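(* For all fixed integers $q\ge 2$, $p\ge 1$ and $m\ge 1$, as $n\to\infty$, $$\sum_{k=1}^{n-1} \frac{(\log k)^p}{(n-k)^q} = \zeta(q) (\log n)^p+ \sum_{i=1}^{q-2} \frac{\zeta(q-i)}{i\,n^i} \sum_{r=1}^{\min(i,p)} c_{p,i,r}(\log n)^{p-r} +\frac{1}{(q-1)\, n^{q-1}} \sum_{r=0}^p d_{p,q,r} (\log n)^{p-r} -\sum_{k=1}^m \bigg( \frac{(-1)^k B_k}{k(k+q-1)} \sum_{r=1}^p c_{p,k+q-1,r}(\log n)^{p-r} -(-1)^p \binom{k+q-2}{q-1} \zeta^{(p)}(1-k) \bigg)\frac{1}{n^{k+q-1}} +O\Big(\frac{(\log n)^{p-1}}{n^{m+q}}\Big).$$ Here, for $1\le r\le p$ and $i\ge1$, $c_{p,i,r} := \dfrac{(-1)^r p!}{(p-r)!}\, S_{r-1,1,i-1}$; for $0\le r\le p$, $$d_{p,q,r} := \frac{(-1)^r p!}{(p-r)!} \times \begin{cases} D_{r,q} -(p-r) S_{r,1,q-2} +S_{r-1,1,q-2}\,\gamma +\displaystyle\sum_{s=2}^r S_{r-s,1,q-2}\, \zeta(s) & \text{if } r\le q-1,\\[2mm] \displaystyle\sum_{s=r-q+2}^r S_{r-s,1,q-2}\, \zeta(s) & \text{if } r\ge q \ (\text{which occurs only if } p\ge q), \end{cases}$$ and $D_{r,q}$ are the rational numbers $$D_{r,q} := \sum_{a=0}^{r-2}\ \sum_{j=1}^{q-r+a} \frac{S_{a,1,j-1}}{j} \bigg(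 \frac{S_{r-2-a,1,q-j-2}}{j} -\sum_{b=1}^{q-j-2} \frac{\sum_{i=0}^{b-1} (-1)^i S_{i,1,b-1}\, S_{r-3-a-i,1,q-j-2-b}}{b(b+j)} \bigg) + \frac{S_{r-1,1,q-2}}{q-1}-S_{r,1,q-2}.$$ In particular, there is no constant term in the asymptotic expansion.
   Context: $B_k$ are the Bernoulli numbers defined by $\frac{t}{e^t-1}=\sum_k B_k\frac{t^k}{k!}$ (so $B_1=-\frac12$); $\gamma$ is Euler's constant; $\zeta^{(p)}$ is the $p$-th derivative of the (analytically continued) Riemann zeta function. $S_{r,s,t}:=\sum_{s\le i_1<\dots<i_r\le t}\frac{1}{i_1\cdots i_r}$ (sum over integers), which is $0$ for $r\ge 1$ and $t<r+s-1$; $S_{0,s,t}:=1$ if $t\ge s-1$, and $S_{r,s,t}:=0$ if $r<0$. Empty sums are $0$. *)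

theory Defs
  imports "HOL-Complex_Analysis.Complex_Analysis" "HOL-Library.Landau_Symbols"
begin

definition bernoulli :: "nat \<Rightarrow> real" where
  "bernoulli k = fact k * fps_nth (fps_X / (fps_exp 1 - 1)) k"

(* The Riemann zeta function as the analytic continuation of its Dirichlet series to the
   complex plane without 1. The value at the pole is irrelevant; it is fixed only to make the
   description unique. *)
definition zeta :: "complex \<Rightarrow> complex" where
  "zeta = (THE f. f holomorphic_on - {1} \<and>
                  (\<forall>s. Re s > 1 \<longrightarrow> (\<lambda>n. 1 / of_nat (Suc n) powr s) sums f s) \<and>
                  f 1 = 0)"

(* The p-th derivative of zeta at a real point. It is real there (zeta commutes with complex
   conjugation), so that taking the real part is merely a change of type. *)
definition zeta_deriv :: "nat \<Rightarrow> real \<Rightarrow> real" where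
  "zeta_deriv p x = Re ((deriv ^^ p) zeta (of_real x))"

abbreviation zeta_real :: "real \<Rightarrow> real" where
  "zeta_real x \<equiv> zeta_deriv 0 x"

(* The sum of 1 / (i_1 ... i_r) over s <= i_1 < ... < i_r <= t; the increasing tuples are
   represented by the sets {i_1, ..., i_r}. Integer arguments, since r and t may become negative
   in formal index computations: S_sum r s t = 0 for r < 0, and S_sum 0 s t = 1. *)
definition S_sum :: "int \<Rightarrow> int \<Rightarrow> int \<Rightarrow> real" where
  "S_sum r s t = (\<Sum>I | I \<subseteq> {s..t} \<and> int (card I) = r. \<Prod>i\<in>I. 1 / real_of_int i)"

definition c_coeff :: "nat \<Rightarrow> nat \<Rightarrow> nat \<Rightarrow> real" where
  "c_coeff p i r = (-1) ^ r * fact p / fact (p - r) * S_sum (int r - 1) 1 (int i - 1)"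

definition D_coeff :: "int \<Rightarrow> int \<Rightarrow> real" where
  "D_coeff r q =
     (\<Sum>a=0..r-2. \<Sum>j=1..q-r+a.
        S_sum a 1 (j-1) / j *
        (S_sum (r-2-a) 1 (q-j-2) / j -
         (\<Sum>b=1..q-j-2.
            (\<Sum>i=0..b-1. (-1) powi i * S_sum i 1 (b-1) * S_sum (r-3-a-i) 1 (q-j-2-b))
            / (b * (b+j)))))
     + S_sum (r-1) 1 (q-2) / (q-1) - S_sum r 1 (q-2)"

definition d_coeff :: "nat \<Rightarrow> nat \<Rightarrow> nat \<Rightarrow> real" where
  "d_coeff p q r =
     (-1) ^ r * fact p / fact (p - r) *
     (if r \<le> q - 1 then
        D_coeff (int r) (int q)
        - (real p - real r) * S_sum (int r) 1 (int q - 2)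
        + S_sum (int r - 1) 1 (int q - 2) * euler_mascheroni
        + (\<Sum>s=2..r. S_sum (int r - int s) 1 (int q - 2) * zeta_real (real s))
      else
        (\<Sum>s=r-q+2..r. S_sum (int r - int s) 1 (int q - 2) * zeta_real (real s)))"

lemma S_sum_neg: "r < 0 \<Longrightarrow> S_sum r s t = 0"
  by (simp add: S_sum_def)

lemma S_sum_0: "S_sum 0 s t = 1"
proof -
  have "{I. I \<subseteq> {s..t} \<and> int (card I) = 0} = {{}}"
    using finite_subset[OF _ finite_atLeastAtMost_int] by (auto simp: card_eq_0_iff)
  then show ?thesis by (simp add: S_sum_def)
qed

lemma S_sum_eq_0:
  assumes "r \<ge> 1" "t < r + s - 1"
  shows "S_sum r s t = 0"
proof -
  have "int (card I) \<noteq> r" if "I \<subseteq> {s..t}" for I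
    using card_mono[OF _ that] assms by simp
  then have "{I. I \<subseteq> {s..t} \<and> int (card I) = r} = {}"
    by blast
  then show ?thesis
    unfolding S_sum_def by (simp only: sum.empty)
qed

lemma sum_in_Rats: "(\<And>x. x \<in> A \<Longrightarrow> f x \<in> \<rat>) \<Longrightarrow> sum f A \<in> (\<rat> :: real set)"
  by (induction A rule: infinite_finite_induct) auto

lemma prod_in_Rats: "(\<And>x. x \<in> A \<Longrightarrow> f x \<in> \<rat>) \<Longrightarrow> prod f A \<in> (\<rat> :: real set)"
  by (induction A rule: infinite_finite_induct) auto

lemma S_sum_Rats: "S_sum r s t \<in> \<rat>"
  unfolding S_sum_def by (rule sum_in_Rats prod_in_Rats Rats_divide Rats_1 Rats_of_int)+

lemma D_coeff_Rats: "D_coeff r q \<in> \<rat>"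
proof -
  have *: "(-1) powi i \<in> (\<rat> :: real set)" for i
    by (simp add: power_int_def)
  show ?thesis
    unfolding D_coeff_def
    by (rule Rats_diff Rats_add Rats_mult Rats_divide sum_in_Rats S_sum_Rats * Rats_of_int)+
qed

end

theory Submission
  imports Defs
begin

text \<open>
  Write \<open>(ln k)^p\<close> as \<open>(-1)^p\<close> times the \<open>p\<close>-th derivative of \<open>k^(-s)\<close> at \<open>s = 0\<close>. It then suffices to
  expand \<open>F(s) = \<Sum>k<n. k^(-s) (n-k)^(-q)\<close> with an error that is uniform for \<open>\<bar>s\<bar> \<le> 1/2\<close>: by
  Cauchy's inequality the error of the expansion may be differentiated, and by power series
  arithmetic in \<open>s\<close> the derivatives of the terms are explicit.

  The sum is cut near \<open>n/2\<close>. On the left part \<open>(n-k)^(-q)\<close> is a convergent power series in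
  \<open>k/n\<close>, on the right part, with \<open>j = n-k\<close>, the same holds for \<open>(n-j)^(-s)\<close> and \<open>j/n\<close>. This leaves sums
  of pure powers \<open>\<Sum>k<N. k^(l-w)\<close>, for which Euler-Maclaurin summation gives a constant, namely
  \<open>\<zeta>(w-l)\<close> (or Euler's constant if \<open>w-l = 1\<close>), plus boundary terms at \<open>N\<close>
  (\<open>pow_regular_approx\<close>, \<open>half_sum_approx\<close>). The constants from the right part are the terms with
  \<open>\<zeta>(q-i)\<close>, and those with \<open>i \<ge> q\<close> turn into Bernoulli numbers; the constants from the left
  part are the terms with \<open>\<zeta>^(p)(1-k)\<close>. Both occur without any remaining reference to the cut,
  because the boundary terms of positive order of the two parts are derivatives of the same
  function seen from opposite sides and cancel (\<open>boundary_cancel\<close>).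

  What remains of the boundary is the two primitives, whose sum is the finite part of
  \<open>\<integral> x^(-s) (1-x)^(-q) dx\<close> over \<open>[0,1]\<close>, independent of the cut. Integration by parts lowers \<open>q\<close>
  to \<open>1\<close> (\<open>beta_const_rec\<close>), where the value is \<open>-\<psi>(1-s) - \<gamma> = \<Sum>k\<ge>2. \<zeta>(k) s^(k-1)\<close>
  (\<open>beta_const_1\<close>). With \<open>P(s) = (1+s/1)...(1+s/(q-2))\<close>, whose coefficients are the sums \<open>S_{r,1,q-2}\<close>,
  and with \<open>H\<close> the harmonic number of \<open>q-1\<close>, the coefficient of \<open>s^r\<close> in \<open>P (s H - 1) - s P'\<close> is
  \<open>S_{r-1,1,q-2} H - (r+1) S_{r,1,q-2}\<close>. That this equals \<open>D_{r,q}\<close> for \<open>r < q\<close> is a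
  separate, purely algebraic fact (\<open>D_coeff_eq_harm\<close>): the generating polynomial of the double sum in \<open>D_{r,q}\<close> collapses to \<open>\<Sum>c. P_{N-c}(s) P_{c-1}(-s) / c^2\<close>, and this is \<open>P_N(s) \<Sum>j. 1 / (j (j+s))\<close> for \<open>N = q-2\<close>.
\<close>

section \<open>Bernoulli numbers and the symmetric sums\<close>

text \<open>The coefficients of \<open>t / (e^t - 1)\<close>, which are the weights of the derivatives in
  Euler-Maclaurin summation.\<close>
definition bern :: "nat \<Rightarrow> real" where "bern k = bernoulli k / fact k"

lemma bern_gf: "Abs_fps bern * (fps_exp 1 - 1) = fps_X"
proof -
  have ne: "fps_exp (1::real) - 1 \<noteq> 0"
  proof
    assume "fps_exp (1::real) - 1 = 0"
    then have "fps_nth (fps_exp (1::real) - 1) 1 = 0" by simp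
    then show False by simp
  qed
  have "subdegree (fps_exp (1::real) - 1) = 1"
    by (rule subdegreeI) auto
  then have "(fps_exp (1::real) - 1) dvd fps_X"
    using ne by (simp add: fps_dvd_iff)
  moreover have "Abs_fps bern = fps_X / (fps_exp 1 - 1)"
    by (rule fps_ext) (simp add: bern_def bernoulli_def)
  ultimately show ?thesis by simp
qed

text \<open>Coefficients of \<open>(t / (e^t - 1)) (e^t - 1) = t\<close>. This is what makes all Taylor coefficients
  but one cancel in \<open>euler_maclaurin_step\<close>.\<close>
lemma bern_convolution:
  "(\<Sum>i<m. bern i / fact (m - i)) = (if m = 1 then 1 else 0)"
proof -
  have "(\<Sum>i<m. bern i / fact (m - i)) = (\<Sum>i=0..m. bern i * fps_nth (fps_exp 1 - 1) (m - i))"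
    by (rule sum.mono_neutral_cong_left) (auto simp: field_simps)
  also have "\<dots> = fps_nth (Abs_fps bern * (fps_exp 1 - 1)) m"
    by (simp add: fps_mult_nth)
  finally show ?thesis by (simp add: bern_gf)
qed

text \<open>Since \<open>t / (1 - e^(-t)) = t + t / (e^t - 1)\<close>, replacing \<open>t\<close> by \<open>-t\<close>
  changes the linear coefficient only. Thus the odd Bernoulli numbers other than the first vanish, and the first one
  changes sign.\<close>
lemma bern_sign: "(-1) ^ k * bern k = (if k = 1 then - bern k else bern k)"
proof -
  define B where "B = Abs_fps bern"
  define E where "E = fps_exp (1::real)"
  have EE: "E * fps_exp (-1) = 1"
    using fps_exp_add_mult[of "1::real" "-1"] by (simp add: E_def)
  have B: "B * (E - 1) = fps_X" unfolding B_def E_def by (rule bern_gf)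
  have "(B * (E - 1)) oo (- fps_X) = (B oo (- fps_X)) * ((E - 1) oo (- fps_X))"
    by (rule fps_compose_mult_distrib) simp
  also have "(E - 1) oo (- fps_X) = fps_exp (-1) - 1"
    by (simp add: E_def fps_compose_sub_distrib fps_exp_compose_linear[of 1 "-1", simplified]
        flip: fps_const_neg)
  finally have 1: "(B oo (- fps_X)) * (fps_exp (-1) - 1) = - fps_X"
    by (simp add: B)
  have "(B oo (- fps_X)) * (E - 1) = - ((B oo (- fps_X)) * (fps_exp (-1) - 1)) * E"
    using EE by (simp add: algebra_simps)
  also have "\<dots> = (fps_X + B) * (E - 1)"
    using B unfolding 1 by (simp add: algebra_simps)
  finally have "B oo (- fps_X) = fps_X + B"
  proof -
    assume *: "(B oo (- fps_X)) * (E - 1) = (fps_X + B) * (E - 1)"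
    have "E - 1 \<noteq> 0" using B by force
    with * show ?thesis by simp
  qed
  then have "fps_nth (B oo (- fps_X)) k = fps_nth (fps_X + B) k" by simp
  moreover have "fps_nth (B oo (- fps_X)) k = (-1) ^ k * bern k"
    using fps_nth_compose_linear[of B "-1" k]
    by (simp add: B_def flip: fps_const_neg)
  moreover have "bern 1 = -1/2"
    using bern_convolution[of 2] bern_convolution[of 1]
    by (simp add: numeral_2_eq_2)
  ultimately show ?thesis by (auto simp: B_def split: if_splits)
qed

lemma bern_0: "bern 0 = 1" and bern_1: "bern 1 = - 1 / 2"
  using bern_convolution[of 2] bern_convolution[of 1] by (simp_all add: numeral_2_eq_2)

text \<open>A subset of \<open>{1..n+1}\<close> either avoids \<open>n+1\<close> or contributes the factor \<open>1 /
  (n+1)\<close>.\<close>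
lemma S_sum_Suc:
  "S_sum r 1 (int (Suc n)) = S_sum r 1 (int n) + S_sum (r - 1) 1 (int n) / real (Suc n)"
proof -
  let ?m = "int (Suc n)"
  let ?A = "{I. I \<subseteq> {1..int n} \<and> int (card I) = r}"
  let ?B = "{I. I \<subseteq> {1..int n} \<and> int (card I) = r - 1}"
  have fin: "finite ?A" "finite ?B" by (auto intro: finite_subset[of _ "Pow {1..int n}"])
  have fI: "finite I \<and> ?m \<notin> I" if "I \<subseteq> {1..int n}" for I
    using that finite_subset by fastforce
  have set: "{1..?m} = insert ?m {1..int n}" by auto
  have eq: "{I. I \<subseteq> {1..?m} \<and> int (card I) = r} = ?A \<union> insert ?m ` ?B" (is "?L = ?R")
  proof
    show "?L \<subseteq> ?R"
    proof
      fix I assume I: "I \<in> ?L"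
      show "I \<in> ?R"
      proof (cases "?m \<in> I")
        case False
        with I set show ?thesis by auto
      next
        case True
        have "finite I" using I finite_subset by blast
        then have "int (card (I - {?m})) = r - 1"
          using True I by (simp add: of_nat_diff card_gt_0_iff Suc_leI) 
             (metis One_nat_def Suc_leI card_gt_0_iff empty_iff of_nat_diff of_nat_1)
        moreover have "I - {?m} \<subseteq> {1..int n}" using I set by auto
        ultimately have "I - {?m} \<in> ?B" by simp
        then show ?thesis using True by (metis (no_types, lifting) UnI2 image_eqI insert_Diff)
      qed
    qed
    show "?R \<subseteq> ?L"
      using fI set by (auto simp: card_insert_if)
  qed
  have inj: "inj_on (insert ?m) ?B"
    by (rule inj_onI) (metis (no_types, lifting) fI insert_ident mem_Collect_eq)
  have "S_sum r 1 ?m = (\<Sum>I\<in>?A. \<Prod>i\<in>I. 1 / real_of_int i) + (\<Sum>I\<in>insert ?m ` ?B. \<Prod>i\<in>I. 1 / real_of_int i)"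
    unfolding S_sum_def eq using fin fI by (intro sum.union_disjoint) auto
  also have "(\<Sum>I\<in>insert ?m ` ?B. \<Prod>i\<in>I. 1 / real_of_int i) = (\<Sum>I\<in>?B. \<Prod>i\<in>insert ?m I. 1 / real_of_int i)"
    using inj by (simp add: sum.reindex)
  also have "\<dots> = (\<Sum>I\<in>?B. (\<Prod>i\<in>I. 1 / real_of_int i) / real (Suc n))"
    using fI by (intro sum.cong refl) (subst prod.insert, auto)
  finally show ?thesis by (simp add: S_sum_def sum_divide_distrib)
qed

lemma S_sum_nat_eq_0: "r > int n \<Longrightarrow> S_sum r 1 (int n) = 0"
  by (rule S_sum_eq_0) auto

text \<open>The generating polynomial of the sums \<open>S_sum r 1 n\<close>. Identities between these sums are proved
  by evaluating such polynomials at a number \<open>s\<close>, where \<open>rising_poly n\<close> has the value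
  \<open>(s+1)...(s+n) / n!\<close>.\<close>
definition rising_poly :: "nat \<Rightarrow> real poly" where
  "rising_poly n = (\<Prod>j=1..n. [:1, 1 / real j:])"

lemma rising_poly_0 [simp]: "rising_poly 0 = 1" by (simp add: rising_poly_def)

lemma rising_poly_Suc: "rising_poly (Suc n) = rising_poly n * [:1, 1 / real (Suc n):]"
  by (simp add: rising_poly_def mult.commute)

lemma coeff_rising_poly: "coeff (rising_poly n) r = S_sum (int r) 1 (int n)"
proof (induction n arbitrary: r)
  case 0
  then show ?case using S_sum_0[of 1 0] S_sum_nat_eq_0[of 0 "int r"] by (cases r) auto
next
  case (Suc n)
  show ?case
  proof (cases r)
    case 0
    then show ?thesis using Suc[of 0] by (simp add: rising_poly_Suc S_sum_Suc S_sum_neg S_sum_0 mult.commute[of "rising_poly n"])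
  next
    case (Suc r')
    then show ?thesis using Suc.IH[of r] Suc.IH[of r']
      by (simp add: rising_poly_Suc S_sum_Suc mult.commute[of "rising_poly n"] del: of_nat_Suc) simp
  qed
qed

section \<open>Rising factorials\<close>

text \<open>The coefficients of \<open>(1 - z)^(-a)\<close>.\<close>
definition rising :: "'a::field_char_0 \<Rightarrow> nat \<Rightarrow> 'a" where
  "rising a n = pochhammer a n / fact n"

lemma rising_0 [simp]: "rising a 0 = 1" by (simp add: rising_def)

lemma rising_Suc: "rising a (Suc n) = rising a n * (a + of_nat n) / of_nat (Suc n)"
  by (simp add: rising_def pochhammer_Suc field_simps)

lemma rising_gbinomial: "rising a n = (-1) ^ n * ((-a) gchoose n)"
  by (simp add: rising_def gbinomial_pochhammer)

text \<open>The product of the series of \<open>(1 - z)^(-a)\<close> and \<open>(1 - z)^(-b)\<close>.\<close>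
lemma rising_Vandermonde: "(\<Sum>k\<le>n. rising a k * rising b (n - k)) = rising (a + b) n"
proof -
  have "(\<Sum>k\<le>n. rising a k * rising b (n - k))
      = (\<Sum>k=0..n. (-1) ^ n * (((-a) gchoose k) * ((-b) gchoose (n - k))))"
    unfolding atLeast0AtMost rising_gbinomial
    by (intro sum.cong refl) (simp add: algebra_simps flip: power_add)
  also have "\<dots> = (-1) ^ n * ((- a + - b) gchoose n)"
    by (simp only: gbinomial_Vandermonde flip: sum_distrib_left)
  finally show ?thesis by (simp add: rising_gbinomial)
qed

lemma poly_rising_poly: "poly (rising_poly n) s = rising (s + 1) n"
  by (induction n) (simp_all add: rising_poly_Suc rising_Suc field_simps)

lemma rising_shift: "rising s (Suc n) = s * rising (s + 1) n / of_nat (Suc n)"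
  by (simp add: rising_def pochhammer_rec field_simps)

section \<open>The closed form of the coefficients D\<close>

lemma sum_triangle_swap:
  "(\<Sum>j=1..n. \<Sum>c=j..n. f j c) = (\<Sum>c=1..n. \<Sum>j=1..c. f j (c::nat))"
  by (subst (1 2) sum.Sigma) (auto intro!: sum.reindex_bij_witness[of _ prod.swap prod.swap])

text \<open>Coefficients of \<open>(1 - x)^(-s) (1 - x)^s = 1\<close>: the term \<open>j = 0\<close> of this
  convolution is moved to the other side, and a factor \<open>s\<close> is cancelled.\<close>
lemma rising_inverse_convolution:
  fixes s :: "'a::field_char_0"
  assumes "s \<noteq> 0"
  shows "(\<Sum>j=1..c. rising (s + 1) (j - 1) / of_nat j * rising (- s) (c - j))
       = (if c = 0 then 0 else rising (1 - s) (c - 1) / of_nat c)"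
proof (cases c)
  case (Suc c')
  have "0 = (\<Sum>k\<le>c. rising s k * rising (- s) (c - k))"
    by (subst rising_Vandermonde) (simp add: rising_def Suc pochhammer_rec)
  also have "\<dots> = rising (- s) c + (\<Sum>j=1..c. rising s j * rising (- s) (c - j))"
    by (simp add: atMost_atLeast0 sum.atLeast_Suc_atMost)
  also have "(\<Sum>j=1..c. rising s j * rising (- s) (c - j))
     = s * (\<Sum>j=1..c. rising (s + 1) (j - 1) / of_nat j * rising (- s) (c - j))"
    unfolding sum_distrib_left
  proof (rule sum.cong[OF refl])
    fix j assume "j \<in> {1..c}"
    then obtain i where "j = Suc i" by (cases j) auto
    then show "rising s j * rising (- s) (c - j) = s * (rising (s + 1) (j - 1) / of_nat j * rising (- s) (c - j))"
      by (simp add: rising_shift)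
  qed
  also have "rising (- s) c = - s * (rising (1 - s) (c - 1) / of_nat c)"
    by (simp add: Suc rising_shift)
  finally have eq: "0 = - s * (rising (1 - s) (c - 1) / of_nat c) +
      s * (\<Sum>j=1..c. rising (s + 1) (j - 1) / of_nat j * rising (- s) (c - j))" .
  have "B = A" if "0 = - s * A + s * B" for A B
    using that assms by simp
  from this[OF eq] show ?thesis using Suc by simp
qed simp

text \<open>Coefficients of \<open>(1 - x)^(-1-s) (1 - (1 - x)^s) / s\<close>.\<close>
lemma rising_convolution_shift:
  fixes s :: "'a::field_char_0"
  assumes "s \<noteq> 0"
  shows "(\<Sum>c=1..n. rising (s + 1) (n - c) * rising (1 - s) (c - 1) / of_nat c)
       = (rising (s + 1) n - 1) / s"
proof -
  have "1 = (\<Sum>k\<le>n. rising (- s) k * rising (s + 1) (n - k))"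
    by (subst rising_Vandermonde) (simp add: rising_def flip: pochhammer_fact)
  also have "\<dots> = rising (s + 1) n + (\<Sum>c=1..n. rising (- s) c * rising (s + 1) (n - c))"
    by (simp add: atMost_atLeast0 sum.atLeast_Suc_atMost)
  also have "(\<Sum>c=1..n. rising (- s) c * rising (s + 1) (n - c))
     = - s * (\<Sum>c=1..n. rising (s + 1) (n - c) * rising (1 - s) (c - 1) / of_nat c)"
    unfolding sum_distrib_left
  proof (rule sum.cong[OF refl])
    fix j assume "j \<in> {1..n}"
    then obtain i where "j = Suc i" by (cases j) auto
    then show "rising (- s) j * rising (s + 1) (n - j) = - s * (rising (s + 1) (n - j) * rising (1 - s) (j - 1) / of_nat j)"
      by (simp add: rising_shift)
  qed
  finally show ?thesis using assms by (simp add: field_simps)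
qed

text \<open>The value at \<open>s\<close> of the generating polynomial of the double sum in \<open>D_coeff\<close>;
  see \<open>poly_D_poly\<close>.\<close>
definition weighted_convolution :: "nat \<Rightarrow> real \<Rightarrow> real" where
  "weighted_convolution n s = (\<Sum>c=1..n. rising (s + 1) (n - c) * rising (1 - s) (c - 1) / real c ^ 2)"

text \<open>Write \<open>n + 1 = (n + 1 - c) + c\<close> in the \<open>c\<close>-th summand. The factor \<open>n + 1 -
  c\<close> lowers the index of the first rising factorial; the factor \<open>c\<close> cancels against
  \<open>c^2\<close> and leaves a difference of two sums that \<open>rising_convolution_shift\<close>
  evaluates.\<close>
lemma weighted_convolution_Suc:
  assumes "s \<noteq> 0"
  shows "real (Suc n) * weighted_convolution (Suc n) s
       = (real (Suc n) + s) * weighted_convolution n s + rising (s + 1) n / real (Suc n)"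
proof -
  let ?f = "\<lambda>n c. rising (s + 1) (n - c) * rising (1 - s) (c - 1)"
  have step: "real (Suc n) * (?f (Suc n) c / real c ^ 2)
      = (real (Suc n) + s) * (?f n c / real c ^ 2) - ?f n c / real c + ?f (Suc n) c / real c"
    if "c \<in> {1..n}" for c
  proof -
    have "Suc n - c = Suc (n - c)" using that by auto
    then have "rising (s + 1) (Suc n - c) * real (Suc n - c) = rising (s + 1) (n - c) * (s + 1 + real (n - c))"
      by (simp add: rising_Suc del: of_nat_Suc)
    then have 1: "rising (s + 1) (Suc n - c) * (real (Suc n) - real c) = rising (s + 1) (n - c) * (real (Suc n) + s - real c)"
      using that by (simp add: of_nat_diff algebra_simps)
    define A where "A = rising (s + 1) (Suc n - c)"
    define B where "B = rising (s + 1) (n - c)"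
    define Q where "Q = rising (1 - s) (c - 1)"
    define N where "N = real (Suc n)"
    have "A * (N - c) * Q = B * (N + s - c) * Q" using 1 by (simp add: A_def B_def N_def)
    then have "N * (A * Q) = (N + s) * (B * Q) - c * (B * Q) + c * (A * Q)" by (simp add: algebra_simps)
    then have "N * (A * Q) / c^2 = ((N + s) * (B * Q) - c * (B * Q) + c * (A * Q)) / c^2" by simp
    also have "\<dots> = (N + s) * (B * Q / c^2) - B * Q / c + A * Q / c"
      using that by (simp add: add_divide_distrib diff_divide_distrib power2_eq_square)
    finally show ?thesis by (simp add: A_def B_def Q_def N_def)
  qed
  have "real (Suc n) * weighted_convolution (Suc n) s
     = (\<Sum>c=1..n. real (Suc n) * (?f (Suc n) c / real c ^ 2)) + real (Suc n) * (?f (Suc n) (Suc n) / real (Suc n) ^ 2)"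
    by (simp add: weighted_convolution_def distrib_left sum_distrib_left del: of_nat_Suc)
  also have "(\<Sum>c=1..n. real (Suc n) * (?f (Suc n) c / real c ^ 2))
     = (real (Suc n) + s) * weighted_convolution n s - (\<Sum>c=1..n. ?f n c / real c) + (\<Sum>c=1..n. ?f (Suc n) c / real c)"
    unfolding weighted_convolution_def sum_distrib_left
    by (subst sum.cong[OF refl step]) (simp_all add: sum.distrib sum_subtractf)
  also have "real (Suc n) * (?f (Suc n) (Suc n) / real (Suc n) ^ 2) = ?f (Suc n) (Suc n) / real (Suc n)"
    by (simp add: power2_eq_square del: of_nat_Suc)
  finally have "real (Suc n) * weighted_convolution (Suc n) s
    = (real (Suc n) + s) * weighted_convolution n s - (\<Sum>c=1..n. ?f n c / real c) + (\<Sum>c=1..Suc n. ?f (Suc n) c / real c)"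
    by simp
  also have "\<dots> = (real (Suc n) + s) * weighted_convolution n s + (rising (s + 1) (Suc n) - rising (s + 1) n) / s"
    by (simp only: rising_convolution_shift[OF assms]) (simp add: diff_divide_distrib)
  also have "(rising (s + 1) (Suc n) - rising (s + 1) n) / s = rising (s + 1) n / real (Suc n)"
  proof -
    have "rising (s + 1) (Suc n) = rising (s + 1) n + s * (rising (s + 1) n / real (Suc n))"
      by (simp add: rising_Suc field_simps)
    then show ?thesis using assms by simp
  qed
  finally show ?thesis .
qed

text \<open>Induction with the recurrence above. By the logarithmic derivative of \<open>(s+1)...(s+n)\<close>, the
  right-hand side is \<open>s^2 rising (s+1) n\<close> times \<open>\<Sum>j\<le>n. 1 / (j (j+s))\<close> for \<open>s
  > 0\<close>; the form below avoids the poles.\<close>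
lemma weighted_convolution_eq:
  assumes "s \<noteq> 0"
  shows "s\<^sup>2 * weighted_convolution n s
       = s * rising (s + 1) n * harm n - s * poly (pderiv (rising_poly n)) s"
proof (induction n)
  case 0
  then show ?case by (simp add: weighted_convolution_def harm_def)
next
  case (Suc n)
  define N where "N = real (Suc n)"
  have N: "N > 0" by (simp add: N_def)
  let ?W = "weighted_convolution" and ?P = "rising (s + 1)" and ?d = "\<lambda>n. poly (pderiv (rising_poly n)) s"
  have d: "?d (Suc n) = ?d n * (1 + s / N) + ?P n / N"
  proof -
    have "pderiv [:1, 1 / N:] = [:1 / N:]" by (simp add: pderiv_pCons)
    then show ?thesis
      unfolding rising_poly_Suc pderiv_mult N_def[symmetric] by (simp add: poly_rising_poly field_simps)
  qed
  have P: "?P (Suc n) = ?P n * (1 + s / N)"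
    by (simp add: rising_Suc N_def field_simps)
  have H: "harm (Suc n) = harm n + 1 / N"
    by (simp add: harm_Suc N_def inverse_eq_divide)
  have "N * ?W (Suc n) s = (N + s) * ?W n s + ?P n / N"
    using weighted_convolution_Suc[OF assms, of n] by (simp add: N_def)
  then have "?W (Suc n) s = (1 + s / N) * ?W n s + ?P n / N\<^sup>2"
    using N by (simp add: field_simps power2_eq_square)
  then have "s\<^sup>2 * ?W (Suc n) s = (1 + s / N) * (s\<^sup>2 * ?W n s) + s\<^sup>2 * ?P n / N\<^sup>2"
    by (simp add: algebra_simps)
  also have "\<dots> = s * ?P (Suc n) * harm (Suc n) - s * ?d (Suc n)"
    unfolding Suc d P H using N by (simp add: field_simps power2_eq_square)
  finally show ?case .
qed

text \<open>The coefficient of \<open>X^(r-2)\<close> in \<open>D_poly (q-2)\<close> is the double sum in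
  \<open>D_coeff r q\<close>: products of sums \<open>S_sum\<close> summed over \<open>a\<close> and \<open>i\<close>
  are coefficients of products of polynomials.\<close>
definition D_poly :: "nat \<Rightarrow> real poly" where
  "D_poly n = (\<Sum>j=1..n. smult (1 / real j) (rising_poly (j - 1)) *
     (smult (1 / real j) (rising_poly (n - j)) -
      pCons 0 (\<Sum>b=1..n-j. smult (1 / (real b * (real b + real j)))
         (pcompose (rising_poly (b - 1)) [:0, -1:] * rising_poly (n - j - b)))))"

text \<open>The numbers \<open>-s rising (1-s) (b-1) / b\<close> are the coefficients \<open>rising (-s) b\<close> of
  \<open>(1-x)^s\<close>, and the first summand in the bracket of \<open>D_poly\<close> is the missing term \<open>b =
  0\<close>. So the bracket is a single sum over \<open>c = j + b\<close>, and for fixed \<open>c\<close> the sum over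
  \<open>j\<close> is \<open>rising_inverse_convolution\<close>.\<close>
lemma poly_D_poly:
  assumes "s \<noteq> 0"
  shows "poly (D_poly n) s = weighted_convolution n s"
proof -
  let ?P = "rising (s + 1)" and ?e = "rising (- s)"
  have inner: "?P (n - j) / real j - s * (\<Sum>b=1..n-j. rising (1 - s) (b - 1) * ?P (n - j - b) / (real b * (real b + real j)))
      = (\<Sum>c=j..n. ?P (n - c) * ?e (c - j) / real c)" if j: "j \<in> {1..n}" for j
  proof -
    have "(\<Sum>c=j..n. ?P (n - c) * ?e (c - j) / real c) = (\<Sum>b=0..n-j. ?P (n - j - b) * ?e b / (real b + real j))"
      using j by (intro sum.reindex_bij_witness[of _ "\<lambda>b. b + j" "\<lambda>c. c - j"]) (auto simp: of_nat_diff)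
    also have "\<dots> = ?P (n - j) / real j + (\<Sum>b=1..n-j. ?P (n - j - b) * ?e b / (real b + real j))"
      by (simp add: sum.atLeast_Suc_atMost)
    also have "(\<Sum>b=1..n-j. ?P (n - j - b) * ?e b / (real b + real j))
       = - s * (\<Sum>b=1..n-j. rising (1 - s) (b - 1) * ?P (n - j - b) / (real b * (real b + real j)))"
      unfolding sum_distrib_left
    proof (rule sum.cong[OF refl])
      fix b assume "b \<in> {1..n-j}"
      then obtain i where "b = Suc i" by (cases b) auto
      then show "?P (n - j - b) * ?e b / (real b + real j)
          = - s * (rising (1 - s) (b - 1) * ?P (n - j - b) / (real b * (real b + real j)))"
        by (simp add: rising_shift)
    qed
    finally show ?thesis by simp
  qed
  have "poly (D_poly n) s = (\<Sum>j=1..n. ?P (j - 1) / real j *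
     (?P (n - j) / real j - s * (\<Sum>b=1..n-j. rising (1 - s) (b - 1) * ?P (n - j - b) / (real b * (real b + real j)))))"
    by (simp add: D_poly_def poly_sum poly_pcompose poly_rising_poly)
  also have "\<dots> = (\<Sum>j=1..n. \<Sum>c=j..n. ?P (j - 1) / real j * (?P (n - c) * ?e (c - j) / real c))"
    unfolding sum_distrib_left[symmetric] by (intro sum.cong refl) (simp only: inner)
  also have "\<dots> = (\<Sum>c=1..n. \<Sum>j=1..c. ?P (j - 1) / real j * (?P (n - c) * ?e (c - j) / real c))"
    by (rule sum_triangle_swap)
  also have "\<dots> = (\<Sum>c=1..n. ?P (n - c) / real c * (\<Sum>j=1..c. ?P (j - 1) / real j * ?e (c - j)))"
    unfolding sum_distrib_left by (intro sum.cong refl) (simp add: mult_ac)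
  also have "\<dots> = weighted_convolution n s"
    unfolding weighted_convolution_def
    by (intro sum.cong refl) (subst rising_inverse_convolution[OF assms], auto simp: power2_eq_square)
  finally show ?thesis .
qed

text \<open>Evaluation at \<open>s \<noteq> 0\<close> is \<open>weighted_convolution_eq\<close>; the factor
  \<open>X^2\<close> makes the identity trivial at \<open>s = 0\<close>.\<close>
lemma D_poly_eq:
  "[:0, 0, 1:] * D_poly n = pCons 0 (smult (harm n) (rising_poly n)) - pCons 0 (pderiv (rising_poly n))"
proof -
  have "poly ([:0, 0, 1:] * D_poly n) s = poly (pCons 0 (smult (harm n) (rising_poly n)) - pCons 0 (pderiv (rising_poly n))) s" for s
    using weighted_convolution_eq[of s n]
    by (cases "s = 0") (simp_all add: poly_D_poly poly_rising_poly power2_eq_square algebra_simps)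
  then show ?thesis by (simp add: poly_eq_poly_eq_iff[symmetric] fun_eq_iff)
qed

lemma coeff_D_poly:
  "coeff (D_poly n) k = S_sum (int k + 1) 1 (int n) * harm n - (real k + 2) * S_sum (int k + 2) 1 (int n)"
proof -
  have "coeff ([:0, 0, 1:] * D_poly n) (Suc (Suc k)) = coeff (D_poly n) k"
    by simp
  then show ?thesis
    unfolding D_poly_eq by (simp add: coeff_rising_poly coeff_pderiv algebra_simps)
qed

lemma coeff_pcompose_uminus: "coeff (pcompose p [:0, -1:]) i = (-1) ^ i * coeff p (i::nat)" for p :: "real poly"
proof (induction p arbitrary: i)
  case (pCons a p)
  then show ?case by (cases i) (simp_all add: pcompose_pCons)
qed simp

lemma sum_int_atLeast0: "(\<Sum>i=0..int n. f i) = (\<Sum>i\<le>n. f (int i))"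
  by (rule sum.reindex_bij_witness[of _ int nat]) auto

lemma sum_int_atLeast1: "(\<Sum>i=1..int n. f i) = (\<Sum>i=1..n. f (int i))"
  by (rule sum.reindex_bij_witness[of _ int nat]) auto

text \<open>The sums over \<open>i\<close> in \<open>D_coeff\<close> and in the product of polynomials have different
  ranges, but the summands in which the ranges differ contain a sum \<open>S_sum\<close> with a negative first
  argument or over too few numbers.\<close>
lemma coeff_signed_rising_poly_product:
  assumes "b \<ge> 1"
  shows "coeff (pCons 0 (pcompose (rising_poly (b - 1)) [:0, -1:] * rising_poly n)) k
       = (\<Sum>i=0..int b-1. (-1) powi i * S_sum i 1 (int b - 1) * S_sum (int k - 1 - i) 1 (int n))"
proof -
  have r: "(\<Sum>i=0..int b-1. (-1) powi i * S_sum i 1 (int b - 1) * S_sum (int k - 1 - i) 1 (int n))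
    = (\<Sum>i\<le>b-1. (-1) ^ i * S_sum (int i) 1 (int (b - 1)) * S_sum (int k - 1 - int i) 1 (int n))"
  proof -
    have b: "int b - 1 = int (b - 1)" using assms by simp
    show ?thesis unfolding b sum_int_atLeast0 by (simp add: power_int_def)
  qed
  show ?thesis
  proof (cases k)
    case 0
    then show ?thesis unfolding r by (simp add: S_sum_neg)
  next
    case (Suc k')
    have "coeff (pCons 0 (pcompose (rising_poly (b - 1)) [:0, -1:] * rising_poly n)) k
       = (\<Sum>i\<le>k'. (-1) ^ i * S_sum (int i) 1 (int (b - 1)) * S_sum (int k - 1 - int i) 1 (int n))"
      by (simp add: Suc coeff_mult coeff_pcompose_uminus coeff_rising_poly of_nat_diff)
    also have "\<dots> = (\<Sum>i\<le>min k' (b-1). (-1) ^ i * S_sum (int i) 1 (int (b - 1)) * S_sum (int k - 1 - int i) 1 (int n))"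
      by (rule sum.mono_neutral_right) (auto simp: S_sum_nat_eq_0)
    also have "\<dots> = (\<Sum>i\<le>b-1. (-1) ^ i * S_sum (int i) 1 (int (b - 1)) * S_sum (int k - 1 - int i) 1 (int n))"
      by (rule sum.mono_neutral_left) (auto simp: S_sum_neg Suc)
    finally show ?thesis unfolding r .
  qed
qed

text \<open>The double sum is a coefficient of \<open>D_poly\<close>. In \<open>D_coeff\<close> the index
  \<open>j\<close> stops at \<open>q - r + a\<close> rather than at \<open>q - 2\<close>, but the missing summands
  vanish.\<close>
lemma D_coeff_eq_harm:
  assumes "q \<ge> 2" "r \<le> q - 1"
  shows "D_coeff (int r) (int q)
       = S_sum (int r - 1) 1 (int q - 2) * harm (q - 1) - (real r + 1) * S_sum (int r) 1 (int q - 2)"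
proof -
  define n where "n = q - 2"
  have q: "q = n + 2" using assms by (simp add: n_def)
  have qn: "int q - 2 = int n" by (simp add: q)
  have h: "harm (q - 1) = harm n + 1 / (real q - 1)"
    by (simp add: q harm_Suc inverse_eq_divide add_ac)
  let ?C = "\<Sum>a=0..int r-2. \<Sum>j=1..int q-int r+a.
        S_sum a 1 (j-1) / j *
        (S_sum (int r-2-a) 1 (int q-j-2) / j -
         (\<Sum>b=1..int q-j-2.
            (\<Sum>i=0..b-1. (-1) powi i * S_sum i 1 (b-1) * S_sum (int r-3-a-i) 1 (int q-j-2-b))
            / (b * (b+j))))"
  have C: "?C = S_sum (int r - 1) 1 (int n) * harm n - real r * S_sum (int r) 1 (int n)"
  proof (cases "r \<ge> 2")
    case False
    then consider "r = 0" | "r = 1" by linarith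
    then show ?thesis
    proof cases
      case 1 then show ?thesis by (simp add: S_sum_neg)
    next
      case 2
      have "S_sum 1 1 (int n) = harm n"
        by (induction n) (use S_sum_nat_eq_0[of 0 1] S_sum_Suc[of 1] in \<open>auto simp: S_sum_0 harm_def inverse_eq_divide\<close>)
      with 2 show ?thesis by (simp add: S_sum_0)
    qed
  next
    case True
    then obtain k where r: "r = k + 2" using le_Suc_ex by (metis add.commute)
    let ?in = "\<lambda>a j. S_sum (int k - a) 1 (int n - j) / j -
         (\<Sum>b=1..int n-j.
            (\<Sum>i=0..b-1. (-1) powi i * S_sum i 1 (b-1) * S_sum (int k-1-a-i) 1 (int n-j-b))
            / (b * (b+j)))"
    have van: "?in (int a) (int j) = 0" if "a \<le> k" "j \<le> n" "int n - int k + int a < int j" for a j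
    proof -
      have 1: "S_sum (int k - int a) 1 (int n - int j) = 0"
        using that by (intro S_sum_eq_0) auto
      have 2: "S_sum (int k-1-int a-i) 1 (int n-int j-b) = 0"
        if "b \<in> {1..int n-int j}" "i \<in> {0..b-1}" for i b
        using that \<open>int n - int k + int a < int j\<close> by (intro S_sum_eq_0) auto
      have "(\<Sum>b=1..int n-int j.
            (\<Sum>i=0..b-1. (-1) powi i * S_sum i 1 (b-1) * S_sum (int k-1-int a-i) 1 (int n-int j-b))
            / (b * (b+int j))) = 0"
        by (intro sum.neutral ballI) (simp add: 2 sum.neutral)
      then show ?thesis by (simp add: 1)
    qed
    have inner: "?in (int a) (int j) = coeff (smult (1 / real j) (rising_poly (n - j)) -
      pCons 0 (\<Sum>b=1..n-j. smult (1 / (real b * (real b + real j)))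
         (pcompose (rising_poly (b - 1)) [:0, -1:] * rising_poly (n - j - b)))) (k - a)"
      if "a \<le> k" "j \<le> n" for a j
    proof -
      have "(\<Sum>b=1..int n-int j.
            (\<Sum>i=0..b-1. (-1) powi i * S_sum i 1 (b-1) * S_sum (int k-1-int a-i) 1 (int n-int j-b))
            / (b * (b+int j)))
         = (\<Sum>b=1..n-j. 1 / (real b * (real b + real j)) *
            coeff (pCons 0 (pcompose (rising_poly (b - 1)) [:0, -1:] * rising_poly (n - j - b))) (k - a))"
      proof -
        have nj: "int n - int j = int (n - j)" using that by simp
        show ?thesis
          unfolding nj sum_int_atLeast1
          using that by (intro sum.cong refl) (subst coeff_signed_rising_poly_product, auto simp: of_nat_diff algebra_simps)
      qed
      also have "\<dots> = coeff (pCons 0 (\<Sum>b=1..n-j. smult (1 / (real b * (real b + real j)))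
         (pcompose (rising_poly (b - 1)) [:0, -1:] * rising_poly (n - j - b)))) (k - a)"
        by (simp add: coeff_pCons coeff_sum split: nat.splits)
      finally show ?thesis using that by (simp add: coeff_rising_poly of_nat_diff)
    qed
    have "?C = (\<Sum>a=0..int k. \<Sum>j=1..int n - int k + a. S_sum a 1 (j-1) / j * ?in a j)"
      by (simp add: r q algebra_simps)
    also have "\<dots> = (\<Sum>a\<le>k. \<Sum>j=1..int n - int k + int a. S_sum (int a) 1 (j-1) / j * ?in (int a) j)"
      by (rule sum_int_atLeast0)
    also have "\<dots> = (\<Sum>a\<le>k. \<Sum>j=1..n. S_sum (int a) 1 (int (j-1)) / real j * ?in (int a) (int j))"
    proof (rule sum.cong[OF refl])
      fix a assume "a \<in> {..k}"
      then have a: "a \<le> k" by simp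
      have "(\<Sum>j=1..int n - int k + int a. S_sum (int a) 1 (j-1) / j * ?in (int a) j)
          = (\<Sum>j=1..int n. S_sum (int a) 1 (j-1) / j * ?in (int a) j)"
      proof (rule sum.mono_neutral_left)
        show "\<forall>j\<in>{1..int n} - {1..int n - int k + int a}. S_sum (int a) 1 (j-1) / j * ?in (int a) j = 0"
        proof
          fix j assume j: "j \<in> {1..int n} - {1..int n - int k + int a}"
          then have "?in (int a) (int (nat j)) = 0" by (intro van[OF a]) auto
          with j show "S_sum (int a) 1 (j-1) / j * ?in (int a) j = 0" by simp
        qed
      qed (use a in auto)
      also have "\<dots> = (\<Sum>j=1..n. S_sum (int a) 1 (int (j-1)) / real j * ?in (int a) (int j))"
        unfolding sum_int_atLeast1 by (intro sum.cong refl) (simp add: of_nat_diff)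
      finally show "(\<Sum>j=1..int n - int k + int a. S_sum (int a) 1 (j-1) / j * ?in (int a) j) = \<dots>" .
    qed
    also have "\<dots> = (\<Sum>j=1..n. \<Sum>a\<le>k. S_sum (int a) 1 (int (j-1)) / real j * ?in (int a) (int j))"
      by (rule sum.swap)
    also have "\<dots> = coeff (D_poly n) k"
      unfolding D_poly_def coeff_sum coeff_mult
    proof (intro sum.cong refl)
      fix j a assume "j \<in> {1..n}" "a \<in> {..k}"
      then have "?in (int a) (int j) = coeff (smult (1 / real j) (rising_poly (n - j)) -
        pCons 0 (\<Sum>b=1..n-j. smult (1 / (real b * (real b + real j)))
         (pcompose (rising_poly (b - 1)) [:0, -1:] * rising_poly (n - j - b)))) (k - a)"
        by (intro inner) auto
      then show "S_sum (int a) 1 (int (j-1)) / real j * ?in (int a) (int j)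
        = coeff (smult (1 / real j) (rising_poly (j - 1))) a * coeff (smult (1 / real j) (rising_poly (n - j)) -
        pCons 0 (\<Sum>b=1..n-j. smult (1 / (real b * (real b + real j)))
         (pcompose (rising_poly (b - 1)) [:0, -1:] * rising_poly (n - j - b)))) (k - a)"
        unfolding coeff_smult coeff_rising_poly by simp
    qed
    also have "\<dots> = S_sum (int r - 1) 1 (int n) * harm n - real r * S_sum (int r) 1 (int n)"
      by (simp add: coeff_D_poly r algebra_simps)
    finally show ?thesis .
  qed
  show ?thesis
    unfolding D_coeff_def C h qn by (simp add: qn algebra_simps)
qed

section \<open>Euler-Maclaurin summation of powers and the zeta function\<close>

text \<open>Index \<open>0\<close> is a primitive of \<open>x^(-w)\<close>, index \<open>i\<close> its
  \<open>i\<close>-th derivative. Including the logarithm for \<open>w = 1\<close> makes the pole of the zeta function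
  harmless in all that follows.\<close>
fun pow_prim :: "nat \<Rightarrow> complex \<Rightarrow> complex \<Rightarrow> complex" where
  "pow_prim 0 w x = (if w = 1 then ln x else x powr (1 - w) / (1 - w))"
| "pow_prim (Suc i) w x = (-1) ^ i * pochhammer w i * x powr (- w - of_nat i)"

lemma has_field_derivative_pow_prim:
  assumes "x \<notin> \<real>\<^sub>\<le>\<^sub>0"
  shows "(pow_prim i w has_field_derivative pow_prim (Suc i) w x) (at x within A)"
proof (cases i)
  case 0
  show ?thesis
  proof (cases "w = 1")
    case True
    have "((\<lambda>x. ln x) has_field_derivative inverse x) (at x within A)"
      using assms by (auto intro!: derivative_eq_intros)
    moreover have "inverse x = x powr (-1)" using assms by (simp add: powr_minus)
    moreover have "pow_prim 0 1 = ln" by (rule ext) simp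
    ultimately show ?thesis using True 0 by simp
  next
    case False
    have "((\<lambda>x. x powr (1 - w) / (1 - w)) has_field_derivative x powr (- w)) (at x within A)"
      using assms False by (auto intro!: derivative_eq_intros)
    moreover have "pow_prim 0 w = (\<lambda>x. x powr (1 - w) / (1 - w))" using False by (intro ext) simp
    ultimately show ?thesis using False 0 by simp
  qed
next
  case (Suc j)
  have "((\<lambda>x. (-1) ^ j * pochhammer w j * x powr (- w - of_nat j)) has_field_derivative
      (-1) ^ j * pochhammer w j * ((- w - of_nat j) * x powr (- w - of_nat j - 1))) (at x within A)"
    using assms by (auto intro!: derivative_eq_intros)
  moreover have "(-1) ^ j * pochhammer w j * ((- w - of_nat j) * x powr (- w - of_nat j - 1))
     = pow_prim (Suc i) w x"
    by (simp add: Suc pochhammer_Suc algebra_simps)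
  moreover have "pow_prim (Suc j) w = (\<lambda>x. (-1) ^ j * pochhammer w j * x powr (- w - of_nat j))"
    by (rule ext) simp
  ultimately show ?thesis unfolding Suc by (simp only: Suc)
qed

lemma norm_pochhammer_le:
  fixes w :: complex
  assumes "norm w \<le> R" "i \<le> K"
  shows "norm (pochhammer w i) \<le> (R + real K) ^ i"
proof -
  have "norm (pochhammer w i) = (\<Prod>j<i. norm (w + of_nat j))"
    by (simp add: pochhammer_prod prod_norm atLeast0LessThan)
  also have "\<dots> \<le> (\<Prod>j<i. R + real K)"
  proof (intro prod_mono conjI norm_ge_zero)
    fix j assume "j \<in> {..<i}"
    then have "norm (w + of_nat j) \<le> norm w + real j" and "real j \<le> real K"
      using norm_triangle_ineq[of w "of_nat j"] assms by auto
    then show "norm (w + of_nat j) \<le> R + real K" using assms by linarith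
  qed
  finally show ?thesis by simp
qed

lemma norm_pow_prim_Suc:
  assumes "x > 0"
  shows "norm (pow_prim (Suc i) w (of_real x)) = norm (pochhammer w i) * x powr (- Re w - real i)"
  using assms by (simp add: norm_mult norm_power norm_powr_real_powr)

definition bern_bound :: "nat \<Rightarrow> real" where
  "bern_bound K = (\<Sum>i<K. \<bar>bern i\<bar>)"

lemma bern_bound_nonneg: "bern_bound K \<ge> 0"
  by (simp add: bern_bound_def sum_nonneg)

text \<open>Expand each \<open>pow_prim i w (x+1)\<close> by Taylor's formula up to order \<open>K\<close>. In the
  weighted sum the derivative of order \<open>m < K\<close> gets the coefficient computed in
  \<open>bern_convolution\<close>, so that only \<open>x^(-w)\<close> itself and the remainders survive.\<close>
lemma euler_maclaurin_step:
  assumes "x > 0" "K \<ge> 2" and B: "\<And>u. u \<in> {x..x+1} \<Longrightarrow> norm (pow_prim K w (of_real u)) \<le> B"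
  shows "norm (of_real x powr (- w) -
     (\<Sum>i<K. of_real (bern i) * (pow_prim i w (of_real (x + 1)) - pow_prim i w (of_real x)))) \<le> bern_bound K * B"
proof -
  define f where "f = (\<lambda>i. pow_prim i w (of_real x))"
  define S where "S = complex_of_real ` {x..x+1}"
  have "convex S" unfolding S_def
    by (intro convex_linear_image) (auto intro!: linearI simp: scaleR_conv_of_real)
  have S: "z \<notin> \<real>\<^sub>\<le>\<^sub>0" if "z \<in> S" for z
    using that \<open>x > 0\<close> by (auto simp: S_def complex_nonpos_Reals_iff)
  define r where "r = (\<lambda>i. pow_prim i w (of_real (x + 1)) - (\<Sum>j<K-i. f (i + j) / fact j))"
  have r: "norm (r i) \<le> B" if "i < K" for i
  proof -
    have "B \<ge> 0" using order_trans[OF norm_ge_zero B[of x]] by simp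
    have "norm (pow_prim (i + 0) w (of_real (x + 1)) -
       (\<Sum>j\<le>K-i-1. pow_prim (i + j) w (of_real x) * (of_real (x+1) - of_real x) ^ j / fact j))
       \<le> B * norm (complex_of_real (x+1) - of_real x) ^ Suc (K - i - 1) / fact (K - i - 1)"
    proof (rule complex_Taylor[OF \<open>convex S\<close>, where f = "\<lambda>j. pow_prim (i + j) w"])
      show "norm (pow_prim (i + Suc (K - i - 1)) w u) \<le> B" if "u \<in> S" for u
        using that \<open>i < K\<close> B by (auto simp: S_def)
      show "complex_of_real (x + 1) \<in> S" "complex_of_real x \<in> S" unfolding S_def by (intro imageI, simp)+
    qed (use S has_field_derivative_pow_prim in \<open>auto simp del: pow_prim.simps\<close>)
    also have "\<dots> \<le> B"
      using \<open>B \<ge> 0\<close> by (simp add: field_simps mult_left_le fact_ge_1 mult_le_cancel_left1)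
    also have "{..K-i-1} = {..<K-i}" using that by auto
    finally show ?thesis by (simp add: r_def f_def)
  qed
  have dec: "pow_prim i w (of_real (x + 1)) - pow_prim i w (of_real x) = (\<Sum>m\<in>{i<..<K}. f m / fact (m - i)) + r i"
    if "i < K" for i
  proof -
    have "(\<Sum>j<K-i. f (i + j) / fact j) = (\<Sum>m\<in>{i..<K}. f m / fact (m - i))"
      by (rule sum.reindex_bij_witness[of _ "\<lambda>m. m - i" "\<lambda>j. i + j"]) auto
    also have "{i..<K} = insert i {i<..<K}" using that by auto
    finally show ?thesis by (simp add: r_def f_def)
  qed
  have "(\<Sum>i<K. of_real (bern i) * (pow_prim i w (of_real (x + 1)) - pow_prim i w (of_real x)))
      = (\<Sum>i<K. \<Sum>m\<in>{i<..<K}. of_real (bern i) * f m / fact (m - i)) + (\<Sum>i<K. of_real (bern i) * r i)"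
    unfolding sum.distrib[symmetric]
    by (intro sum.cong refl) (subst dec, auto simp: distrib_left sum_distrib_left)
  also have "(\<Sum>i<K. \<Sum>m\<in>{i<..<K}. of_real (bern i) * f m / fact (m - i))
     = (\<Sum>m<K. \<Sum>i<m. of_real (bern i) * f m / fact (m - i))"
    by (subst (1 2) sum.Sigma) (auto intro!: sum.reindex_bij_witness[of _ prod.swap prod.swap])
  also have "\<dots> = (\<Sum>m<K. f m * of_real (\<Sum>i<m. bern i / fact (m - i)))"
    by (simp add: sum_distrib_left field_simps)
  also have "\<dots> = (\<Sum>m<K. if m = 1 then f m else 0)"
    by (intro sum.cong refl) (simp add: bern_convolution)
  also have "\<dots> = f 1" using \<open>K \<ge> 2\<close> by (subst sum.delta) auto
  finally have "of_real x powr (- w) -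
     (\<Sum>i<K. of_real (bern i) * (pow_prim i w (of_real (x + 1)) - pow_prim i w (of_real x)))
     = - (\<Sum>i<K. of_real (bern i) * r i)" by (simp add: f_def)
  also have "norm \<dots> \<le> (\<Sum>i<K. \<bar>bern i\<bar> * B)"
    unfolding norm_minus_cancel by (rule sum_norm_le) (auto simp: norm_mult intro!: mult_left_mono r)
  finally show ?thesis by (simp add: bern_bound_def sum_distrib_right)
qed

definition pow_boundary :: "nat \<Rightarrow> complex \<Rightarrow> nat \<Rightarrow> complex" where
  "pow_boundary K w N = (\<Sum>i<K. of_real (bern i) * pow_prim i w (of_nat N))"

text \<open>What is left of the power sum when the Euler-Maclaurin terms at its upper end are removed. It converges
  for large \<open>K\<close>, even where the power sum diverges.\<close>
definition pow_regular :: "nat \<Rightarrow> complex \<Rightarrow> nat \<Rightarrow> complex" where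
  "pow_regular K w N = (\<Sum>k=1..<N. of_nat k powr (- w)) - pow_boundary K w N"

lemma pow_regular_increment:
  assumes "k \<ge> 1" "K \<ge> 2" "\<And>u. u \<in> {real k..real k + 1} \<Longrightarrow> norm (pow_prim K w (of_real u)) \<le> B"
  shows "norm (pow_regular K w (Suc k) - pow_regular K w k) \<le> bern_bound K * B"
proof -
  have "pow_regular K w (Suc k) - pow_regular K w k = of_real (real k) powr (- w) -
     (\<Sum>i<K. of_real (bern i) * (pow_prim i w (of_real (real k + 1)) - pow_prim i w (of_real (real k))))"
    using assms by (simp add: pow_regular_def pow_boundary_def sum_subtractf algebra_simps del: pow_prim.simps)
  then show ?thesis using euler_maclaurin_step[of "real k" K w B] assms by simp
qed

lemma pow_regular_step:
  assumes "k \<ge> 1" "K \<ge> 2" "norm w \<le> R" "Re w + real K \<ge> 1"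
  shows "norm (pow_regular K w (Suc k) - pow_regular K w k)
       \<le> bern_bound K * ((R + real K) ^ (K - 1) * real k powr (1 - Re w - real K))"
proof (rule pow_regular_increment)
  fix u assume u: "u \<in> {real k..real k + 1}"
  obtain K' where K': "K = Suc K'" using assms by (cases K) auto
  have "R \<ge> 0" using norm_ge_zero[of w] assms by linarith
  have "norm (pow_prim K w (of_real u)) = norm (pochhammer w K') * u powr (- Re w - real K')"
    unfolding K' using u assms by (intro norm_pow_prim_Suc) auto
  also have "\<dots> \<le> (R + real K) ^ K' * real k powr (- Re w - real K')"
    using u assms \<open>R \<ge> 0\<close> by (intro mult_mono norm_pochhammer_le powr_mono2') (auto simp: K')
  finally show "norm (pow_prim K w (of_real u)) \<le> (R + real K) ^ (K - 1) * real k powr (1 - Re w - real K)"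
    by (simp add: K' algebra_simps)
qed (use assms in auto)

text \<open>Summation of the steps. A factor \<open>1 / k^2 \<le> 2 (1 / k - 1 / (k+1))\<close> is split off, which
  telescopes. The bound is one power of \<open>N\<close> weaker than the true order; \<open>pow_regular_approx\<close>
  makes up for it by taking more boundary terms.\<close>
lemma telescoping_limit:
  fixes f :: "nat \<Rightarrow> complex"
  assumes step: "\<And>k. k \<ge> 1 \<Longrightarrow> norm (f (Suc k) - f k) \<le> A * real k powr (- b)"
    and "b \<ge> 2" "A \<ge> 0"
  shows "\<exists>L. f \<longlonglongrightarrow> L \<and> (\<forall>N\<ge>1. norm (f N - L) \<le> 2 * A * real N powr (2 - b))"
proof -
  have tel: "norm (f (N + j) - f N) \<le> 2 * A * real N powr (2 - b) * (1 / real N - 1 / real (N + j))"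
    if "N \<ge> 1" for N j
  proof (induction j)
    case (Suc j)
    define k where "k = N + j"
    have k: "k \<ge> 1" "k \<ge> N" using that by (auto simp: k_def)
    have "real k powr (- b) = real k powr (2 - b) * real k powr (-2)"
      by (simp flip: powr_add)
    also have "\<dots> \<le> real N powr (2 - b) * (2 * (1 / real k - 1 / real (Suc k)))"
    proof (rule mult_mono)
      show "real k powr (2 - b) \<le> real N powr (2 - b)"
        using k that assms by (intro powr_mono2') auto
      have "real k powr (-2) = 1 / (real k)\<^sup>2" using k by (simp add: powr_minus divide_inverse)
      also have "\<dots> \<le> 2 * (1 / real k - 1 / real (Suc k))"
      proof -
        have "2 * (1 / real k - 1 / real (Suc k)) - 1 / (real k)\<^sup>2 = (real k - 1) / ((real k)\<^sup>2 * real (Suc k))"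
          using k by (simp add: divide_simps) (simp add: algebra_simps power2_eq_square)
        also have "\<dots> \<ge> 0" using k by simp
        finally show ?thesis by simp
      qed
      finally show "real k powr (-2) \<le> 2 * (1 / real k - 1 / real (Suc k))" .
    qed auto
    finally have "norm (f (Suc k) - f k) \<le> A * (real N powr (2 - b) * (2 * (1 / real k - 1 / real (Suc k))))"
      using step[OF k(1)] mult_left_mono[OF _ \<open>A \<ge> 0\<close>] order_trans by blast
    moreover have "norm (f (Suc k) - f N) \<le> norm (f (Suc k) - f k) + norm (f k - f N)"
      by (rule norm_diff_triangle_le[OF order_refl order_refl])
    ultimately have "norm (f (Suc k) - f N) \<le> A * (real N powr (2 - b) * (2 * (1 / real k - 1 / real (Suc k))))
       + 2 * A * real N powr (2 - b) * (1 / real N - 1 / real k)"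
      using Suc unfolding k_def by linarith
    also have "\<dots> = 2 * A * real N powr (2 - b) * (1 / real N - 1 / real (Suc k))"
      by (simp add: algebra_simps)
    finally show ?case by (simp add: k_def)
  qed simp
  have tel2: "norm (f M - f N) \<le> 2 * A * real N powr (2 - b) * (1 / real N)" if "1 \<le> N" "N \<le> M" for M N
  proof -
    have "norm (f M - f N) \<le> 2 * A * real N powr (2 - b) * (1 / real N - 1 / real M)"
      using tel[of N "M - N"] that by simp
    also have "\<dots> \<le> 2 * A * real N powr (2 - b) * (1 / real N)"
      using \<open>A \<ge> 0\<close> by (intro mult_left_mono) auto
    finally show ?thesis .
  qed
  have "summable (\<lambda>k. f (Suc k) - f k)"
  proof (rule summable_comparison_test_ev)
    show "\<forall>\<^sub>F k in sequentially. norm (f (Suc k) - f k) \<le> A * real k powr (-2)"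
    proof (rule eventually_sequentiallyI[of 1])
      fix k :: nat assume "k \<ge> 1"
      then have "A * real k powr (- b) \<le> A * real k powr (-2)"
        using assms by (intro mult_left_mono powr_mono) auto
      with step[OF \<open>k \<ge> 1\<close>] show "norm (f (Suc k) - f k) \<le> A * real k powr (-2)" by linarith
    qed
    show "summable (\<lambda>k. A * real k powr (-2))" by (intro summable_mult) (simp add: summable_real_powr_iff)
  qed
  then have "convergent (\<lambda>n. \<Sum>k<n. f (Suc k) - f k)" by (simp add: summable_iff_convergent)
  then have "convergent (\<lambda>n. f n - f 0)" unfolding sum_lessThan_telescope .
  then have "convergent f" using convergent_add[OF _ convergent_const[of "f 0"]] by fastforce
  then obtain L where L: "f \<longlonglongrightarrow> L" using convergent_def by blast
  have "norm (f N - L) \<le> 2 * A * real N powr (2 - b)" if "N \<ge> 1" for N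
  proof (rule tendsto_upperbound)
    show "(\<lambda>M. norm (f N - f M)) \<longlonglongrightarrow> norm (f N - L)" by (intro tendsto_intros L)
    show "\<forall>\<^sub>F M in sequentially. norm (f N - f M) \<le> 2 * A * real N powr (2 - b)"
    proof (rule eventually_sequentiallyI[of N])
      fix M assume "M \<ge> N"
      then have "norm (f M - f N) \<le> 2 * A * real N powr (2 - b) * (1 / real N)" using that by (intro tel2) auto
      also have "\<dots> \<le> 2 * A * real N powr (2 - b) * 1"
        using \<open>A \<ge> 0\<close> that by (intro mult_left_mono) auto
      finally show "norm (f N - f M) \<le> 2 * A * real N powr (2 - b)" by (simp add: norm_minus_commute)
    qed
  qed auto
  with L show ?thesis by blast
qed

text \<open>The constant term in the asymptotic expansion of \<open>\<Sum>k<N. k^(-w)\<close>. It is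
  \<open>\<zeta>(w)\<close> for \<open>w \<noteq> 1\<close> and Euler's constant for \<open>w = 1\<close>. The number
  of boundary terms ensures convergence; more of them give the same limit.\<close>
definition zeta_const :: "complex \<Rightarrow> complex" where
  "zeta_const w = lim (pow_regular (nat \<lceil>norm w\<rceil> + 4) w)"

text \<open>The additional boundary terms are bounded one by one; the first of them dominates.\<close>
lemma pow_regular_diff:
  assumes "K \<le> K'" "K \<ge> 1" "norm w \<le> R" "N \<ge> 1"
  shows "norm (pow_regular K w N - pow_regular K' w N)
       \<le> (bern_bound K' * (R + real K') ^ K') * real N powr (1 - Re w - real K)"
proof (cases "K' = K")
  case True
  have "R \<ge> 0" using norm_ge_zero[of w] assms by linarith
  then show ?thesis using True by (simp add: bern_bound_nonneg)
next
  case False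
  have "R \<ge> 0" using norm_ge_zero[of w] assms by linarith
  have R1: "R + real K' \<ge> 1" using assms \<open>R \<ge> 0\<close> by linarith
  have "{..<K'} = {..<K} \<union> {K..<K'}" using assms by auto
  moreover have "(\<Sum>i\<in>{..<K} \<union> {K..<K'}. of_real (bern i) * pow_prim i w (of_nat N))
      = pow_boundary K w N + (\<Sum>i=K..<K'. of_real (bern i) * pow_prim i w (of_nat N))"
    unfolding pow_boundary_def by (rule sum.union_disjoint) auto
  ultimately have "pow_boundary K' w N = pow_boundary K w N + (\<Sum>i=K..<K'. of_real (bern i) * pow_prim i w (of_nat N))"
    unfolding pow_boundary_def by (simp only:)
  then have "norm (pow_regular K w N - pow_regular K' w N) = norm (\<Sum>i=K..<K'. of_real (bern i) * pow_prim i w (of_nat N))"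
    by (simp add: pow_regular_def)
  also have "\<dots> \<le> (\<Sum>i=K..<K'. \<bar>bern i\<bar> * ((R + real K') ^ K' * real N powr (1 - Re w - real K)))"
  proof (rule sum_norm_le)
    fix i assume i: "i \<in> {K..<K'}"
    obtain j where j: "i = Suc j" using i assms by (cases i) auto
    have "norm (pow_prim i w (of_nat N)) = norm (pochhammer w j) * real N powr (- Re w - real j)"
      unfolding j using norm_pow_prim_Suc[of "real N"] assms by simp
    also have "\<dots> \<le> (R + real K') ^ K' * real N powr (1 - Re w - real K)"
    proof (rule mult_mono)
      have "norm (pochhammer w j) \<le> (R + real K') ^ j" using assms i by (intro norm_pochhammer_le) (auto simp: j)
      also have "\<dots> \<le> (R + real K') ^ K'" using R1 i by (intro power_increasing) (auto simp: j)
      finally show "norm (pochhammer w j) \<le> (R + real K') ^ K'" .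
      show "real N powr (- Re w - real j) \<le> real N powr (1 - Re w - real K)"
        using assms i by (intro powr_mono) (auto simp: j)
    qed (use R1 in auto)
    finally show "norm (of_real (bern i) * pow_prim i w (of_nat N)) \<le> \<bar>bern i\<bar> * ((R + real K') ^ K' * real N powr (1 - Re w - real K))"
      by (simp add: norm_mult mult_left_mono del: pow_prim.simps)
  qed
  also have "\<dots> = (\<Sum>i=K..<K'. \<bar>bern i\<bar>) * ((R + real K') ^ K' * real N powr (1 - Re w - real K))"
    by (simp add: sum_distrib_right)
  also have "\<dots> \<le> bern_bound K' * ((R + real K') ^ K' * real N powr (1 - Re w - real K))"
    unfolding bern_bound_def using R1 by (intro mult_right_mono sum_mono2) auto
  finally show ?thesis by (simp add: mult.assoc)
qed

lemma real_powr_tendsto_0: "a < 0 \<Longrightarrow> (\<lambda>n. real n powr a) \<longlonglongrightarrow> 0"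
  by (rule tendsto_neg_powr) (auto intro: filterlim_real_sequentially)

text \<open>With \<open>K' \<ge> K + R + 4\<close> boundary terms the rate of convergence is better than claimed, and
  the boundary terms from \<open>K\<close> to \<open>K'\<close> have the claimed order. The constant depends on
  \<open>w\<close> only through \<open>R\<close>, also near \<open>w = 1\<close>.\<close>
lemma pow_regular_approx:
  assumes "K \<ge> 1"
  shows "\<exists>C\<ge>0. \<forall>w N. norm w \<le> R \<longrightarrow> N \<ge> 1 \<longrightarrow>
    norm (pow_regular K w N - zeta_const w) \<le> C * real N powr (1 - Re w - real K)"
proof -
  define K' where "K' = K + nat \<lceil>R\<rceil> + 4"
  define A where "A = bern_bound K' * (R + real K') ^ (K' - 1)"
  define A' where "A' = bern_bound K' * (R + real K') ^ K'"
  have main: "norm (pow_regular K w N - zeta_const w) \<le> (2 * \<bar>A\<bar> + \<bar>A'\<bar>) * real N powr (1 - Re w - real K)"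
    if w: "norm w \<le> R" and N: "N \<ge> 1" for w N
  proof -
    have R: "R \<ge> 0" using norm_ge_zero[of w] w by linarith
    have Rew: "Re w \<ge> - R" using abs_Re_le_cmod[of w] w by linarith
    have K': "real K' \<ge> real K + R + 4" unfolding K'_def using R by simp
    have "A \<ge> 0" unfolding A_def using R bern_bound_nonneg by simp
    have "\<exists>L. pow_regular K' w \<longlonglongrightarrow> L \<and>
       (\<forall>N\<ge>1. norm (pow_regular K' w N - L) \<le> 2 * A * real N powr (2 - (Re w + real K' - 1)))"
    proof (rule telescoping_limit)
      fix k :: nat assume "k \<ge> 1"
      have "norm (pow_regular K' w (Suc k) - pow_regular K' w k) \<le> A * real k powr (1 - Re w - real K')"
        unfolding A_def mult.assoc
      proof (rule pow_regular_step)
        show "K' \<ge> 2" by (simp add: K'_def)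
        show "Re w + real K' \<ge> 1" using Rew K' by linarith
      qed (use w \<open>k \<ge> 1\<close> in auto)
      then show "norm (pow_regular K' w (Suc k) - pow_regular K' w k) \<le> A * real k powr (- (Re w + real K' - 1))"
        by (simp add: algebra_simps)
    qed (use Rew K' \<open>A \<ge> 0\<close> in auto)
    then obtain L where L: "pow_regular K' w \<longlonglongrightarrow> L"
      and LN: "\<And>N. N \<ge> 1 \<Longrightarrow> norm (pow_regular K' w N - L) \<le> 2 * A * real N powr (3 - Re w - real K')"
      by (auto simp: algebra_simps)
    define K0 where "K0 = nat \<lceil>norm w\<rceil> + 4"
    have K0: "real K0 \<ge> norm w + 4" unfolding K0_def by simp
    have "nat \<lceil>norm w\<rceil> \<le> nat \<lceil>R\<rceil>" using w by (intro nat_mono ceiling_mono)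
    then have "K0 \<le> K'" by (simp add: K0_def K'_def)
    have "(\<lambda>N. pow_regular K0 w N - pow_regular K' w N) \<longlonglongrightarrow> 0"
    proof (rule Lim_null_comparison)
      show "\<forall>\<^sub>F N in sequentially. norm (pow_regular K0 w N - pow_regular K' w N) \<le> A' * real N powr (1 - Re w - real K0)"
        unfolding A'_def using \<open>K0 \<le> K'\<close> w
        by (intro eventually_sequentiallyI[of 1] pow_regular_diff) (auto simp: K0_def)
      have "1 - Re w - real K0 < 0" using K0 abs_Re_le_cmod[of w] by linarith
      then show "(\<lambda>N. A' * real N powr (1 - Re w - real K0)) \<longlonglongrightarrow> 0"
        by (intro tendsto_mult_right_zero real_powr_tendsto_0)
    qed
    from tendsto_add[OF this L] have "pow_regular K0 w \<longlonglongrightarrow> L" by simp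
    then have zc: "zeta_const w = L" unfolding zeta_const_def K0_def[symmetric] by (rule limI)
    have "norm (pow_regular K w N - L) \<le> norm (pow_regular K w N - pow_regular K' w N) + norm (pow_regular K' w N - L)"
      by (rule norm_diff_triangle_le[OF order_refl order_refl])
    also have "\<dots> \<le> A' * real N powr (1 - Re w - real K) + 2 * A * real N powr (3 - Re w - real K')"
      unfolding A'_def using w N assms by (intro add_mono LN pow_regular_diff) (auto simp: K'_def)
    also have "\<dots> \<le> \<bar>A'\<bar> * real N powr (1 - Re w - real K) + 2 * \<bar>A\<bar> * real N powr (1 - Re w - real K)"
      using N K' R \<open>A \<ge> 0\<close> by (intro add_mono mult_mono powr_mono) auto
    finally show ?thesis by (simp add: zc algebra_simps)
  qed
  show ?thesis by (intro exI[of _ "2 * \<bar>A\<bar> + \<bar>A'\<bar>"]) (use main in auto)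
qed

lemma pow_regular_tendsto:
  assumes "K \<ge> 1" "Re w + real K > 1"
  shows "pow_regular K w \<longlonglongrightarrow> zeta_const w"
proof -
  obtain C where C: "\<And>N. N \<ge> 1 \<Longrightarrow> norm (pow_regular K w N - zeta_const w) \<le> C * real N powr (1 - Re w - real K)"
    using pow_regular_approx[OF assms(1), of "norm w"] by blast
  have "(\<lambda>N. pow_regular K w N - zeta_const w) \<longlonglongrightarrow> 0"
  proof (rule Lim_null_comparison)
    show "\<forall>\<^sub>F N in sequentially. norm (pow_regular K w N - zeta_const w) \<le> C * real N powr (1 - Re w - real K)"
      using C by (rule eventually_sequentiallyI)
    show "(\<lambda>N. C * real N powr (1 - Re w - real K)) \<longlonglongrightarrow> 0"
      using assms by (intro tendsto_mult_right_zero real_powr_tendsto_0) auto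
  qed
  then show ?thesis by (simp add: LIM_zero_iff)
qed

lemma zeta_const_1: "zeta_const 1 = of_real euler_mascheroni"
proof (rule LIMSEQ_unique)
  show "pow_regular 1 1 \<longlonglongrightarrow> zeta_const 1" by (rule pow_regular_tendsto) auto
  have "(\<lambda>N. complex_of_real (harm N - ln (real N)) - of_real (1 / real N)) \<longlonglongrightarrow> of_real euler_mascheroni - of_real 0"
    by (intro tendsto_diff tendsto_of_real euler_mascheroni_LIMSEQ lim_1_over_n)
  moreover have "\<forall>\<^sub>F N in sequentially. complex_of_real (harm N - ln (real N)) - of_real (1 / real N) = pow_regular 1 1 N"
  proof (rule eventually_sequentiallyI[of 1])
    fix N :: nat assume "N \<ge> 1"
    then obtain M where N: "N = Suc M" by (cases N) auto
    have "complex_of_real (harm N) = (\<Sum>k=1..<N. of_nat k powr (-1)) + of_real (1 / real N)"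
      by (simp add: N harm_def atLeastLessThanSuc_atLeastAtMost powr_minus inverse_eq_divide)
    then show "complex_of_real (harm N - ln (real N)) - of_real (1 / real N) = pow_regular 1 1 N"
      using \<open>N \<ge> 1\<close> by (simp add: pow_regular_def pow_boundary_def bern_0 Ln_of_nat)
  qed
  ultimately show "pow_regular 1 1 \<longlonglongrightarrow> of_real euler_mascheroni"
    by (simp add: Lim_transform_eventually)
qed

lemma zeta_const_sums:
  assumes "Re s > 1"
  shows "(\<lambda>n. 1 / of_nat (Suc n) powr s) sums zeta_const s"
proof -
  have s: "s \<noteq> 1" using assms by auto
  have "(\<lambda>N. pow_boundary 1 s N) \<longlonglongrightarrow> 0"
  proof (rule Lim_null_comparison)
    show "\<forall>\<^sub>F N in sequentially. norm (pow_boundary 1 s N) \<le> (1 / norm (1 - s)) * real N powr (1 - Re s)"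
      using norm_powr_real_powr[of "of_nat N" for N]
      by (intro eventually_sequentiallyI[of 1])
         (auto simp: pow_boundary_def s bern_0 norm_divide norm_powr_real_powr)
    show "(\<lambda>N. (1 / norm (1 - s)) * real N powr (1 - Re s)) \<longlonglongrightarrow> 0"
      using assms by (intro tendsto_mult_right_zero real_powr_tendsto_0) auto
  qed
  from tendsto_add[OF pow_regular_tendsto[of 1 s] this]
  have "(\<lambda>N. \<Sum>k=1..<N. of_nat k powr (- s)) \<longlonglongrightarrow> zeta_const s"
    using assms by (simp add: pow_regular_def)
  then have "(\<lambda>N. \<Sum>k=1..<Suc N. of_nat k powr (- s)) \<longlonglongrightarrow> zeta_const s"
    by (rule LIMSEQ_Suc)
  moreover have "(\<Sum>k=1..<Suc N. of_nat k powr (- s)) = (\<Sum>n<N. 1 / of_nat (Suc n) powr s)" for N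
    by (rule sum.reindex_bij_witness[of _ Suc "\<lambda>k. k - 1"]) (auto simp: powr_minus_divide)
  ultimately show ?thesis by (simp add: sums_def)
qed

lemma holomorphic_pow_prim_param:
  assumes "x > 0"
  shows "(\<lambda>w. pow_prim i w (of_real x)) holomorphic_on - {1}"
proof (cases i)
  case 0
  have "(\<lambda>w. of_real x powr (1 - w) / (1 - w)) holomorphic_on - {1}"
    using assms by (intro holomorphic_intros) auto
  then show ?thesis by (rule holomorphic_transform) (auto simp: 0)
next
  case (Suc j)
  show ?thesis unfolding Suc pow_prim.simps pochhammer_prod
    using assms by (intro holomorphic_intros) auto
qed

text \<open>On a disc, a fixed number of boundary terms makes the convergence uniform.\<close>
lemma holomorphic_zeta_const: "zeta_const holomorphic_on - {1}"
proof -
  have "zeta_const holomorphic_on ball 0 R - {1}" for R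
  proof -
    (* This makes the exponent 1 - Re w - K at most -1 on the disc. *)
    define K where "K = nat \<lceil>R\<rceil> + 2"
    have K: "real K \<ge> R + 2" unfolding K_def by simp linarith
    obtain C where C: "C \<ge> 0" "\<And>w N. norm w \<le> R \<Longrightarrow> N \<ge> 1 \<Longrightarrow>
        norm (pow_regular K w N - zeta_const w) \<le> C * real N powr (1 - Re w - real K)"
      using pow_regular_approx[of K R] by (auto simp: K_def)
    show ?thesis
    proof (rule holomorphic_uniform_sequence[where f = "\<lambda>n w. pow_regular K w (Suc n)"])
      show "open (ball 0 R - {1::complex})" by (intro open_Diff) auto
      show "(\<lambda>w. pow_regular K w (Suc n)) holomorphic_on ball 0 R - {1}" for n
        unfolding pow_regular_def pow_boundary_def
        using holomorphic_pow_prim_param[of "real (Suc n)"]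
        by (intro holomorphic_intros) (auto simp del: pow_prim.simps intro: holomorphic_on_subset)
      fix x :: complex assume x: "x \<in> ball 0 R - {1}"
      then obtain d where d: "d > 0" "cball x d \<subseteq> ball 0 R - {1}"
        using \<open>open (ball 0 R - {1::complex})\<close> open_contains_cball by blast
      have "uniform_limit (cball x d) (\<lambda>n w. pow_regular K w (Suc n)) zeta_const sequentially"
      proof (rule uniform_limitI)
        fix e :: real assume "e > 0"
        have "(\<lambda>n. C * (1 / real (Suc n))) \<longlonglongrightarrow> 0"
          by (intro tendsto_mult_right_zero) (use LIMSEQ_Suc[OF lim_1_over_n] in simp)
        then have "\<forall>\<^sub>F n in sequentially. C * (1 / real (Suc n)) < e"
          using \<open>e > 0\<close> by (rule order_tendstoD)
        then show "\<forall>\<^sub>F n in sequentially. \<forall>w\<in>cball x d. dist (pow_regular K w (Suc n)) (zeta_const w) < e"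
        proof eventually_elim
          fix n assume n: "C * (1 / real (Suc n)) < e"
          show "\<forall>w\<in>cball x d. dist (pow_regular K w (Suc n)) (zeta_const w) < e"
          proof
            fix w assume "w \<in> cball x d"
            then have "w \<in> ball 0 R - {1}" using d(2) by blast
            then have w: "norm w \<le> R" by simp
            have "1 - Re w - real K \<le> -1" using abs_Re_le_cmod[of w] w K by linarith
            then have "real (Suc n) powr (1 - Re w - real K) \<le> real (Suc n) powr (-1)" by (intro powr_mono) auto
            then have "C * real (Suc n) powr (1 - Re w - real K) \<le> C * (1 / real (Suc n))"
              using C by (intro mult_left_mono) (auto simp: powr_minus divide_inverse)
            with C(2)[OF w, of "Suc n"] n show "dist (pow_regular K w (Suc n)) (zeta_const w) < e"
              by (simp add: dist_norm)
          qed
        qed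
      qed
      with d show "\<exists>d>0. cball x d \<subseteq> ball 0 R - {1} \<and>
          uniform_limit (cball x d) (\<lambda>n w. pow_regular K w (Suc n)) zeta_const sequentially" by blast
    qed
  qed
  then have "zeta_const field_differentiable (at w)" if "w \<noteq> 1" for w
  proof -
    have "open (ball 0 (norm w + 1) - {1::complex})" by (intro open_Diff) auto
    then show ?thesis
      using \<open>\<And>R. zeta_const holomorphic_on ball 0 R - {1}\<close>[of "norm w + 1"] that
      by (intro holomorphic_on_imp_differentiable_at) auto
  qed
  then show ?thesis by (auto simp: holomorphic_on_def field_differentiable_at_within)
qed

text \<open>Both are continuations of the same Dirichlet series to a connected domain.\<close>
lemma zeta_eq_zeta_const:
  assumes "s \<noteq> 1"
  shows "zeta s = zeta_const s"
proof -
  define g where "g = (\<lambda>s. if s = 1 then 0 else zeta_const s)"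
  have g: "g holomorphic_on - {1}"
    by (rule holomorphic_transform[OF holomorphic_zeta_const]) (auto simp: g_def)
  have "zeta = g"
    unfolding zeta_def
  proof (rule the_equality)
    show "g holomorphic_on - {1} \<and> (\<forall>s. Re s > 1 \<longrightarrow> (\<lambda>n. 1 / of_nat (Suc n) powr s) sums g s) \<and> g 1 = 0"
      using g zeta_const_sums by (auto simp: g_def)
    fix f :: "complex \<Rightarrow> complex"
    assume f: "f holomorphic_on - {1} \<and> (\<forall>s. Re s > 1 \<longrightarrow> (\<lambda>n. 1 / of_nat (Suc n) powr s) sums f s) \<and> f 1 = 0"
    show "f = g"
    proof
      fix z
      show "f z = g z"
      proof (cases "z = 1")
        case False
        show ?thesis
        proof (rule analytic_continuation_open[of "{s. Re s > 1}" "- {1}" f g])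
          show "open {s. Re s > 1}" by (rule open_halfspace_Re_gt)
          show "{s. Re s > 1} \<noteq> {}" by (auto intro: exI[of _ "2 :: complex"])
          show "connected (- {1::complex})" by (rule connected_punctured_universe) auto
          show "f s = g s" if "s \<in> {s. Re s > 1}" for s
            using that f zeta_const_sums[of s] by (auto simp: g_def intro: sums_unique2)
        qed (use f g False in auto)
      qed (use f in \<open>simp add: g_def\<close>)
    qed
  qed
  then have "zeta s = g s" by (rule fun_cong)
  with assms show ?thesis by (simp add: g_def)
qed

lemma pochhammer_one_minus:
  "i < k \<Longrightarrow> (-1) ^ i * pochhammer (1 - of_nat k :: complex) i = fact (k - 1) / fact (k - 1 - i)"
proof (induction i)
  case (Suc i)
  define a where "a = (of_nat (k - 1 - i) :: complex)"
  have a: "a \<noteq> 0" using Suc.prems unfolding a_def of_nat_eq_0_iff by simp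
  have f: "fact (k - 1 - i) = (a * fact (k - 1 - Suc i) :: complex)"
    using Suc.prems unfolding a_def by (subst fact_reduce) (auto simp: Suc_diff_Suc)
  have "(-1) ^ Suc i * pochhammer (1 - of_nat k :: complex) (Suc i)
     = ((-1) ^ i * pochhammer (1 - of_nat k) i) * a"
    using Suc.prems by (simp add: a_def pochhammer_Suc of_nat_diff algebra_simps)
  also have "\<dots> = fact (k - 1) / (a * fact (k - 1 - Suc i)) * a"
    using Suc.IH Suc.prems unfolding f by simp
  finally show ?case using a by simp
qed simp

text \<open>For \<open>w = 1 - k\<close> the functions \<open>pow_prim i w\<close> vanish when \<open>i > k\<close>.
  Hence the Euler-Maclaurin step is exact, \<open>pow_regular\<close> does not depend on \<open>N\<close>, and its
  value at \<open>N = 1\<close> is minus the boundary term there.\<close>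
lemma zeta_const_nonpos:
  assumes "k \<ge> 1"
  shows "zeta_const (1 - of_nat k) = of_real (- ((-1) ^ k * bern k * fact (k - 1)))"
proof -
  define w where "w = (1 - of_nat k :: complex)"
  define K where "K = k + 2"
  have poch: "pochhammer w i = 0" if "i \<ge> k" for i
    using that assms unfolding w_def by (subst pochhammer_eq_0_iff) (auto intro!: exI[of _ "k - 1"] simp: of_nat_diff)
  have const: "pow_regular K w (Suc n) = pow_regular K w 1" for n
  proof (induction n)
    case (Suc n)
    have "norm (of_real (real (Suc n)) powr (- w) -
     (\<Sum>i<K. of_real (bern i) * (pow_prim i w (of_real (real (Suc n) + 1)) - pow_prim i w (of_real (real (Suc n)))))) \<le> bern_bound K * 0"
      by (rule euler_maclaurin_step) (auto simp: K_def poch)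
    then have "pow_regular K w (Suc (Suc n)) = pow_regular K w (Suc n)"
      by (simp add: pow_regular_def pow_boundary_def sum_subtractf algebra_simps del: pow_prim.simps)
    with Suc show ?case by simp
  qed simp
  have "pow_regular K w \<longlonglongrightarrow> zeta_const w" by (rule pow_regular_tendsto) (auto simp: K_def w_def)
  then have "(\<lambda>n. pow_regular K w (Suc n)) \<longlonglongrightarrow> zeta_const w" by (rule LIMSEQ_Suc)
  then have "zeta_const w = pow_regular K w 1" unfolding const by (rule LIMSEQ_unique) (rule tendsto_const)
  also have "\<dots> = - (\<Sum>i<K. of_real (bern i) * pow_prim i w 1)"
    by (simp add: pow_regular_def pow_boundary_def del: pow_prim.simps)
  also have "(\<Sum>i<K. of_real (bern i) * pow_prim i w 1) = (\<Sum>i\<le>k. of_real (bern i) * pow_prim i w 1)"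
  proof -
    have "pow_prim (Suc k) w 1 = 0" by (simp add: poch)
    then show ?thesis by (simp add: K_def lessThan_Suc_atMost del: pow_prim.simps)
  qed
  also have "\<dots> = (\<Sum>i\<le>k. of_real (fact (k - 1) * (bern i / fact (k - i))))"
  proof (rule sum.cong[OF refl])
    fix i assume i: "i \<in> {..k}"
    have "pow_prim i w 1 = fact (k - 1) / fact (k - i)"
    proof (cases i)
      case 0
      then show ?thesis using assms by (simp add: w_def fact_reduce[of k])
    next
      case (Suc j)
      then show ?thesis using i pochhammer_one_minus[of j k] by (simp add: w_def)
    qed
    then show "of_real (bern i) * pow_prim i w 1 = of_real (fact (k - 1) * (bern i / fact (k - i)))"
      by (simp del: pow_prim.simps)
  qed
  also have "\<dots> = of_real (fact (k - 1) * ((if k = 1 then 1 else 0) + bern k))"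
    unfolding bern_convolution[symmetric] of_real_sum[symmetric] sum_distrib_left[symmetric]
    by (simp flip: lessThan_Suc_atMost)
  also have "(if k = 1 then 1 else 0) + bern k = (-1) ^ k * bern k"
    using bern_sign[of k] bern_1 by auto
  finally show ?thesis by (simp add: w_def mult_ac)
qed

section \<open>Power sums with a binomial factor\<close>

lemma summable_poly_geometric:
  assumes "norm x < 1"
  shows "summable (\<lambda>l. real (Suc l) ^ M * (x::real) ^ l)"
proof -
  have "\<forall>x. norm x < 1 \<longrightarrow> summable (\<lambda>l. real (Suc l) ^ M * (x::real) ^ l)"
  proof (induction M)
    case 0
    then show ?case by (auto intro: summable_geometric)
  next
    case (Suc M)
    show ?case
    proof (intro allI impI)
      fix x :: real assume x: "norm x < 1"
      have "summable (\<lambda>l. diffs (\<lambda>l. real (Suc l) ^ M) l * \<bar>x\<bar> ^ l)"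
        by (rule termdiff_converges[of _ 1]) (use x Suc in auto)
      then show "summable (\<lambda>l. real (Suc l) ^ Suc M * x ^ l)"
      proof (rule summable_comparison_test')
        fix l
        have "norm (real (Suc l) ^ Suc M * x ^ l) = real (Suc l) * real (Suc l) ^ M * \<bar>x\<bar> ^ l"
          by (simp add: abs_mult power_abs)
        also have "\<dots> \<le> real (Suc l) * real (Suc (Suc l)) ^ M * \<bar>x\<bar> ^ l"
          by (intro mult_right_mono mult_left_mono power_mono) auto
        finally show "norm (real (Suc l) ^ Suc M * x ^ l) \<le> diffs (\<lambda>l. real (Suc l) ^ M) l * \<bar>x\<bar> ^ l"
          by (simp add: diffs_def)
      qed
    qed
  qed
  with assms show ?thesis by blast
qed

text \<open>By induction on \<open>l\<close>, since \<open>(d + l) / (l + 1) \<le> (1 + 1 / (l + 1))^d\<close> by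
  Bernoulli's inequality.\<close>
lemma norm_rising_le:
  fixes c :: complex
  assumes "norm c \<le> real d"
  shows "norm (rising c l) \<le> real (Suc l) ^ d"
proof (induction l)
  case (Suc l)
  have "norm (rising c (Suc l)) = norm (rising c l) * (norm (c + of_nat l) / real (Suc l))"
    by (simp add: rising_Suc norm_mult norm_divide del: of_nat_Suc)
  also have "\<dots> \<le> real (Suc l) ^ d * (real (Suc (Suc l)) / real (Suc l)) ^ d"
  proof (rule mult_mono)
    have "norm (c + of_nat l) \<le> real d + real l"
      using norm_triangle_ineq[of c "of_nat l"] assms by simp
    then have "norm (c + of_nat l) / real (Suc l) \<le> 1 + (real d + real l - real (Suc l)) / real (Suc l)"
      by (simp add: divide_simps)
    also have "\<dots> \<le> 1 + real d * (1 / real (Suc l))" by (simp add: divide_simps)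
    also have "\<dots> \<le> (1 + 1 / real (Suc l)) ^ d"
      by (rule Bernoulli_inequality) (auto intro: order_trans[of _ 0])
    also have "1 + 1 / real (Suc l) = real (Suc (Suc l)) / real (Suc l)" by (simp add: divide_simps)
    finally show "norm (c + of_nat l) / real (Suc l) \<le> (real (Suc (Suc l)) / real (Suc l)) ^ d" .
  qed (use Suc in auto)
  also have "\<dots> = real (Suc (Suc l)) ^ d"
    by (simp add: power_divide del: of_nat_Suc)
  finally show ?case .
qed simp

lemma rising_sums:
  fixes c z :: complex
  assumes "norm z < 1"
  shows "(\<lambda>l. rising c l * z ^ l) sums ((1 - z) powr (- c))"
proof -
  have "(\<lambda>l. ((- c) gchoose l) * (- z) ^ l) sums (1 + - z) powr (- c)"
    by (rule gen_binomial_complex) (use assms in auto)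
  moreover have "((- c) gchoose l) * (- z) ^ l = rising c l * z ^ l" for l
    unfolding rising_gbinomial power_minus[of z l] by simp
  ultimately show ?thesis by simp
qed

text \<open>After extraction of \<open>n^(-c)\<close>, this is the part of \<open>\<Sum>k. k^(-w) (n-k)^(-c)\<close>
  below \<open>N\<close>. Both halves of the convolution have this form, with \<open>c\<close> and \<open>w\<close>
  exchanged.\<close>
definition half_sum :: "complex \<Rightarrow> complex \<Rightarrow> nat \<Rightarrow> nat \<Rightarrow> complex" where
  "half_sum c w n N = (\<Sum>k=1..<N. of_nat k powr (- w) * (1 - of_nat k / of_nat n) powr (- c))"

text \<open>The boundary term of order \<open>i\<close>: the factor \<open>(1 - x/n)^(-c)\<close> is expanded, and
  each power of \<open>x\<close> is replaced by the \<open>i\<close>-th derivative of its primitive.\<close>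
definition half_boundary :: "nat \<Rightarrow> complex \<Rightarrow> complex \<Rightarrow> nat \<Rightarrow> nat \<Rightarrow> complex" where
  "half_boundary i c w n N = (\<Sum>l. rising c l / of_nat n ^ l * pow_prim i (w - of_nat l) (of_nat N))"

definition half_zeta :: "nat \<Rightarrow> complex \<Rightarrow> complex \<Rightarrow> nat \<Rightarrow> complex" where
  "half_zeta L c w n = (\<Sum>l<L. rising c l / of_nat n ^ l * zeta_const (w - of_nat l))"

definition half_correction :: "nat \<Rightarrow> complex \<Rightarrow> complex \<Rightarrow> nat \<Rightarrow> nat \<Rightarrow> complex" where
  "half_correction K c w n N = (\<Sum>i<K. of_real (bern i) * half_boundary i c w n N)"

lemma norm_pow_prim_shift_le:
  assumes "N \<ge> 1" "norm w \<le> R" "i \<le> K" "R \<ge> 0" "real l > R"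
  shows "norm (pow_prim i (w - of_nat l) (of_nat N))
       \<le> (R + real K + real l + 1) ^ K * real N powr (1 - Re w - real i) * real N ^ l"
proof (cases i)
  case 0
  have "Re (1 - (w - of_nat l)) \<ge> 1" using abs_Re_le_cmod[of w] assms by simp
  then have 1: "norm (1 - (w - of_nat l)) \<ge> 1" using complex_Re_le_cmod order_trans by blast
  then have ne: "w - of_nat l \<noteq> 1" by auto
  have "norm (pow_prim i (w - of_nat l) (of_nat N)) = real N powr (1 - Re w + real l) / norm (1 - (w - of_nat l))"
    using ne assms by (simp add: 0 norm_divide norm_powr_real_powr algebra_simps)
  also have "\<dots> \<le> real N powr (1 - Re w + real l) / 1"
    using 1 by (intro divide_left_mono) auto
  also have "\<dots> = 1 * real N powr (1 - Re w - real i) * real N ^ l"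
    using assms by (simp add: 0 powr_add powr_realpow)
  also have "\<dots> \<le> (R + real K + real l + 1) ^ K * real N powr (1 - Re w - real i) * real N ^ l"
    using assms by (intro mult_right_mono one_le_power) auto
  finally show ?thesis .
next
  case (Suc j)
  have "norm (w - of_nat l) \<le> R + real l"
    using norm_triangle_ineq4[of w "of_nat l"] assms by simp
  then have "norm (pochhammer (w - of_nat l) j) \<le> (R + real l + real K) ^ j"
    using assms Suc by (intro norm_pochhammer_le) auto
  also have "\<dots> \<le> (R + real K + real l + 1) ^ j" using assms by (intro power_mono) auto
  also have "\<dots> \<le> (R + real K + real l + 1) ^ K" using assms Suc by (intro power_increasing) auto
  finally have p: "norm (pochhammer (w - of_nat l) j) \<le> (R + real K + real l + 1) ^ K" .
  have "norm (pow_prim i (w - of_nat l) (of_nat N))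
      = norm (pochhammer (w - of_nat l) j) * real N powr (- (Re w - real l) - real j)"
    unfolding Suc using norm_pow_prim_Suc[of "real N" j "w - of_nat l"] assms by simp
  also have "real N powr (- (Re w - real l) - real j) = real N powr (1 - Re w - real i) * real N ^ l"
    using assms by (simp add: Suc algebra_simps flip: powr_realpow powr_add)
  also have "norm (pochhammer (w - of_nat l) j) * (real N powr (1 - Re w - real i) * real N ^ l)
     \<le> (R + real K + real l + 1) ^ K * (real N powr (1 - Re w - real i) * real N ^ l)"
    by (intro mult_right_mono p) auto
  finally show ?thesis by (simp add: mult.assoc)
qed

lemma poly_factor_le:
  assumes "R \<ge> 0"
  shows "(R + real K + real l + 1) ^ K \<le> (R + real K + 1) ^ K * real (Suc l) ^ K"
proof -
  have "R + real K + real l + 1 \<le> (R + real K + 1) * real (Suc l)"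
    using assms by (simp add: algebra_simps)
  then have "(R + real K + real l + 1) ^ K \<le> ((R + real K + 1) * real (Suc l)) ^ K"
    using assms by (intro power_mono) auto
  then show ?thesis by (simp add: power_mult_distrib)
qed

lemma ratio_power_le:
  assumes "N \<ge> 1" "3 * N \<le> 2 * n"
  shows "real N ^ l / real n ^ l \<le> (2 / 3) ^ l"
proof -
  have "real N / real n \<le> 2 / 3" using assms by (simp add: divide_simps)
  then have "(real N / real n) ^ l \<le> (2 / 3) ^ l" by (intro power_mono) auto
  then show ?thesis by (simp add: power_divide)
qed

lemma summable_half_boundary:
  assumes "N \<ge> 1" "3 * N \<le> 2 * n"
  shows "summable (\<lambda>l. rising c l / of_nat n ^ l * pow_prim i (w - of_nat l) (of_nat N))"
proof -
  define d where "d = nat \<lceil>norm c\<rceil>"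
  define R where "R = norm w"
  define A where "A = (R + real i + 1) ^ i * real N powr (1 - Re w - real i)"
  have d: "norm c \<le> real d" unfolding d_def by (simp add: real_nat_ceiling_ge)
  have R: "R \<ge> 0" by (simp add: R_def)
  show ?thesis
  proof (rule summable_comparison_test_ev)
    show "summable (\<lambda>l. A * (real (Suc l) ^ (d + i) * (2 / 3) ^ l))"
      by (intro summable_mult summable_poly_geometric) auto
    obtain l0 where l0: "R < real l0" using reals_Archimedean2 by blast
    show "\<forall>\<^sub>F l in sequentially. norm (rising c l / of_nat n ^ l * pow_prim i (w - of_nat l) (of_nat N))
       \<le> A * (real (Suc l) ^ (d + i) * (2 / 3) ^ l)"
    proof (rule eventually_sequentiallyI[of l0])
      fix l assume "l \<ge> l0"
      then have l: "real l > R" using l0 by linarith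
      have "norm (rising c l / of_nat n ^ l * pow_prim i (w - of_nat l) (of_nat N))
        = norm (rising c l) * norm (pow_prim i (w - of_nat l) (of_nat N)) / real n ^ l"
        by (simp add: norm_mult norm_divide norm_power del: pow_prim.simps)
      also have "\<dots> \<le> real (Suc l) ^ d * ((R + real i + real l + 1) ^ i * real N powr (1 - Re w - real i) * real N ^ l) / real n ^ l"
        using assms l R d by (intro divide_right_mono mult_mono norm_rising_le norm_pow_prim_shift_le) (auto simp: R_def)
      also have "\<dots> \<le> real (Suc l) ^ d * (((R + real i + 1) ^ i * real (Suc l) ^ i) * real N powr (1 - Re w - real i) * real N ^ l) / real n ^ l"
        using R by (intro divide_right_mono mult_left_mono mult_right_mono poly_factor_le) auto
      also have "\<dots> = A * real (Suc l) ^ (d + i) * (real N ^ l / real n ^ l)"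
        by (simp add: A_def power_add)
      also have "\<dots> \<le> A * real (Suc l) ^ (d + i) * (2 / 3) ^ l"
        using R assms by (intro mult_left_mono ratio_power_le) (auto simp: A_def)
      finally show "norm (rising c l / of_nat n ^ l * pow_prim i (w - of_nat l) (of_nat N))
         \<le> A * (real (Suc l) ^ (d + i) * (2 / 3) ^ l)" by (simp add: mult.assoc)
    qed
  qed
qed

lemma half_sum_term_sums:
  fixes c w :: complex
  assumes "1 \<le> k" "k < N" "3 * N \<le> 2 * n"
  shows "(\<lambda>l. rising c l / of_nat n ^ l * of_nat k powr (- (w - of_nat l)))
     sums (of_nat k powr (- w) * (1 - of_nat k / of_nat n) powr (- c))"
proof -
  have "norm (of_nat k / of_nat n :: complex) < 1" using assms by (simp add: norm_divide)
  from sums_mult[OF rising_sums[OF this, of c], of "of_nat k powr (- w)"]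
  show ?thesis
    using assms by (simp add: powr_diff powr_nat power_divide powr_minus field_simps)
qed

text \<open>For \<open>l\<close> beyond \<open>R + K\<close> the terms \<open>k^(l-w)\<close> grow so fast that the
  errors of all steps from \<open>1\<close> to \<open>N\<close> are at most of the order of the last one, and no
  constant has to be split off. This matters because \<open>\<zeta>(w-l)\<close> grows like a factorial in
  \<open>l\<close>, whereas the bound here is polynomial in \<open>l\<close> apart from the factor
  \<open>N^l\<close>.\<close>
lemma pow_regular_large_le:
  assumes "N \<ge> 1" "norm w \<le> R" "K \<ge> 2" "R \<ge> 0" "real l \<ge> R + real K"
  shows "norm (pow_regular K (w - of_nat l) N)
       \<le> 2 * bern_bound K * (R + real K + real l + 1) ^ K * real N powr (2 - Re w - real K) * real N ^ l"
proof -
  define P where "P = (R + real K + real l + 1) ^ K"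
  define e where "e = 1 - Re w - real K + real l"
  have P: "P \<ge> 1" using assms unfolding P_def by (intro one_le_power) auto
  have Rew: "\<bar>Re w\<bar> \<le> R" using abs_Re_le_cmod[of w] assms by linarith
  have e: "e \<ge> 1" using Rew assms unfolding e_def by linarith
  have P1: "norm (pow_prim i (w - of_nat l) (of_nat 1)) \<le> P" if "i \<le> K" for i
    using norm_pow_prim_shift_le[of 1 w R i K l] assms that by (simp add: P_def del: pow_prim.simps)
  have one: "norm (pow_regular K (w - of_nat l) 1) \<le> bern_bound K * P"
  proof -
    have "norm (pow_regular K (w - of_nat l) 1) = norm (\<Sum>i<K. of_real (bern i) * pow_prim i (w - of_nat l) (of_nat 1))"
      by (simp add: pow_regular_def pow_boundary_def del: pow_prim.simps)
    also have "\<dots> \<le> (\<Sum>i<K. \<bar>bern i\<bar> * P)"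
      by (rule sum_norm_le) (use P1 in \<open>auto simp: norm_mult simp del: pow_prim.simps intro!: mult_left_mono\<close>)
    finally show ?thesis by (simp add: bern_bound_def sum_distrib_right)
  qed
  have incr: "norm (pow_regular K (w - of_nat l) (Suc k) - pow_regular K (w - of_nat l) k) \<le> bern_bound K * (P * real N powr e)"
    if k: "1 \<le> k" "k < N" for k
  proof (rule pow_regular_increment)
    fix u assume u: "u \<in> {real k..real k + 1}"
    obtain K' where K': "K = Suc K'" using assms by (cases K) auto
    have "norm (w - of_nat l) \<le> R + real l"
      using norm_triangle_ineq4[of w "of_nat l"] assms by simp
    then have "norm (pochhammer (w - of_nat l) K') \<le> (R + real l + real K) ^ K'"
      by (intro norm_pochhammer_le) (auto simp: K')
    also have "\<dots> \<le> (R + real K + real l + 1) ^ K'" using assms by (intro power_mono) auto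
    also have "\<dots> \<le> P" unfolding P_def using assms K' by (intro power_increasing) auto
    finally have p: "norm (pochhammer (w - of_nat l) K') \<le> P" .
    have "norm (pow_prim K (w - of_nat l) (of_real u)) = norm (pochhammer (w - of_nat l) K') * u powr e"
      unfolding K' using u k norm_pow_prim_Suc[of u K' "w - of_nat l"] by (simp add: e_def K' algebra_simps)
    also have "\<dots> \<le> P * real N powr e"
    proof (rule mult_mono[OF p])
      have "real k + 1 \<le> real N" using k by linarith
      then show "u powr e \<le> real N powr e" using u e by (intro powr_mono2) auto
    qed (use P in auto)
    finally show "norm (pow_prim K (w - of_nat l) (of_real u)) \<le> P * real N powr e" .
  qed (use k assms in auto)
  have "norm (pow_regular K (w - of_nat l) M) \<le> bern_bound K * P + (real M - 1) * (bern_bound K * (P * real N powr e))"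
    if "1 \<le> M" "M \<le> N" for M
    using that
  proof (induction M rule: dec_induct)
    case base
    then show ?case using one by simp
  next
    case (step M)
    have "norm (pow_regular K (w - of_nat l) (Suc M)) \<le> norm (pow_regular K (w - of_nat l) M)
       + norm (pow_regular K (w - of_nat l) (Suc M) - pow_regular K (w - of_nat l) M)"
      by (rule norm_triangle_sub)
    also have "\<dots> \<le> (bern_bound K * P + (real M - 1) * (bern_bound K * (P * real N powr e))) + bern_bound K * (P * real N powr e)"
      using step by (intro add_mono incr) auto
    finally show ?case by (simp add: algebra_simps)
  qed
  from this[of N] have "norm (pow_regular K (w - of_nat l) N) \<le> bern_bound K * P + (real N - 1) * (bern_bound K * (P * real N powr e))"
    using assms by simp
  also have "\<dots> \<le> bern_bound K * (P * (real N * real N powr e)) + real N * (bern_bound K * (P * real N powr e))"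
  proof (rule add_mono)
    have "1 * 1 \<le> real N * real N powr e" using assms e by (intro mult_mono ge_one_powr_ge_zero) auto
    then have "P * 1 \<le> P * (real N * real N powr e)" using P by (intro mult_left_mono) auto
    then show "bern_bound K * P \<le> bern_bound K * (P * (real N * real N powr e))"
      using bern_bound_nonneg[of K] by (intro mult_left_mono) auto
    show "(real N - 1) * (bern_bound K * (P * real N powr e)) \<le> real N * (bern_bound K * (P * real N powr e))"
      using bern_bound_nonneg[of K] P by (intro mult_right_mono) auto
  qed
  also have "\<dots> = 2 * bern_bound K * P * (real N * real N powr e)" by (simp add: algebra_simps)
  also have "real N * real N powr e = real N powr (2 - Re w - real K) * real N ^ l"
    using assms by (simp add: e_def powr_mult_base flip: powr_realpow powr_add) (simp add: algebra_simps)
  finally show ?thesis by (simp add: P_def mult.assoc)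
qed

text \<open>Expand the binomial factor and sum the power \<open>k^(l-w)\<close> for each \<open>l\<close> separately:
  for \<open>l < L\<close> with \<open>pow_regular_approx\<close>, for \<open>l \<ge> L\<close> with
  \<open>pow_regular_large_le\<close>. As \<open>N \<le> 2n/3\<close>, the errors carry the factor
  \<open>(2/3)^l\<close>, against which the polynomial growth in \<open>l\<close> is summable.\<close>
lemma half_sum_approx:
  fixes R :: real and d K L :: nat
  assumes "K \<ge> 2" "R \<ge> 0" "real L \<ge> R + real K"
  shows "\<exists>C\<ge>0. \<forall>c w n N. norm c \<le> real d \<longrightarrow> norm w \<le> R \<longrightarrow> 1 \<le> N \<longrightarrow> 3 * N \<le> 2 * n \<longrightarrow>
     norm (half_sum c w n N - half_zeta L c w n - half_correction K c w n N)
       \<le> C * real N powr (2 - Re w - real K)"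
proof -
  obtain C0 where C0: "C0 \<ge> 0" "\<And>w N. norm w \<le> R + real L \<Longrightarrow> N \<ge> 1 \<Longrightarrow>
      norm (pow_regular K w N - zeta_const w) \<le> C0 * real N powr (1 - Re w - real K)"
    using pow_regular_approx[of K "R + real L"] assms by auto
  define C1 where "C1 = C0 + 2 * bern_bound K * (R + real K + 1) ^ K"
  have C1: "C1 \<ge> 0" using C0 bern_bound_nonneg[of K] assms by (simp add: C1_def)
  define S where "S = (\<Sum>l. real (Suc l) ^ (d + K) * (2 / 3) ^ l)"
  have sumS: "summable (\<lambda>l. real (Suc l) ^ (d + K) * (2 / 3 :: real) ^ l)"
    by (rule summable_poly_geometric) auto
  have "S \<ge> 0" unfolding S_def by (rule suminf_nonneg[OF sumS]) auto
  have main: "norm (half_sum c w n N - half_zeta L c w n - half_correction K c w n N)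
       \<le> C1 * S * real N powr (2 - Re w - real K)"
    if c: "norm c \<le> real d" and w: "norm w \<le> R" and N: "1 \<le> N" "3 * N \<le> 2 * n" for c w n N
  proof -
    define E where "E = (\<lambda>l. pow_regular K (w - of_nat l) N - (if l < L then zeta_const (w - of_nat l) else 0))"
    define X where "X = real N powr (2 - Re w - real K)"
    have E: "norm (E l) \<le> C1 * real (Suc l) ^ K * X * real N ^ l" for l
    proof (cases "l < L")
      case True
      have "norm (w - of_nat l) \<le> R + real L"
        using norm_triangle_ineq4[of w "of_nat l"] w True by simp
      from C0(2)[OF this N(1)] have "norm (E l) \<le> C0 * real N powr (1 - Re (w - of_nat l) - real K)"
        unfolding E_def using True by simp
      also have "real N powr (1 - Re (w - of_nat l) - real K) = real N powr (1 - Re w - real K) * real N ^ l"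
        using N by (simp flip: powr_realpow powr_add) (simp add: algebra_simps)
      also have "C0 * \<dots> \<le> (C1 * real (Suc l) ^ K) * (X * real N ^ l)"
      proof (rule mult_mono)
        have "C0 * 1 \<le> C1 * real (Suc l) ^ K"
          using C0(1) bern_bound_nonneg[of K] assms by (intro mult_mono one_le_power) (auto simp: C1_def)
        then show "C0 \<le> C1 * real (Suc l) ^ K" by simp
        show "real N powr (1 - Re w - real K) * real N ^ l \<le> X * real N ^ l"
          unfolding X_def using N by (intro mult_right_mono powr_mono) auto
      qed (use C1 in auto)
      finally show ?thesis by (simp add: mult.assoc)
    next
      case False
      then have "norm (E l) \<le> 2 * bern_bound K * (R + real K + real l + 1) ^ K * X * real N ^ l"
        unfolding E_def X_def using pow_regular_large_le[of N w R K l] N w assms by simp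
      also have "\<dots> \<le> 2 * bern_bound K * ((R + real K + 1) ^ K * real (Suc l) ^ K) * X * real N ^ l"
        using bern_bound_nonneg[of K] assms
        by (intro mult_right_mono mult_left_mono poly_factor_le) (auto simp: X_def)
      also have "\<dots> = (2 * bern_bound K * (R + real K + 1) ^ K) * (real (Suc l) ^ K * X * real N ^ l)"
        by (simp add: mult_ac)
      also have "\<dots> \<le> C1 * (real (Suc l) ^ K * X * real N ^ l)"
        using C0 by (intro mult_right_mono) (auto simp: C1_def X_def)
      finally show ?thesis by (simp add: mult.assoc)
    qed
    have "(\<lambda>l. rising c l / of_nat n ^ l * E l) sums
       (half_sum c w n N - half_correction K c w n N - half_zeta L c w n)"
    proof -
      have 1: "(\<lambda>l. \<Sum>k=1..<N. rising c l / of_nat n ^ l * of_nat k powr (- (w - of_nat l))) sums half_sum c w n N"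
        unfolding half_sum_def using N by (intro sums_sum half_sum_term_sums) auto
      have 2: "(\<lambda>l. \<Sum>i<K. of_real (bern i) * (rising c l / of_nat n ^ l * pow_prim i (w - of_nat l) (of_nat N)))
          sums half_correction K c w n N"
        unfolding half_correction_def half_boundary_def using N
        by (intro sums_sum sums_mult summable_sums summable_half_boundary)
      have 3: "(\<lambda>l. if l \<in> {..<L} then rising c l / of_nat n ^ l * zeta_const (w - of_nat l) else 0)
          sums half_zeta L c w n"
        unfolding half_zeta_def by (rule sums_If_finite_set) auto
      have "rising c l / of_nat n ^ l * E l = (\<Sum>k=1..<N. rising c l / of_nat n ^ l * of_nat k powr (- (w - of_nat l)))
         - (\<Sum>i<K. of_real (bern i) * (rising c l / of_nat n ^ l * pow_prim i (w - of_nat l) (of_nat N)))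
         - (if l \<in> {..<L} then rising c l / of_nat n ^ l * zeta_const (w - of_nat l) else 0)" for l
        unfolding E_def pow_regular_def pow_boundary_def
        by (simp add: right_diff_distrib sum_distrib_left mult_ac del: pow_prim.simps)
      then show ?thesis using sums_diff[OF sums_diff[OF 1 2] 3] by simp
    qed
    then have eq: "half_sum c w n N - half_zeta L c w n - half_correction K c w n N
         = (\<Sum>l. rising c l / of_nat n ^ l * E l)"
      by (simp add: sums_iff algebra_simps)
    have "norm (\<Sum>l. rising c l / of_nat n ^ l * E l) \<le> (\<Sum>l. C1 * X * (real (Suc l) ^ (d + K) * (2 / 3) ^ l))"
    proof (rule norm_suminf_le)
      fix l
      have "norm (rising c l / of_nat n ^ l * E l) = norm (rising c l) * norm (E l) / real n ^ l"
        by (simp add: norm_mult norm_divide norm_power)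
      also have "\<dots> \<le> real (Suc l) ^ d * (C1 * real (Suc l) ^ K * X * real N ^ l) / real n ^ l"
        using c by (intro divide_right_mono mult_mono norm_rising_le E) auto
      also have "\<dots> = C1 * X * real (Suc l) ^ (d + K) * (real N ^ l / real n ^ l)"
        by (simp add: power_add)
      also have "\<dots> \<le> C1 * X * real (Suc l) ^ (d + K) * (2 / 3) ^ l"
        using N C1 by (intro mult_left_mono ratio_power_le) (auto simp: X_def)
      finally show "norm (rising c l / of_nat n ^ l * E l) \<le> C1 * X * (real (Suc l) ^ (d + K) * (2 / 3) ^ l)"
        by (simp add: mult.assoc)
    qed (intro summable_mult sumS)
    also have "\<dots> = C1 * S * X" unfolding suminf_mult[OF sumS] S_def by simp
    finally show ?thesis unfolding eq X_def .
  qed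
  show ?thesis
    by (intro exI[of _ "C1 * S"]) (use main C1 \<open>S \<ge> 0\<close> in auto)
qed

section \<open>Boundary terms at the cut\<close>

text \<open>Divided by \<open>z^j\<close>, this is the \<open>j\<close>-th derivative of \<open>(1 - z)^(-c)\<close>
  over \<open>j!\<close>, obtained by shifting the index of summation by \<open>j\<close>.\<close>
lemma rising_binomial_sums:
  fixes c z :: complex
  assumes "norm z < 1"
  shows "(\<lambda>l. rising c l * of_nat (l choose j) * z ^ l) sums (rising c j * z ^ j * (1 - z) powr (- c - of_nat j))"
proof -
  have "(\<lambda>l. rising c j * z ^ j * (rising (c + of_nat j) l * z ^ l)) sums
      (rising c j * z ^ j * (1 - z) powr (- (c + of_nat j)))"
    by (intro sums_mult rising_sums assms)
  moreover have "rising c j * z ^ j * (rising (c + of_nat j) l * z ^ l)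
      = rising c (l + j) * of_nat (l + j choose j) * z ^ (l + j)" for l
  proof -
    have "pochhammer c (l + j) = pochhammer c j * pochhammer (c + of_nat j) l"
      by (metis add.commute pochhammer_product')
    moreover have "(of_nat (l + j choose j) :: complex) = fact (l + j) / (fact j * fact l)"
      by (simp add: binomial_fact)
    ultimately show ?thesis by (simp add: rising_def power_add)
  qed
  ultimately have "(\<lambda>l. rising c (l + j) * of_nat (l + j choose j) * z ^ (l + j)) sums
     (rising c j * z ^ j * (1 - z) powr (- (c + of_nat j)))" by simp
  then have "(\<lambda>l. rising c l * of_nat (l choose j) * z ^ l) sums
     (rising c j * z ^ j * (1 - z) powr (- (c + of_nat j)) + (\<Sum>l<j. rising c l * of_nat (l choose j) * z ^ l))"
    by (subst (asm) sums_iff_shift) simp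
  moreover have "(\<Sum>l<j. rising c l * of_nat (l choose j) * z ^ l) = 0" by (intro sum.neutral) auto
  ultimately show ?thesis by simp
qed

lemma complement_ratio:
  assumes "N + M > 0"
  shows "1 - of_nat N / of_nat (N + M) = (of_nat M / of_nat (N + M) :: complex)"
proof -
  have "(of_nat (N + M) :: complex) \<noteq> 0" using assms by (simp only: of_nat_eq_0_iff)
  then have "(of_nat N + of_nat M) / of_nat (N + M) = (1 :: complex)" by (metis divide_self of_nat_add)
  then show ?thesis by (metis add_diff_cancel_left' add_divide_distrib)
qed

text \<open>By Leibniz' rule, the \<open>i\<close>-th derivative of \<open>x^(-w) (N + M - x)^(-c)\<close> at \<open>x
  = N\<close>.\<close>
definition mixed_deriv :: "nat \<Rightarrow> complex \<Rightarrow> complex \<Rightarrow> nat \<Rightarrow> nat \<Rightarrow> complex" where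
  "mixed_deriv i c w N M = fact i * (\<Sum>j\<le>i. (-1) ^ (i - j) * rising w (i - j) * rising c j *
      of_nat N powr (- w - of_nat (i - j)) * of_nat M powr (- c - of_nat j))"

text \<open>The reflection \<open>x \<mapsto> N + M - x\<close> exchanges the two factors and gives each derivative a
  sign.\<close>
lemma mixed_deriv_swap: "mixed_deriv i w c M N = (-1) ^ i * mixed_deriv i c w N M"
proof -
  have "(\<Sum>j\<le>i. (-1) ^ (i - j) * rising c (i - j) * rising w j *
      of_nat M powr (- c - of_nat (i - j)) * of_nat N powr (- w - of_nat j))
    = (\<Sum>j\<le>i. (-1) ^ (i - (i - j)) * rising c (i - (i - j)) * rising w (i - j) *
      of_nat M powr (- c - of_nat (i - (i - j))) * of_nat N powr (- w - of_nat (i - j)))"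
    by (rule sum.reindex_bij_witness[of _ "\<lambda>j. i - j" "\<lambda>j. i - j"]) auto
  also have "\<dots> = (\<Sum>j\<le>i. (-1) ^ i * ((-1) ^ (i - j) * rising w (i - j) * rising c j *
      of_nat N powr (- w - of_nat (i - j)) * of_nat M powr (- c - of_nat j)))"
  proof (rule sum.cong[OF refl])
    fix j assume "j \<in> {..i}"
    then obtain k where i: "i = j + k" using le_Suc_ex by auto
    have "(-1 :: complex) ^ j = (-1) ^ (j + k) * (-1) ^ k"
      by (simp add: power_add mult.assoc flip: power_mult_distrib)
    then show "(-1) ^ (i - (i - j)) * rising c (i - (i - j)) * rising w (i - j) *
      of_nat M powr (- c - of_nat (i - (i - j))) * of_nat N powr (- w - of_nat (i - j))
      = (-1) ^ i * ((-1) ^ (i - j) * rising w (i - j) * rising c j *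
      of_nat N powr (- w - of_nat (i - j)) * of_nat M powr (- c - of_nat j))"
      by (simp add: i)
  qed
  finally show ?thesis unfolding mixed_deriv_def sum_distrib_left[symmetric] by simp
qed

text \<open>Vandermonde's identity splits the falling factorial of \<open>l - w\<close> into falling factorials of
  \<open>l\<close> and of \<open>-w\<close>; the sum over \<open>l\<close> is then
  \<open>rising_binomial_sums\<close>.\<close>
lemma half_boundary_Suc:
  assumes "1 \<le> N" "1 \<le> M"
  shows "of_nat (N + M) powr (- c) * half_boundary (Suc i) c w (N + M) N = mixed_deriv i c w N M"
proof -
  define n where "n = N + M"
  define z where "z = (of_nat N / of_nat n :: complex)"
  have n: "n > 0" "N < n" using assms by (auto simp: n_def)
  have z: "norm z < 1" using n by (simp add: z_def norm_divide)
  have z1: "1 - z = of_real (real M / real n)"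
    unfolding z_def n_def using complement_ratio[of N M] assms by simp
  have coef: "rising c l / of_nat n ^ l * pow_prim (Suc i) (w - of_nat l) (of_nat N)
     = (\<Sum>j\<le>i. fact i * (-1) ^ (i - j) * rising w (i - j) * of_nat N powr (- w - of_nat i) *
          (rising c l * of_nat (l choose j) * z ^ l))" for l
  proof -
    have "(-1) ^ i * pochhammer (w - of_nat l) i = fact i * ((of_nat l + - w) gchoose i)"
      by (simp add: gbinomial_pochhammer)
    also have "(of_nat l + - w) gchoose i = (\<Sum>j\<le>i. (of_nat l gchoose j) * ((- w) gchoose (i - j)))"
      by (simp only: gbinomial_Vandermonde flip: atLeast0AtMost)
    also have "\<dots> = (\<Sum>j\<le>i. of_nat (l choose j) * ((-1) ^ (i - j) * rising w (i - j)))"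
      by (intro sum.cong refl) (simp add: binomial_gbinomial rising_gbinomial flip: power_mult_distrib mult.assoc)
    finally have p: "(-1) ^ i * pochhammer (w - of_nat l) i
        = fact i * (\<Sum>j\<le>i. of_nat (l choose j) * ((-1) ^ (i - j) * rising w (i - j)))" .
    have "(of_nat N :: complex) powr (- (w - of_nat l) - of_nat i) = of_nat N powr (- w - of_nat i + of_nat l)"
      by (simp add: algebra_simps)
    also have "\<dots> = of_nat N powr (- w - of_nat i) * of_nat N ^ l"
      using assms by (subst powr_add) (simp add: powr_nat)
    finally have q: "(of_nat N :: complex) powr (- (w - of_nat l) - of_nat i) = of_nat N powr (- w - of_nat i) * of_nat N ^ l" .
    show ?thesis unfolding pow_prim.simps p q
      by (simp add: sum_distrib_left sum_distrib_right z_def power_divide mult_ac)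
  qed
  have "(\<lambda>l. rising c l / of_nat n ^ l * pow_prim (Suc i) (w - of_nat l) (of_nat N)) sums
     (\<Sum>j\<le>i. fact i * (-1) ^ (i - j) * rising w (i - j) * of_nat N powr (- w - of_nat i) *
          (rising c j * z ^ j * (1 - z) powr (- c - of_nat j)))"
    unfolding coef by (intro sums_sum sums_mult rising_binomial_sums z)
  then have "half_boundary (Suc i) c w n N = (\<Sum>j\<le>i. fact i * (-1) ^ (i - j) * rising w (i - j) * of_nat N powr (- w - of_nat i) *
          (rising c j * z ^ j * (1 - z) powr (- c - of_nat j)))"
    unfolding half_boundary_def by (simp add: sums_iff)
  then have "of_nat n powr (- c) * half_boundary (Suc i) c w n N
    = (\<Sum>j\<le>i. fact i * (-1) ^ (i - j) * rising w (i - j) * rising c j *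
        (of_nat N powr (- w - of_nat i) * z ^ j * of_nat n powr (- c) * (1 - z) powr (- c - of_nat j)))"
    by (simp add: sum_distrib_left mult_ac)
  also have "\<dots> = (\<Sum>j\<le>i. fact i * (-1) ^ (i - j) * rising w (i - j) * rising c j *
        (of_nat N powr (- w - of_nat (i - j)) * of_nat M powr (- c - of_nat j)))"
  proof (rule sum.cong[OF refl])
    fix j assume "j \<in> {..i}"
    then have j: "j \<le> i" by simp
    have "(of_nat N :: complex) powr (- w - of_nat (i - j)) = of_nat N powr (- w - of_nat i + of_nat j)"
      using j by (simp add: of_nat_diff algebra_simps)
    also have "\<dots> = of_nat N powr (- w - of_nat i) * of_nat N ^ j"
      using assms by (subst powr_add) (simp add: powr_nat)
    finally have 1: "(of_nat N :: complex) powr (- w - of_nat (i - j)) = of_nat N powr (- w - of_nat i) * of_nat N ^ j" .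
    have "(of_nat n :: complex) powr (- c) = of_nat n powr (- c - of_nat j + of_nat j)" by simp
    also have "\<dots> = of_nat n powr (- c - of_nat j) * of_nat n ^ j"
      using n by (subst powr_add) (simp add: powr_nat)
    finally have 2: "(of_nat n :: complex) powr (- c) = of_nat n powr (- c - of_nat j) * of_nat n ^ j" .
    have "(of_nat n * (1 - z)) powr (- c - of_nat j) = of_nat n powr (- c - of_nat j) * (1 - z) powr (- c - of_nat j)"
      unfolding z1 using powr_times_real[of "of_nat n" "of_real (real M / real n)" "- c - of_nat j"] by simp
    moreover have "of_nat n * (1 - z) = of_nat M" using n unfolding z1 by simp
    ultimately have 3: "of_nat M powr (- c - of_nat j) = of_nat n powr (- c - of_nat j) * (1 - z) powr (- c - of_nat j)" by simp
    have 4: "z ^ j * of_nat n ^ j = of_nat N ^ j" using n by (simp add: z_def power_divide)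
    have "of_nat N powr (- w - of_nat i) * z ^ j * of_nat n powr (- c) * (1 - z) powr (- c - of_nat j)
      = of_nat N powr (- w - of_nat i) * (z ^ j * of_nat n ^ j) * (of_nat n powr (- c - of_nat j) * (1 - z) powr (- c - of_nat j))"
      by (simp add: 2)
    also have "\<dots> = of_nat N powr (- w - of_nat (i - j)) * of_nat M powr (- c - of_nat j)"
      by (simp add: 1 3 4)
    finally show "fact i * (-1) ^ (i - j) * rising w (i - j) * rising c j *
        (of_nat N powr (- w - of_nat i) * z ^ j * of_nat n powr (- c) * (1 - z) powr (- c - of_nat j))
      = fact i * (-1) ^ (i - j) * rising w (i - j) * rising c j *
        (of_nat N powr (- w - of_nat (i - j)) * of_nat M powr (- c - of_nat j))"
      by (simp only:)
  qed
  finally show ?thesis by (simp add: mixed_deriv_def n_def sum_distrib_left mult_ac)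
qed

section \<open>The finite part of the beta integral\<close>

text \<open>Up to the factor \<open>y^(1-s)\<close>, the primitive of \<open>y^(-s) (1-y)^(-q)\<close> that is
  expanded at \<open>0\<close>.\<close>
definition left_series :: "nat \<Rightarrow> complex \<Rightarrow> complex \<Rightarrow> complex" where
  "left_series q s y = (\<Sum>l. rising (of_nat q) l / (of_nat l + 1 - s) * y ^ l)"

text \<open>With \<open>z = 1 - y\<close> and up to the factor \<open>z^(1-q)\<close>, the primitive with respect to
  \<open>z\<close> of \<open>z^(-q) (1-z)^(-s)\<close>, expanded at \<open>z = 0\<close>, without the logarithm that
  comes from the term \<open>i = q - 1\<close>.\<close>
definition right_series :: "nat \<Rightarrow> complex \<Rightarrow> complex \<Rightarrow> complex" where
  "right_series q s z = (\<Sum>i. (if i = q - 1 then 0 else rising s i / (of_nat i - of_nat q + 1)) * z ^ i)"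

text \<open>The sum of the two primitives at \<open>y\<close>, which does not depend on \<open>y\<close>: the finite
  part of the beta integral \<open>\<integral> x^(-s) (1-x)^(-q) dx\<close> over \<open>[0,1]\<close>.\<close>
definition beta_const :: "nat \<Rightarrow> complex \<Rightarrow> complex \<Rightarrow> complex" where
  "beta_const q s y = y powr (1 - s) * left_series q s y
     + (1 - y) powr (1 - of_nat q) * right_series q s (1 - y) + rising s (q - 1) * ln (1 - y)"

lemma norm_shift_ge:
  assumes "norm s \<le> 1 / 2"
  shows "norm (of_nat l + 1 - s :: complex) \<ge> 1 / 2"
proof -
  have "Re (of_nat l + 1 - s) \<ge> 1 / 2" using abs_Re_le_cmod[of s] assms by simp
  then show ?thesis using complex_Re_le_cmod order_trans by blast
qed

lemma summable_poly_geometric_complex: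
  fixes f :: "nat \<Rightarrow> complex"
  assumes "norm z < 1" "\<And>l. norm (f l) \<le> A * real (Suc l) ^ d"
  shows "summable (\<lambda>l. f l * z ^ l)"
proof (rule summable_comparison_test')
  show "summable (\<lambda>l. A * (real (Suc l) ^ d * norm z ^ l))"
    using assms by (intro summable_mult summable_poly_geometric) auto
  show "norm (f l * z ^ l) \<le> A * (real (Suc l) ^ d * norm z ^ l)" for l
    using mult_right_mono[OF assms(2)[of l], of "norm z ^ l"] by (simp add: norm_mult norm_power mult.assoc)
qed

lemma norm_left_coeff_le:
  assumes "norm s \<le> 1 / 2"
  shows "norm (rising (of_nat q) l / (of_nat l + 1 - s :: complex)) \<le> 2 * real (Suc l) ^ q"
proof -
  have "norm (rising (of_nat q) l / (of_nat l + 1 - s :: complex)) \<le> real (Suc l) ^ q / (1 / 2)"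
    unfolding norm_divide by (intro frac_le norm_rising_le norm_shift_ge assms) auto
  then show ?thesis by simp
qed

lemma norm_right_coeff_le:
  assumes "norm s \<le> 1" "q \<ge> 1"
  shows "norm (if i = q - 1 then 0 else rising s i / (of_nat i - of_nat q + 1 :: complex)) \<le> 1 * real (Suc i) ^ 1"
proof (cases "i = q - 1")
  case False
  have "(of_nat i - of_nat q + 1 :: complex) = of_int (int i - int q + 1)" by simp
  then have "norm (of_nat i - of_nat q + 1 :: complex) = \<bar>of_int (int i - int q + 1)\<bar>"
    by (metis norm_of_int)
  also have "\<dots> \<ge> 1" using False assms by linarith
  finally have "norm (rising s i / (of_nat i - of_nat q + 1 :: complex)) \<le> real (Suc i) ^ 1 / 1"
    unfolding norm_divide using assms by (intro frac_le norm_rising_le) auto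
  then show ?thesis using False by simp
qed simp

lemma left_series_sums:
  assumes "norm s \<le> 1 / 2" "norm y < 1"
  shows "(\<lambda>l. rising (of_nat q) l / (of_nat l + 1 - s) * y ^ l) sums left_series q s y"
  unfolding left_series_def
  by (intro summable_sums summable_poly_geometric_complex[OF _ norm_left_coeff_le] assms)

lemma right_series_sums:
  assumes "norm s \<le> 1 / 2" "norm z < 1" "q \<ge> 1"
  shows "(\<lambda>i. (if i = q - 1 then 0 else rising s i / (of_nat i - of_nat q + 1)) * z ^ i) sums right_series q s z"
  unfolding right_series_def
  using assms by (intro summable_sums summable_poly_geometric_complex[OF _ norm_right_coeff_le]) auto

lemma right_series_1: "right_series 1 s = (\<lambda>z. \<Sum>i. (if i = 0 then 0 else rising s i / of_nat i) * z ^ i)"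
  by (rule ext) (simp add: right_series_def cong: if_cong)

lemma half_boundary_0_left:
  assumes "1 \<le> N" "N < n" "norm s \<le> 1 / 2"
  shows "half_boundary 0 (of_nat q) s n N = of_nat N powr (1 - s) * left_series q s (of_nat N / of_nat n)"
proof -
  have "norm (of_nat N / of_nat n :: complex) < 1" using assms by (simp add: norm_divide)
  from sums_mult[OF left_series_sums[OF assms(3) this, of q], of "of_nat N powr (1 - s)"]
  have "(\<lambda>l. of_nat N powr (1 - s) * (rising (of_nat q) l / (of_nat l + 1 - s) * (of_nat N / of_nat n) ^ l))
     sums (of_nat N powr (1 - s) * left_series q s (of_nat N / of_nat n))" .
  moreover have "of_nat N powr (1 - s) * (rising (of_nat q) l / (of_nat l + 1 - s) * (of_nat N / of_nat n) ^ l)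
     = rising (of_nat q) l / of_nat n ^ l * pow_prim 0 (s - of_nat l) (of_nat N)" for l
  proof -
    have ne: "of_nat l + 1 - s \<noteq> 0" using norm_shift_ge[OF assms(3), of l] by auto
    then have ne': "s - of_nat l \<noteq> 1" by (metis add.commute diff_diff_eq2 diff_self diff_diff_add right_minus_eq)
    have "(of_nat N :: complex) powr (1 - (s - of_nat l)) = of_nat N powr (1 - s + of_nat l)"
      by (simp add: algebra_simps)
    also have "\<dots> = of_nat N powr (1 - s) * of_nat N ^ l"
      using assms by (subst powr_add) (simp add: powr_nat)
    finally show ?thesis using ne' by (simp add: power_divide algebra_simps)
  qed
  ultimately show ?thesis by (simp add: half_boundary_def sums_iff del: pow_prim.simps)
qed

lemma half_boundary_0_right:
  assumes "1 \<le> M" "M < n" "norm s \<le> 1 / 2" "q \<ge> 1"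
  shows "half_boundary 0 s (of_nat q) n M = of_nat M powr (1 - of_nat q) * right_series q s (of_nat M / of_nat n)
      + rising s (q - 1) / of_nat n ^ (q - 1) * ln (of_nat M)"
proof -
  have "norm (of_nat M / of_nat n :: complex) < 1" using assms by (simp add: norm_divide)
  from sums_mult[OF right_series_sums[OF assms(3) this assms(4)], of "of_nat M powr (1 - of_nat q)"]
  have 1: "(\<lambda>i. of_nat M powr (1 - of_nat q) * ((if i = q - 1 then 0 else rising s i / (of_nat i - of_nat q + 1)) * (of_nat M / of_nat n) ^ i))
     sums (of_nat M powr (1 - of_nat q) * right_series q s (of_nat M / of_nat n))" .
  have 2: "(\<lambda>i. if i = q - 1 then rising s i / of_nat n ^ i * ln (of_nat M) else 0) sums
     (rising s (q - 1) / of_nat n ^ (q - 1) * ln (of_nat M))"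
    by (rule sums_single)
  have "of_nat M powr (1 - of_nat q) * ((if i = q - 1 then 0 else rising s i / (of_nat i - of_nat q + 1)) * (of_nat M / of_nat n) ^ i)
     + (if i = q - 1 then rising s i / of_nat n ^ i * ln (of_nat M) else 0)
     = rising s i / of_nat n ^ i * pow_prim 0 (of_nat q - of_nat i) (of_nat M)" for i
  proof (cases "i = q - 1")
    case True
    then show ?thesis using assms by (simp add: of_nat_diff)
  next
    case False
    have ne: "(of_nat q - of_nat i :: complex) \<noteq> 1"
    proof
      assume "(of_nat q - of_nat i :: complex) = 1"
      then have "(of_nat q :: complex) = of_nat (i + 1)" by (simp add: algebra_simps)
      then have "q = i + 1" by (simp only: of_nat_eq_iff)
      with False show False by simp
    qed
    have "(of_nat M :: complex) powr (1 - (of_nat q - of_nat i)) = of_nat M powr (1 - of_nat q + of_nat i)"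
      by (simp add: algebra_simps)
    also have "\<dots> = of_nat M powr (1 - of_nat q) * of_nat M ^ i"
      using assms by (subst powr_add) (simp add: powr_nat)
    finally show ?thesis using ne False by (simp add: power_divide algebra_simps)
  qed
  with sums_add[OF 1 2] show ?thesis by (simp add: half_boundary_def sums_iff del: pow_prim.simps)
qed

text \<open>The two boundary terms of order \<open>0\<close> are primitives on the scale \<open>n\<close>. Rescaling
  to \<open>y = N/n\<close> changes the logarithm in the right one by \<open>ln n\<close>; this is the only source of
  logarithms that are not due to \<open>n^(-s)\<close>.\<close>
lemma boundary_0_total:
  assumes "1 \<le> N" "1 \<le> M" "norm s \<le> 1 / 2" "q \<ge> 1"
  shows "of_nat (N + M) powr (- of_nat q) * half_boundary 0 (of_nat q) s (N + M) N
       + of_nat (N + M) powr (- s) * half_boundary 0 s (of_nat q) (N + M) M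
       = of_nat (N + M) powr (1 - s - of_nat q) *
         (beta_const q s (of_real (real N / real (N + M))) + rising s (q - 1) * of_real (ln (real (N + M))))"
proof -
  define n where "n = N + M"
  define y where "y = (of_nat N / of_nat n :: complex)"
  define z where "z = (of_nat M / of_nat n :: complex)"
  have n: "n > 0" "N < n" "M < n" using assms by (auto simp: n_def)
  have zy: "1 - y = z" unfolding z_def y_def n_def using assms by (intro complement_ratio) simp
  define X where "X = (of_nat n :: complex) powr (1 - s - of_nat q)"
  have pN: "of_nat n powr (- of_nat q) * of_nat N powr (1 - s) = X * y powr (1 - s)"
  proof -
    have "(of_nat n * y) powr (1 - s) = of_nat n powr (1 - s) * y powr (1 - s)"
      unfolding y_def using powr_times_real[of "of_nat n" "of_real (real N / real n)" "1 - s"] by simp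
    moreover have "of_nat n * y = of_nat N" using n by (simp add: y_def)
    moreover have "X = of_nat n powr (- of_nat q) * of_nat n powr (1 - s)"
      unfolding X_def powr_add[symmetric] by simp
    ultimately show ?thesis by simp
  qed
  have pM: "of_nat n powr (- s) * of_nat M powr (1 - of_nat q) = X * z powr (1 - of_nat q)"
  proof -
    have "(of_nat n * z) powr (1 - of_nat q) = of_nat n powr (1 - of_nat q) * z powr (1 - of_nat q)"
      unfolding z_def using powr_times_real[of "of_nat n" "of_real (real M / real n)" "1 - of_nat q"] by simp
    moreover have "of_nat n * z = of_nat M" using n by (simp add: z_def)
    moreover have "X = of_nat n powr (- s) * of_nat n powr (1 - of_nat q)"
      unfolding X_def powr_add[symmetric] by (simp add: algebra_simps)
    ultimately show ?thesis by simp
  qed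
  have pn: "of_nat n powr (- s) / of_nat n ^ (q - 1) = X"
  proof -
    have "X = of_nat n powr (- s - of_nat (q - 1))" using assms by (simp add: X_def of_nat_diff algebra_simps)
    also have "\<dots> = of_nat n powr (- s) / of_nat n ^ (q - 1)" using n by (subst powr_diff) (simp add: powr_nat)
    finally show ?thesis by simp
  qed
  have "ln (of_nat M :: complex) = of_real (ln (real M))" using assms by (simp add: Ln_of_nat)
  also have "ln (real M) = ln (real n) + ln (real M / real n)"
    using n assms by (simp add: ln_div)
  also have "complex_of_real (ln (real n) + ln (real M / real n)) = of_real (ln (real n)) + ln (of_real (real M / real n))"
    using n assms by (subst Ln_of_real) auto
  finally have lnM: "ln (of_nat M :: complex) = of_real (ln (real n)) + ln z" by (simp add: z_def)
  have "of_nat n powr (- of_nat q) * half_boundary 0 (of_nat q) s n N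
       + of_nat n powr (- s) * half_boundary 0 s (of_nat q) n M
     = (of_nat n powr (- of_nat q) * of_nat N powr (1 - s)) * left_series q s y
       + (of_nat n powr (- s) * of_nat M powr (1 - of_nat q)) * right_series q s z
       + (of_nat n powr (- s) / of_nat n ^ (q - 1)) * rising s (q - 1) * ln (of_nat M)"
    using assms n by (simp add: half_boundary_0_left half_boundary_0_right y_def z_def algebra_simps)
  also have "\<dots> = X * (beta_const q s y + rising s (q - 1) * of_real (ln (real n)))"
    unfolding pN pM pn lnM beta_const_def zy by (simp add: algebra_simps)
  finally show ?thesis by (simp add: X_def y_def n_def)
qed

text \<open>Integration by parts for \<open>x^(-s) (1-x)^(-q)\<close>, as an identity between coefficients.\<close>
lemma left_series_rec:
  assumes "norm s \<le> 1 / 2" "norm y < 1" "q \<ge> 1"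
  shows "of_nat q * left_series (Suc q) s y = (s + of_nat q - 1) * left_series q s y + (1 - y) powr (- of_nat q)"
proof -
  have "of_nat q * (rising (of_nat (Suc q)) l / (of_nat l + 1 - s) * y ^ l)
      = (s + of_nat q - 1) * (rising (of_nat q) l / (of_nat l + 1 - s) * y ^ l) + rising (of_nat q) l * y ^ l" for l
  proof -
    have ne: "of_nat l + 1 - s \<noteq> 0" using norm_shift_ge[OF assms(1), of l] by auto
    have "of_nat q * pochhammer (of_nat q + 1 :: complex) l = pochhammer (of_nat q) l * (of_nat q + of_nat l)"
      by (metis pochhammer_Suc pochhammer_rec)
    then have "of_nat q * rising (of_nat (Suc q)) l = rising (of_nat q) l * (of_nat q + of_nat l :: complex)"
      by (simp add: rising_def add.commute)
    then have "of_nat q * (rising (of_nat (Suc q)) l / (of_nat l + 1 - s) * y ^ l)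
       = rising (of_nat q) l * ((s + of_nat q - 1) + (of_nat l + 1 - s)) / (of_nat l + 1 - s) * y ^ l"
      by (simp add: add_ac)
    also have "\<dots> = (s + of_nat q - 1) * (rising (of_nat q) l / (of_nat l + 1 - s) * y ^ l) + rising (of_nat q) l * y ^ l"
      using ne by (simp only: distrib_left add_divide_distrib distrib_right) simp
    finally show ?thesis .
  qed
  with sums_add[OF sums_mult[OF left_series_sums[OF assms(1,2), of q], of "s + of_nat q - 1"] rising_sums[OF assms(2), of "of_nat q"]]
  have "(\<lambda>l. of_nat q * (rising (of_nat (Suc q)) l / (of_nat l + 1 - s) * y ^ l)) sums
     ((s + of_nat q - 1) * left_series q s y + (1 - y) powr (- of_nat q))" by simp
  moreover have "(\<lambda>l. of_nat q * (rising (of_nat (Suc q)) l / (of_nat l + 1 - s) * y ^ l)) sums (of_nat q * left_series (Suc q) s y)"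
    by (intro sums_mult left_series_sums assms)
  ultimately show ?thesis using sums_unique2 by blast
qed

text \<open>The same integration by parts at the other end. The logarithm is absent from \<open>right_series\<close>,
  and the coefficient \<open>i = q\<close> that is missing on the left returns as the last summand.\<close>
lemma right_series_rec:
  assumes "norm s \<le> 1 / 2" "norm z < 1" "q \<ge> 1"
  shows "of_nat q * right_series (Suc q) s z = (s + of_nat q - 1) * (z * right_series q s z)
      - (1 - z) powr (1 - s) + rising (s - 1) q * z ^ q"
proof -
  define e where "e = (\<lambda>i. (if i = q - 1 then 0 else rising s i / (of_nat i - of_nat q + 1)) :: complex)"
  have A: "(\<lambda>i. if i = 0 then 0 else e (i - 1) * z ^ i) sums (z * right_series q s z)"
  proof -
    have "(\<lambda>i. z * (e i * z ^ i)) sums (z * right_series q s z)"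
      unfolding e_def by (intro sums_mult right_series_sums assms)
    then have "(\<lambda>i. (\<lambda>i. if i = 0 then 0 else e (i - 1) * z ^ i) (Suc i)) sums (z * right_series q s z)"
      by (simp add: mult_ac)
    then show ?thesis by (subst (asm) sums_Suc_iff) simp
  qed
  have B: "(\<lambda>i. rising (s - 1) i * z ^ i) sums ((1 - z) powr (1 - s))"
    using rising_sums[OF assms(2), of "s - 1"] by simp
  have C: "(\<lambda>i. if i = q then rising (s - 1) i * z ^ i else 0) sums (rising (s - 1) q * z ^ q)"
    by (rule sums_single)
  have D: "of_nat q * ((if i = Suc q - 1 then 0 else rising s i / (of_nat i - of_nat (Suc q) + 1)) * z ^ i)
     = (s + of_nat q - 1) * (if i = 0 then 0 else e (i - 1) * z ^ i) - rising (s - 1) i * z ^ i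
       + (if i = q then rising (s - 1) i * z ^ i else 0)" for i
  proof (cases i)
    case 0
    then show ?thesis using assms by simp
  next
    case (Suc j)
    show ?thesis
    proof (cases "i = q")
      case True
      then show ?thesis by (simp add: e_def Suc)
    next
      case False
      have ne: "(of_nat j - of_nat q + 1 :: complex) \<noteq> 0"
      proof
        assume "(of_nat j - of_nat q + 1 :: complex) = 0"
        then have "(of_nat q :: complex) = of_nat (j + 1)" by (simp add: algebra_simps)
        then have "q = j + 1" by (simp only: of_nat_eq_iff)
        with False Suc show False by simp
      qed
      have r1: "rising s (Suc j) = rising s j * (s + of_nat j) / of_nat (Suc j)" by (rule rising_Suc)
      have r2: "rising (s - 1) (Suc j) = (s - 1) * rising s j / of_nat (Suc j)"
        using rising_shift[of "s - 1" j] by simp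
      define N where "N = (of_nat (Suc j) :: complex)"
      have N: "N \<noteq> 0" unfolding N_def by (rule of_nat_neq_0)
      have j: "of_nat j = N - 1" by (simp add: N_def)
      have "of_nat q * (rising s (Suc j) / (N - of_nat q)) = (s + of_nat q - 1) * (rising s j / (N - of_nat q)) - rising (s - 1) (Suc j)"
        using ne N unfolding r1 r2 N_def[symmetric] j by (simp add: divide_simps) (simp add: algebra_simps)
      moreover have "j \<noteq> q - 1" using False Suc assms by auto
      ultimately have "of_nat q * (rising s (Suc j) / (N - of_nat q)) * z ^ i = ((s + of_nat q - 1) * e j - rising (s - 1) (Suc j)) * z ^ i"
        by (simp add: e_def N_def)
      then show ?thesis using False by (simp add: Suc N_def algebra_simps)
    qed
  qed
  have "(\<lambda>i. of_nat q * ((if i = Suc q - 1 then 0 else rising s i / (of_nat i - of_nat (Suc q) + 1)) * z ^ i)) sums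
     ((s + of_nat q - 1) * (z * right_series q s z) - (1 - z) powr (1 - s) + rising (s - 1) q * z ^ q)"
    unfolding D by (intro sums_add sums_diff sums_mult A B C)
  moreover have "(\<lambda>i. of_nat q * ((if i = Suc q - 1 then 0 else rising s i / (of_nat i - of_nat (Suc q) + 1)) * z ^ i)) sums
     (of_nat q * right_series (Suc q) s z)"
    by (intro sums_mult right_series_sums assms) auto
  ultimately show ?thesis using sums_unique2 by blast
qed

text \<open>The boundary terms of the two integrations by parts cancel, except for the constant coefficient of
  \<open>z^(-q) (1-z)^(1-s)\<close>.\<close>
lemma beta_const_rec:
  assumes "norm s \<le> 1 / 2" "0 < y" "y < 1" "q \<ge> 1"
  shows "of_nat q * beta_const (Suc q) s (of_real y) = (s + of_nat q - 1) * beta_const q s (of_real y) + rising (s - 1) q"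
proof -
  define Y where "Y = complex_of_real y"
  define Z where "Z = 1 - Y"
  have Z: "Z = of_real (1 - y)" by (simp add: Z_def Y_def)
  have ZY: "1 - Z = Y" by (simp add: Z_def)
  have nY: "norm Y < 1" and nZ: "norm Z < 1" using assms by (auto simp: Y_def Z norm_of_real simp del: of_real_diff)
  have Z0: "Z \<noteq> 0" using assms by (auto simp: Z simp del: of_real_diff)
  obtain r where q: "q = Suc r" using assms by (cases q) auto
  have p1: "Y powr (1 - s) * Z powr (- of_nat q) = Z powr (1 - of_nat (Suc q)) * Y powr (1 - s)" by simp
  have p2: "Z powr (1 - of_nat (Suc q)) * Z = Z powr (1 - of_nat q)"
    using Z0 by (simp add: powr_diff divide_simps powr_minus powr_nat q)
  have p3: "Z powr (1 - of_nat (Suc q)) * Z ^ q = 1"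
    using Z0 by (simp add: powr_minus powr_nat)
  have r: "of_nat q * rising s q = (s + of_nat q - 1) * rising s (q - 1)"
    unfolding q rising_Suc by (simp add: mult.commute del: of_nat_Suc) simp
  have "of_nat q * beta_const (Suc q) s Y
     = Y powr (1 - s) * (of_nat q * left_series (Suc q) s Y)
       + Z powr (1 - of_nat (Suc q)) * (of_nat q * right_series (Suc q) s Z) + (of_nat q * rising s q) * ln Z"
    by (simp add: beta_const_def Z_def algebra_simps)
  also have "\<dots> = Y powr (1 - s) * ((s + of_nat q - 1) * left_series q s Y + Z powr (- of_nat q))
       + Z powr (1 - of_nat (Suc q)) * ((s + of_nat q - 1) * (Z * right_series q s Z)
      - Y powr (1 - s) + rising (s - 1) q * Z ^ q) + (s + of_nat q - 1) * rising s (q - 1) * ln Z"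
    unfolding left_series_rec[OF assms(1) nY assms(4)] right_series_rec[OF assms(1) nZ assms(4)] r ZY by (simp only: Z_def)
  also have "\<dots> = (s + of_nat q - 1) * (Y powr (1 - s) * left_series q s Y
       + (Z powr (1 - of_nat (Suc q)) * Z) * right_series q s Z + rising s (q - 1) * ln Z)
       + (Y powr (1 - s) * Z powr (- of_nat q) - Z powr (1 - of_nat (Suc q)) * Y powr (1 - s))
       + rising (s - 1) q * (Z powr (1 - of_nat (Suc q)) * Z ^ q)"
    by (simp add: algebra_simps del: of_nat_Suc)
  also have "\<dots> = (s + of_nat q - 1) * beta_const q s Y + rising (s - 1) q"
    unfolding p2 p3 p1 by (simp add: beta_const_def Z_def)
  finally show ?thesis by (simp add: Y_def)
qed

text \<open>This is \<open>-\<psi>(1-s) - \<gamma>\<close> with the digamma function \<open>\<psi>\<close>; see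
  \<open>higher_deriv_psi_series\<close>.\<close>
definition psi_series :: "complex \<Rightarrow> complex" where
  "psi_series s = (\<Sum>l. 1 / (of_nat l + 1 - s) - 1 / (of_nat l + 1))"

lemma norm_psi_term_le:
  assumes "norm s \<le> 1 / 2"
  shows "norm (1 / (of_nat l + 1 - s) - 1 / (of_nat l + 1) :: complex) \<le> 1 / real (Suc l) ^ 2"
proof -
  have ne: "of_nat l + 1 - s \<noteq> 0" using norm_shift_ge[OF assms, of l] by auto
  have ne1: "(of_nat l + 1 :: complex) \<noteq> 0" by (metis of_nat_Suc of_nat_neq_0 add.commute)
  have "real (Suc l) / 2 \<le> Re (of_nat l + 1 - s)" using abs_Re_le_cmod[of s] assms by simp
  then have 1: "real (Suc l) / 2 \<le> norm (of_nat l + 1 - s)" using complex_Re_le_cmod order_trans by blast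
  have 2: "norm (of_nat l + 1 :: complex) = real (Suc l)" by (metis norm_of_nat of_nat_Suc add.commute)
  have "1 / (of_nat l + 1 - s) - 1 / (of_nat l + 1) = s / ((of_nat l + 1 - s) * (of_nat l + 1))"
    using ne ne1 by (simp add: divide_simps)
  also have "norm \<dots> \<le> (1 / 2) / ((real (Suc l) / 2) * real (Suc l))"
    unfolding norm_divide norm_mult 2 using assms 1 by (intro frac_le mult_right_mono) auto
  finally show ?thesis by (simp add: power2_eq_square field_simps)
qed

lemma summable_inverse_square: "summable (\<lambda>l. 1 / real (Suc l) ^ 2)"
  using inverse_squares_sums by (simp add: sums_iff add.commute)

lemma has_field_derivative_left_term:
  assumes "norm s \<le> 1 / 2" "norm y < 1" "y \<notin> \<real>\<^sub>\<le>\<^sub>0"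
  shows "((\<lambda>y. y powr (1 - s) * left_series 1 s y) has_field_derivative y powr (- s) / (1 - y)) (at y)"
proof -
  define c where "c = (\<lambda>l. 1 / (of_nat l + 1 - s))"
  have L: "left_series 1 s = (\<lambda>y. \<Sum>l. c l * y ^ l)"
    by (rule ext) (simp add: left_series_def c_def rising_def flip: pochhammer_fact)
  have sm: "summable (\<lambda>l. c l * y ^ l)" if "norm y < 1" for y
    using sums_summable[OF left_series_sums[OF assms(1) that, of 1]]
    by (simp add: c_def rising_def flip: pochhammer_fact)
  have D: "((\<lambda>y. \<Sum>l. c l * y ^ l) has_field_derivative (\<Sum>l. diffs c l * y ^ l)) (at y)"
    by (rule termdiffs_strong'[of 1]) (use sm assms in auto)
  have "summable (\<lambda>l. diffs c l * y ^ l)"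
    by (rule termdiff_converges[of _ 1]) (use sm assms in auto)
  then have "(\<lambda>l. y * (diffs c l * y ^ l)) sums (y * (\<Sum>l. diffs c l * y ^ l))"
    by (intro sums_mult summable_sums)
  then have "(\<lambda>l. (\<lambda>l. of_nat l * c l * y ^ l) (Suc l)) sums (y * (\<Sum>l. diffs c l * y ^ l))"
    by (simp add: diffs_def mult_ac)
  then have 1: "(\<lambda>l. of_nat l * c l * y ^ l) sums (y * (\<Sum>l. diffs c l * y ^ l))"
    by (subst (asm) sums_Suc_iff) simp
  have 2: "(\<lambda>l. (1 - s) * (c l * y ^ l)) sums ((1 - s) * (\<Sum>l. c l * y ^ l))"
    by (intro sums_mult summable_sums sm assms)
  have "of_nat l * c l * y ^ l + (1 - s) * (c l * y ^ l) = y ^ l" for l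
  proof -
    have "of_nat l + 1 - s \<noteq> 0" using norm_shift_ge[OF assms(1), of l] by auto
    then have "(of_nat l + 1 - s) * c l = 1" by (simp add: c_def)
    moreover have "of_nat l * c l * y ^ l + (1 - s) * (c l * y ^ l) = ((of_nat l + 1 - s) * c l) * y ^ l"
      by (simp add: algebra_simps)
    ultimately show ?thesis by simp
  qed
  with sums_add[OF 1 2] have "(\<lambda>l. y ^ l) sums (y * (\<Sum>l. diffs c l * y ^ l) + (1 - s) * (\<Sum>l. c l * y ^ l))" by simp
  then have eq: "y * (\<Sum>l. diffs c l * y ^ l) + (1 - s) * (\<Sum>l. c l * y ^ l) = 1 / (1 - y)"
    using geometric_sums[OF assms(2)] sums_unique2 by blast
  have y0: "y \<noteq> 0" using assms by auto
  have "((\<lambda>y. y powr (1 - s) * (\<Sum>l. c l * y ^ l)) has_field_derivative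
     (1 - s) * y powr (1 - s - 1) * (\<Sum>l. c l * y ^ l) + (\<Sum>l. diffs c l * y ^ l) * y powr (1 - s)) (at y)"
    by (rule DERIV_mult[OF has_field_derivative_powr[OF assms(3)] D])
  also have "y powr (1 - s) = y powr (- s) * y"
    using y0 by (simp add: powr_diff powr_minus_divide)
  also have "(1 - s) * y powr (1 - s - 1) * (\<Sum>l. c l * y ^ l) + (\<Sum>l. diffs c l * y ^ l) * (y powr (- s) * y)
     = y powr (- s) * (y * (\<Sum>l. diffs c l * y ^ l) + (1 - s) * (\<Sum>l. c l * y ^ l))"
    by (simp add: algebra_simps)
  finally show ?thesis unfolding L eq by simp
qed

lemma has_field_derivative_right_term:
  assumes "norm s \<le> 1 / 2" "norm z < 1" "z \<noteq> 0"
  shows "(right_series 1 s has_field_derivative ((1 - z) powr (- s) - 1) / z) (at z)"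
proof -
  define c where "c = (\<lambda>i. (if i = 0 then 0 else rising s i / of_nat i))"
  have L: "right_series 1 s = (\<lambda>z. \<Sum>i. c i * z ^ i)"
    by (simp only: right_series_1 c_def)
  have sm: "summable (\<lambda>i. c i * z ^ i)" if "norm z < 1" for z
    using sums_summable[OF right_series_sums[OF assms(1) that, of 1]] by (simp add: c_def cong: if_cong)
  have D: "((\<lambda>z. \<Sum>i. c i * z ^ i) has_field_derivative (\<Sum>i. diffs c i * z ^ i)) (at z)"
    by (rule termdiffs_strong'[of 1]) (use sm assms in auto)
  have dc: "diffs c = (\<lambda>i. rising s (Suc i))" by (rule ext) (simp add: diffs_def c_def del: of_nat_Suc)
  have "(\<lambda>i. rising s i * z ^ i) sums ((1 - z) powr (- s))" by (rule rising_sums[OF assms(2)])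
  then have "(\<lambda>i. rising s (Suc i) * z ^ Suc i) sums ((1 - z) powr (- s) - 1)"
    by (subst sums_Suc_iff) simp
  from sums_divide[OF this, of z] have "(\<lambda>i. rising s (Suc i) * z ^ i) sums (((1 - z) powr (- s) - 1) / z)"
    using assms by simp
  with D show ?thesis unfolding L dc by (simp add: sums_iff)
qed

text \<open>The primitives at the two ends belong to the same function, seen from opposite directions.\<close>
lemma beta_const_1_deriv:
  assumes "norm s \<le> 1 / 2" "norm y < 1" "norm (1 - y) < 1"
  shows "(beta_const 1 s has_field_derivative 0) (at y)"
proof -
  have Re: "Re y > 0" using complex_Re_le_cmod[of "1 - y"] assms by simp
  have Re1: "Re (1 - y) > 0" using complex_Re_le_cmod[of y] assms by simp
  have y: "y \<notin> \<real>\<^sub>\<le>\<^sub>0" "1 - y \<notin> \<real>\<^sub>\<le>\<^sub>0" "1 - y \<noteq> 0"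
    using Re Re1 by (auto simp: complex_nonpos_Reals_iff)
  have eq: "beta_const 1 s = (\<lambda>y. y powr (1 - s) * left_series 1 s y + right_series 1 s (1 - y) * (1 - y) powr 0 + ln (1 - y))"
    by (rule ext) (simp add: beta_const_def)
  have R: "((\<lambda>y. right_series 1 s (1 - y)) has_field_derivative (((1 - (1 - y)) powr (- s) - 1) / (1 - y)) * (-1)) (at y)"
    by (rule DERIV_chain2[OF has_field_derivative_right_term]) (use assms y in \<open>auto intro!: derivative_eq_intros\<close>)
  have P: "((\<lambda>y. (1 - y) powr 0) has_field_derivative 0) (at y)"
  proof -
    have "((\<lambda>y. (1 - y) powr 0) has_field_derivative (0 * (1 - y) powr (0 - 1)) * (-1)) (at y)"
      by (rule DERIV_chain2[OF has_field_derivative_powr]) (use y in \<open>auto intro!: derivative_eq_intros\<close>)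
    then show ?thesis by simp
  qed
  have Ln: "((\<lambda>y. ln (1 - y)) has_field_derivative - (1 / (1 - y))) (at y)"
    using y by (auto intro!: derivative_eq_intros simp: divide_inverse)
  have "((\<lambda>y. y powr (1 - s) * left_series 1 s y + right_series 1 s (1 - y) * (1 - y) powr 0 + ln (1 - y)) has_field_derivative
     y powr (- s) / (1 - y) + ((((1 - (1 - y)) powr (- s) - 1) / (1 - y)) * (-1) * (1 - y) powr 0 + 0 * right_series 1 s (1 - y)) + - (1 / (1 - y))) (at y)"
    by (intro DERIV_add DERIV_mult has_field_derivative_left_term R P Ln assms y)
  moreover have "y powr (- s) / (1 - y) + ((((1 - (1 - y)) powr (- s) - 1) / (1 - y)) * (-1) * (1 - y) powr 0 + 0 * right_series 1 s (1 - y)) + - (1 / (1 - y)) = 0"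
    using y by (simp add: diff_divide_distrib)
  ultimately show ?thesis unfolding eq by simp
qed

text \<open>As \<open>y\<close> tends to \<open>1\<close>, the series \<open>left_series\<close> diverges like
  \<open>-ln (1-y)\<close>. Subtracting \<open>-ln (1-y) = \<Sum>l. y^(l+1) / (l+1)\<close> termwise leaves a series
  that converges uniformly up to \<open>y = 1\<close>, and \<open>(1 - y^(-s)) ln (1-y)\<close> tends to
  \<open>0\<close>.\<close>
lemma beta_const_1_limit:
  assumes "norm s \<le> 1 / 2"
  shows "(\<lambda>n. beta_const 1 s (of_real (1 - 1 / real n))) \<longlonglongrightarrow> psi_series s"
proof -
  define y where "y = (\<lambda>n. complex_of_real (1 - 1 / real n))"
  define u where "u = (\<lambda>l. 1 / (of_nat l + 1 - s) - 1 / (of_nat l + 1) :: complex)"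
  define G where "G = (\<lambda>y. \<Sum>l. u l * y ^ Suc l)"
  have y1: "y \<longlonglongrightarrow> 1"
  proof -
    have "(\<lambda>n. complex_of_real (1 - 1 / real n)) \<longlonglongrightarrow> of_real (1 - 0)"
      by (intro tendsto_intros lim_1_over_n)
    then show ?thesis by (simp add: y_def)
  qed
  have bnd: "norm (u l * y ^ Suc l) \<le> 1 / real (Suc l) ^ 2" if "norm y \<le> 1" for y l
  proof -
    have "norm (u l * y ^ Suc l) \<le> (1 / real (Suc l) ^ 2) * 1"
      unfolding norm_mult norm_power u_def using that
      by (intro mult_mono norm_psi_term_le assms power_le_one) auto
    then show ?thesis by simp
  qed
  (* The coefficients u l are of order 1 / l^2, so the series is continuous up to the boundary of the disc. *)
  have "uniform_limit (cball 0 1) (\<lambda>n y. \<Sum>l<n. u l * y ^ Suc l) G sequentially"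
    unfolding G_def by (rule Weierstrass_m_test[OF _ summable_inverse_square]) (use bnd in auto)
  then have contG: "continuous_on (cball 0 1) G"
    by (rule uniform_limit_theorem[rotated]) (auto intro!: always_eventually continuous_intros)
  have ym: "norm (y n) \<le> 1" if "n \<ge> 1" for n
    using that unfolding y_def norm_of_real by simp
  have G1: "(\<lambda>n. G (y n)) \<longlonglongrightarrow> psi_series s"
  proof -
    have "(\<lambda>n. G (y n)) \<longlonglongrightarrow> G 1"
      by (rule continuous_on_tendsto_compose[OF contG y1])
         (use ym in \<open>auto intro!: eventually_sequentiallyI[of 1]\<close>)
    then show ?thesis by (simp add: G_def psi_series_def u_def)
  qed
  have P1: "(\<lambda>n. y n powr (- s)) \<longlonglongrightarrow> 1"
    using tendsto_powr_complex[OF _ y1 tendsto_const[of "- s"]] by simp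
  have R: "(\<lambda>n. right_series 1 s (1 - y n)) \<longlonglongrightarrow> 0"
  proof -
    have "isCont (right_series 1 s) 0"
    proof -
      have "isCont (\<lambda>z. \<Sum>i. (if i = 0 then 0 else rising s i / of_nat i) * z ^ i) 0"
        by (rule DERIV_isCont[OF termdiffs_strong'[of 1]])
           (use sums_summable[OF right_series_sums[OF assms, of _ 1]] in \<open>auto cong: if_cong\<close>)
      then show ?thesis by (simp only: right_series_1)
    qed
    moreover have "(\<lambda>n. 1 - y n) \<longlonglongrightarrow> 0" using tendsto_diff[OF tendsto_const[of 1] y1] by simp
    ultimately have "(\<lambda>n. right_series 1 s (1 - y n)) \<longlonglongrightarrow> right_series 1 s 0"
      by (rule isCont_tendsto_compose)
    moreover have "right_series 1 s 0 = 0"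
      using powser_zero[of "\<lambda>i. (if i = 0 then 0 else rising s i / of_nat i)"] by (simp add: right_series_1[unfolded One_nat_def])
    ultimately show ?thesis by simp
  qed
  have Q: "(\<lambda>n. (1 - y n powr (- s)) * ln (1 - y n)) \<longlonglongrightarrow> 0"
  proof -
    have "((\<lambda>y. y powr (- s)) has_field_derivative (- s) * 1 powr (- s - 1)) (at (1::complex))"
      by (intro has_field_derivative_powr) auto
    then have "((\<lambda>y. (y powr (- s) - 1 powr (- s)) / (y - 1)) \<longlongrightarrow> - s) (at (1::complex))"
      by (simp add: has_field_derivative_iff)
    moreover have "filterlim y (at 1) sequentially"
      using y1 by (auto simp: filterlim_at y_def intro!: eventually_sequentiallyI[of 1])
    ultimately have a: "(\<lambda>n. (y n powr (- s) - 1 powr (- s)) / (y n - 1)) \<longlonglongrightarrow> - s"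
      by (rule filterlim_compose)
    have b: "(\<lambda>n. complex_of_real (- (ln (real n) / real n))) \<longlonglongrightarrow> of_real (- 0)"
      by (intro tendsto_of_real tendsto_minus lim_ln_over_n)
    have "(\<lambda>n. ((y n powr (- s) - 1 powr (- s)) / (y n - 1)) * complex_of_real (- (ln (real n) / real n))) \<longlonglongrightarrow> - s * of_real (- 0)"
      by (rule tendsto_mult[OF a b])
    then have "(\<lambda>n. ((y n powr (- s) - 1 powr (- s)) / (y n - 1)) * complex_of_real (- (ln (real n) / real n))) \<longlonglongrightarrow> 0" by simp
    moreover have "\<forall>\<^sub>F n in sequentially. ((y n powr (- s) - 1 powr (- s)) / (y n - 1)) * complex_of_real (- (ln (real n) / real n))
        = (1 - y n powr (- s)) * ln (1 - y n)"
    proof (rule eventually_sequentiallyI[of 1])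
      fix n :: nat assume n: "n \<ge> 1"
      have y: "1 - y n = of_real (1 / real n)" by (simp add: y_def)
      have l: "ln (1 - y n) = of_real (- ln (real n))"
        using n unfolding y by (subst Ln_of_real) (auto simp: ln_div)
      have y': "y n - 1 = - of_real (1 / real n)" by (simp add: y_def)
      show "((y n powr (- s) - 1 powr (- s)) / (y n - 1)) * complex_of_real (- (ln (real n) / real n))
        = (1 - y n powr (- s)) * ln (1 - y n)"
        unfolding l y' using n by (simp add: field_simps)
    qed
    ultimately show ?thesis by (rule Lim_transform_eventually)
  qed
  have "(\<lambda>n. y n powr (- s) * G (y n) + (1 - y n powr (- s)) * ln (1 - y n) + right_series 1 s (1 - y n)) \<longlonglongrightarrow> 1 * psi_series s + 0 + 0"
    by (intro tendsto_add tendsto_mult P1 G1 Q R)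
  then have "(\<lambda>n. y n powr (- s) * G (y n) + (1 - y n powr (- s)) * ln (1 - y n) + right_series 1 s (1 - y n)) \<longlonglongrightarrow> psi_series s" by simp
  moreover have "\<forall>\<^sub>F n in sequentially. y n powr (- s) * G (y n) + (1 - y n powr (- s)) * ln (1 - y n) + right_series 1 s (1 - y n)
      = beta_const 1 s (of_real (1 - 1 / real n))"
  proof (rule eventually_sequentiallyI[of 2])
    fix n :: nat assume n: "n \<ge> 2"
    define t where "t = y n"
    have "1 - 1 / real n > 0" "1 - 1 / real n < 1" using n by (auto simp: field_simps)
    then have t: "norm t < 1" "t \<noteq> 0" "t \<noteq> 1" unfolding t_def y_def norm_of_real by (auto simp del: of_real_diff)
    have A: "(\<lambda>l. t * (1 / (of_nat l + 1 - s) * t ^ l)) sums (t * left_series 1 s t)"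
      using sums_mult[OF left_series_sums[OF assms t(1), of 1], of t]
      by (simp add: rising_def flip: pochhammer_fact)
    have B: "(\<lambda>l. t ^ Suc l / of_nat (Suc l)) sums (- ln (1 - t))"
    proof -
      have "(\<lambda>n. (-1) ^ Suc n / of_nat n * (- t) ^ n) sums ln (1 + - t)"
        by (rule Ln_series) (use t in auto)
      then have "(\<lambda>n. - ((-1) ^ Suc n / of_nat n * (- t) ^ n)) sums (- ln (1 + - t))" by (rule sums_minus)
      also have "(\<lambda>n. - ((-1) ^ Suc n / of_nat n * (- t) ^ n)) = (\<lambda>n. t ^ n / of_nat n)"
      proof
        fix n show "- ((-1) ^ Suc n / of_nat n * (- t) ^ n) = t ^ n / of_nat n"
          unfolding power_minus[of t n] by simp
      qed
      finally show ?thesis by (subst sums_Suc_iff) simp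
    qed
    have "(\<lambda>l. u l * t ^ Suc l) sums (t * left_series 1 s t - - ln (1 - t))"
      using sums_diff[OF A B] by (simp add: u_def algebra_simps)
    then have G: "G t = t * left_series 1 s t + ln (1 - t)" by (simp add: G_def sums_iff)
    have "t powr (1 - s) = t powr (- s) * t" using t by (simp add: powr_diff powr_minus_divide)
    then have "beta_const 1 s t = t powr (- s) * (t * left_series 1 s t) + right_series 1 s (1 - t) + ln (1 - t)"
      using t by (simp add: beta_const_def)
    also have "\<dots> = t powr (- s) * G t + (1 - t powr (- s)) * ln (1 - t) + right_series 1 s (1 - t)"
      unfolding G by (simp add: algebra_simps)
    finally show "y n powr (- s) * G (y n) + (1 - y n powr (- s)) * ln (1 - y n) + right_series 1 s (1 - y n)
      = beta_const 1 s (of_real (1 - 1 / real n))" by (simp add: t_def y_def)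
  qed
  ultimately show ?thesis by (rule Lim_transform_eventually)
qed

lemma beta_const_1:
  assumes "norm s \<le> 1 / 2" "0 < y" "y < 1"
  shows "beta_const 1 s (of_real y) = psi_series s"
proof -
  define D where "D = ball 0 1 \<inter> ball (1::complex) 1"
  have "\<exists>c. \<forall>y\<in>D. beta_const 1 s y = c"
  proof (rule has_field_derivative_zero_constant)
    show "convex D" unfolding D_def by (intro convex_Int convex_ball)
    fix y assume "y \<in> D"
    then have "norm y < 1" "norm (1 - y) < 1" by (auto simp: D_def dist_norm)
    then show "(beta_const 1 s has_field_derivative 0) (at y within D)"
      using beta_const_1_deriv[OF assms(1)] has_field_derivative_at_within by blast
  qed
  then obtain c where c: "\<And>y. y \<in> D \<Longrightarrow> beta_const 1 s y = c" by blast
  have mem: "complex_of_real x \<in> D" if "0 < x" "x < 1" for x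
  proof -
    have "norm (1 - complex_of_real x) = \<bar>1 - x\<bar>" by (metis norm_of_real of_real_1 of_real_diff)
    then show ?thesis using that by (simp add: D_def dist_norm)
  qed
  have "\<forall>\<^sub>F n in sequentially. c = beta_const 1 s (of_real (1 - 1 / real n))"
  proof (rule eventually_sequentiallyI[of 2])
    fix n :: nat assume "n \<ge> 2"
    then have "complex_of_real (1 - 1 / real n) \<in> D" by (intro mem) (auto simp: field_simps)
    then show "c = beta_const 1 s (of_real (1 - 1 / real n))" using c by simp
  qed
  with tendsto_const[of c] have "(\<lambda>n. beta_const 1 s (of_real (1 - 1 / real n))) \<longlonglongrightarrow> c"
    by (rule Lim_transform_eventually)
  then have "psi_series s = c" using beta_const_1_limit[OF assms(1)] LIMSEQ_unique by blast
  then show ?thesis using c mem assms by simp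
qed

section \<open>Expansion of the convolution of two powers\<close>

text \<open>The value of \<open>(n+1) beta_const (n+2) s y\<close>; see \<open>beta_const_closed\<close>.\<close>
definition beta_closed :: "nat \<Rightarrow> complex \<Rightarrow> complex" where
  "beta_closed n s = rising (s + 1) n * (s * harm (Suc n) + s * psi_series s - 1) - s * deriv (\<lambda>s. rising (s + 1) n) s"

lemma has_field_derivative_rising_shift:
  "((\<lambda>s::complex. rising (s + 1) n) has_field_derivative deriv (\<lambda>s. rising (s + 1) n) s) (at s)"
proof -
  have "(\<lambda>s::complex. rising (s + 1) n) holomorphic_on UNIV"
    unfolding rising_def pochhammer_prod by (intro holomorphic_intros) auto
  then show ?thesis using holomorphic_derivI[of _ UNIV s] by auto
qed

lemma rising_shift_Suc:
  "rising (s + 1) (Suc n) = rising (s + 1) n * (1 + s / of_nat (Suc n) :: complex)"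
proof -
  define N where "N = (of_nat (Suc n) :: complex)"
  have "N \<noteq> 0" unfolding N_def by (rule of_nat_neq_0)
  moreover have "rising (s + 1) (Suc n) = rising (s + 1) n * (N + s) / N"
    unfolding rising_Suc N_def by (simp add: add_ac)
  ultimately show ?thesis unfolding N_def[symmetric] by (simp add: field_simps)
qed

lemma deriv_rising_shift_Suc:
  "deriv (\<lambda>s::complex. rising (s + 1) (Suc n)) s
     = deriv (\<lambda>s. rising (s + 1) n) s * (1 + s / of_nat (Suc n)) + rising (s + 1) n / of_nat (Suc n)"
proof (rule DERIV_imp_deriv)
  have "(\<lambda>s::complex. rising (s + 1) (Suc n)) = (\<lambda>s. rising (s + 1) n * (1 + s / of_nat (Suc n)))"
    by (rule ext) (rule rising_shift_Suc)
  moreover have "((\<lambda>s. rising (s + 1) n * (1 + s / of_nat (Suc n))) has_field_derivative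
      deriv (\<lambda>s. rising (s + 1) n) s * (1 + s / of_nat (Suc n)) + (1 / of_nat (Suc n)) * rising (s + 1) n) (at s)"
    by (intro DERIV_mult has_field_derivative_rising_shift)
       (auto intro!: derivative_eq_intros simp del: of_nat_Suc)
  ultimately show "((\<lambda>s::complex. rising (s + 1) (Suc n)) has_field_derivative
     deriv (\<lambda>s. rising (s + 1) n) s * (1 + s / of_nat (Suc n)) + rising (s + 1) n / of_nat (Suc n)) (at s)"
    by simp
qed

text \<open>Induction with \<open>beta_const_rec\<close>; the start \<open>n = 0\<close> is
  \<open>beta_const_1\<close>.\<close>
lemma beta_const_closed:
  assumes "norm s \<le> 1 / 2" "0 < y" "y < 1"
  shows "of_nat (Suc n) * beta_const (n + 2) s (of_real y) = beta_closed n s"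
proof (induction n)
  case 0
  have "beta_const 2 s (of_real y) = s * psi_series s + s - 1"
    using beta_const_rec[OF assms, of 1] beta_const_1[OF assms]
    by (simp add: rising_def numeral_2_eq_2)
  then show ?case by (simp add: beta_closed_def harm_def numeral_2_eq_2)
next
  case (Suc n)
  define N where "N = (of_nat (Suc n) :: complex)"
  have N: "N \<noteq> 0" "N + 1 \<noteq> 0"
    unfolding N_def by (rule of_nat_neq_0) (metis of_nat_Suc of_nat_neq_0 add.commute)
  define P where "P = rising (s + 1) n"
  define P' where "P' = deriv (\<lambda>s. rising (s + 1) n) s"
  have 1: "(N + 1) * beta_const (Suc n + 2) s (of_real y)
      = (s + N) * beta_const (n + 2) s (of_real y) + rising (s - 1) (n + 2)"
    using beta_const_rec[OF assms, of "n + 2"] by (simp add: N_def add_ac)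
  have "rising (s - 1) (Suc (Suc n)) = (s - 1) * (s * P / N) / (N + 1)"
    using rising_shift[of "s - 1" "Suc n"] rising_shift[of s n] by (simp add: P_def N_def add_ac)
  with 1 have 2: "(N + 1) * beta_const (Suc n + 2) s (of_real y)
      = (s + N) * beta_const (n + 2) s (of_real y) + (s - 1) * (s * P / N) / (N + 1)" by (simp add: numeral_2_eq_2)
  have IH: "beta_const (n + 2) s (of_real y) = (P * (s * harm (Suc n) + s * psi_series s - 1) - s * P') / N"
    using Suc N by (simp add: beta_closed_def N_def P_def P'_def divide_simps mult_ac)
  have h: "harm (Suc (Suc n)) = harm (Suc n) + 1 / (N + 1)"
    by (simp add: harm_Suc[of "Suc n"] N_def inverse_eq_divide add_ac)
  have P1: "rising (s + 1) (Suc n) = P * (1 + s / N)"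
    using N unfolding rising_Suc P_def N_def by (simp add: field_simps)
  have P'1: "deriv (\<lambda>s. rising (s + 1) (Suc n)) s = P' * (1 + s / N) + P / N"
    unfolding deriv_rising_shift_Suc P_def P'_def N_def by simp
  have "(N + 1) * beta_const (Suc n + 2) s (of_real y) = beta_closed (Suc n) s"
    unfolding 2 IH beta_closed_def P1 P'1 h using N by (simp add: divide_simps) (simp add: algebra_simps)
  then show ?case by (simp add: N_def add_ac)
qed

definition conv_sum :: "nat \<Rightarrow> complex \<Rightarrow> nat \<Rightarrow> complex" where
  "conv_sum q s n = (\<Sum>k=1..<n. of_nat k powr (- s) / of_nat (n - k) ^ q)"

text \<open>The constants of the left half, the constants of the right half, and the two primitives at the
  cut.\<close>
definition conv_expansion :: "nat \<Rightarrow> nat \<Rightarrow> complex \<Rightarrow> nat \<Rightarrow> complex" where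
  "conv_expansion q L s n =
     1 / of_nat n ^ q * half_zeta L (of_nat q) s n
     + of_nat n powr (- s) * (half_zeta L s (of_nat q) n
        + (beta_closed (q - 2) s + of_nat (q - 1) * rising s (q - 1) * of_real (ln (real n))) / (of_nat (q - 1) * of_nat n ^ (q - 1)))"

lemma powr_complement:
  assumes "k < n"
  shows "of_nat n powr c * (1 - of_nat k / of_nat n) powr c = (of_nat (n - k) powr c :: complex)"
proof -
  have eq: "1 - of_nat k / of_nat n = complex_of_real (real (n - k) / real n)"
    using complement_ratio[of k "n - k"] assms by simp
  have "(of_nat n * of_real (real (n - k) / real n)) powr c = of_nat n powr c * complex_of_real (real (n - k) / real n) powr c"
    using powr_times_real[of "of_nat n" "of_real (real (n - k) / real n)" c] by simp
  moreover have "of_nat n * complex_of_real (real (n - k) / real n) = of_nat (n - k)"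
    using assms by simp
  ultimately show ?thesis unfolding eq by simp
qed

lemma powr_minus_nat: "m > 0 \<Longrightarrow> of_nat m powr (- of_nat q) = (1 / of_nat m ^ q :: complex)"
  by (simp add: powr_minus_divide powr_nat)

lemma conv_sum_split:
  assumes "1 \<le> N" "1 \<le> M"
  shows "conv_sum q s (N + M) = of_nat (N + M) powr (- of_nat q) * half_sum (of_nat q) s (N + M) N
     + of_nat (N + M) powr (- s) * half_sum s (of_nat q) (N + M) M
     + of_nat N powr (- s) * of_nat M powr (- of_nat q)"
proof -
  let ?n = "N + M"
  let ?f = "\<lambda>k. of_nat k powr (- s) / of_nat (?n - k) ^ q"
  have "{1..<?n} = {1..<N} \<union> {N..<?n}" using assms by auto
  then have "conv_sum q s ?n = (\<Sum>k\<in>{1..<N} \<union> {N..<?n}. ?f k)" by (simp only: conv_sum_def)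
  also have "\<dots> = (\<Sum>k=1..<N. ?f k) + (\<Sum>k=N..<?n. ?f k)" by (rule sum.union_disjoint) auto
  also have "(\<Sum>k=1..<N. ?f k) = of_nat ?n powr (- of_nat q) * half_sum (of_nat q) s ?n N"
    unfolding half_sum_def sum_distrib_left
  proof (rule sum.cong[OF refl])
    fix k assume "k \<in> {1..<N}"
    then show "?f k = of_nat ?n powr (- of_nat q) * (of_nat k powr (- s) * (1 - of_nat k / of_nat ?n) powr (- of_nat q))"
      using powr_complement[of k ?n "- of_nat q"] powr_minus_nat[of "?n - k" q] by (simp add: mult_ac)
  qed
  also have "(\<Sum>k=N..<?n. ?f k) = (\<Sum>j=1..<Suc M. of_nat (?n - j) powr (- s) / of_nat j ^ q)"
    by (rule sum.reindex_bij_witness[of _ "\<lambda>j. ?n - j" "\<lambda>k. ?n - k"]) auto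
  also have "\<dots> = (\<Sum>j=1..<M. of_nat (?n - j) powr (- s) / of_nat j ^ q) + of_nat N powr (- s) / of_nat M ^ q"
    using assms by (simp add: sum.atLeastLessThan_Suc)
  also have "of_nat N powr (- s) / of_nat M ^ q = of_nat N powr (- s) * of_nat M powr (- of_nat q)"
    using assms powr_minus_nat[of M q] by simp
  also have "(\<Sum>j=1..<M. of_nat (?n - j) powr (- s) / of_nat j ^ q) = of_nat ?n powr (- s) * half_sum s (of_nat q) ?n M"
    unfolding half_sum_def sum_distrib_left
  proof (rule sum.cong[OF refl])
    fix k assume "k \<in> {1..<M}"
    then show "of_nat (?n - k) powr (- s) / of_nat k ^ q = of_nat ?n powr (- s) * (of_nat k powr (- of_nat q) * (1 - of_nat k / of_nat ?n) powr (- s))"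
      using powr_complement[of k ?n "- s"] powr_minus_nat[of k q] by (simp add: mult_ac)
  qed
  finally show ?thesis by simp
qed

text \<open>By \<open>half_boundary_Suc\<close> and \<open>mixed_deriv_swap\<close> the terms of order
  \<open>i\<close> of the two halves agree up to the sign \<open>(-1)^(i-1)\<close>. For even \<open>i\<close> they
  cancel, and for odd \<open>i > 1\<close> the Bernoulli number vanishes. For \<open>i = 1\<close> the two terms, each
  with the weight \<open>B_1 = -1/2\<close>, cancel the summand at the cut, which belongs to neither half.\<close>
lemma boundary_cancel:
  assumes "1 \<le> N" "1 \<le> M" "K \<ge> 2"
  shows "of_nat (N + M) powr (- c) * (\<Sum>i=1..<K. of_real (bern i) * half_boundary i c w (N + M) N)
       + of_nat (N + M) powr (- w) * (\<Sum>i=1..<K. of_real (bern i) * half_boundary i w c (N + M) M)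
       + of_nat N powr (- w) * of_nat M powr (- c) = 0"
proof -
  have "of_nat (N + M) powr (- c) * (\<Sum>i=1..<K. of_real (bern i) * half_boundary i c w (N + M) N)
       + of_nat (N + M) powr (- w) * (\<Sum>i=1..<K. of_real (bern i) * half_boundary i w c (N + M) M)
    = (\<Sum>i=1..<K. of_real (bern i) * (of_nat (N + M) powr (- c) * half_boundary i c w (N + M) N
         + of_nat (N + M) powr (- w) * half_boundary i w c (N + M) M))"
    by (simp add: sum_distrib_left distrib_left sum.distrib mult_ac)
  also have "\<dots> = (\<Sum>i=1..<K. if i = 1 then - mixed_deriv 0 c w N M else 0)"
  proof (rule sum.cong[OF refl])
    fix i assume "i \<in> {1..<K}"
    then obtain j where i: "i = Suc j" by (cases i) auto
    have 1: "of_nat (N + M) powr (- c) * half_boundary i c w (N + M) N = mixed_deriv j c w N M"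
      unfolding i by (rule half_boundary_Suc) (use assms in auto)
    have 2: "of_nat (N + M) powr (- w) * half_boundary i w c (N + M) M = (-1) ^ j * mixed_deriv j c w N M"
      unfolding i mixed_deriv_swap[of j w c M N, symmetric] add.commute[of N M]
      by (rule half_boundary_Suc) (use assms in auto)
    show "of_real (bern i) * (of_nat (N + M) powr (- c) * half_boundary i c w (N + M) N
         + of_nat (N + M) powr (- w) * half_boundary i w c (N + M) M) = (if i = 1 then - mixed_deriv 0 c w N M else 0)"
    proof (cases "j = 0")
      case True
      then show ?thesis unfolding 1 2 by (simp add: i bern_1[unfolded One_nat_def])
    next
      case False
      have "of_real (bern i) * (1 + (-1) ^ j) = (0 :: complex)"
      proof (cases "even j")
        case True
        then have "bern i = 0" using bern_sign[of i] False by (simp add: i)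
        then show ?thesis by simp
      qed simp
      then have "of_real (bern i) * (1 + (-1) ^ j) * mixed_deriv j c w N M = 0" by simp
      then show ?thesis unfolding 1 2 using False by (simp add: i algebra_simps)
    qed
  qed
  also have "\<dots> = - mixed_deriv 0 c w N M" using assms by (subst sum.delta) auto
  also have "mixed_deriv 0 c w N M = of_nat N powr (- w) * of_nat M powr (- c)"
    by (simp add: mixed_deriv_def)
  finally show ?thesis by simp
qed

text \<open>With \<open>N\<close> and \<open>M\<close> about \<open>n/2\<close>, the expansions of the two halves
  combine into \<open>conv_expansion\<close> because of \<open>boundary_cancel\<close> and
  \<open>boundary_0_total\<close>. The exponent is \<open>1/2\<close> larger than at \<open>s = 0\<close>, which
  allows for \<open>\<bar>n^(-s)\<bar> \<le> n^(1/2)\<close>.\<close>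
lemma conv_sum_approx:
  assumes "q \<ge> 2" "K \<ge> q + 3" "L \<ge> q + K"
  shows "\<exists>C\<ge>0. \<forall>s n. norm s \<le> 1 / 2 \<longrightarrow> n \<ge> 3 \<longrightarrow>
     norm (conv_sum q s n - conv_expansion q L s n) \<le> C * real n powr (5 / 2 - real q - real K)"
proof -
  have K: "K \<ge> 2" using assms by simp
  obtain C1 where C1: "C1 \<ge> 0" "\<And>c w n N. norm c \<le> real q \<Longrightarrow> norm w \<le> real q \<Longrightarrow> 1 \<le> N \<Longrightarrow> 3 * N \<le> 2 * n \<Longrightarrow>
     norm (half_sum c w n N - half_zeta L c w n - half_correction K c w n N)
       \<le> C1 * real N powr (2 - Re w - real K)"
    using half_sum_approx[OF K, of "real q" L q] assms by auto
  (* D absorbs the passage from N and M, which are at least n/3, to n. *)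
  define D where "D = (3 :: real) powr (real q + real K)"
  have main: "norm (conv_sum q s n - conv_expansion q L s n) \<le> (2 * C1 * D) * real n powr (5 / 2 - real q - real K)"
    if s: "norm s \<le> 1 / 2" and n3: "n \<ge> 3" for s n
  proof -
    define N where "N = n div 2"
    define M where "M = n - N"
    have n: "n = N + M" by (simp add: M_def N_def)
    have NM: "1 \<le> N" "1 \<le> M" "3 * N \<le> 2 * n" "3 * M \<le> 2 * n" "n \<le> 3 * N" "n \<le> 3 * M"
      using n3 by (auto simp: N_def M_def)
    have n0: "n > 0" using n3 by simp
    have Res: "\<bar>Re s\<bar> \<le> 1 / 2" using abs_Re_le_cmod[of s] s by linarith
    define E1 where "E1 = half_sum (of_nat q) s n N - half_zeta L (of_nat q) s n - half_correction K (of_nat q) s n N"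
    define E2 where "E2 = half_sum s (of_nat q) n M - half_zeta L s (of_nat q) n - half_correction K s (of_nat q) n M"
    have pow: "real J powr e \<le> D * real n powr e" if "n \<le> 3 * J" "1 \<le> J" "e \<le> 0" "- e \<le> real q + real K" for J e
    proof -
      have "real J powr e \<le> (real n / 3) powr e" using that n0 by (intro powr_mono2') auto
      also have "\<dots> = 3 powr (- e) * real n powr e" using n0 by (simp add: powr_divide powr_minus divide_simps)
      also have "\<dots> \<le> D * real n powr e" unfolding D_def using that by (intro mult_right_mono powr_mono) auto
      finally show ?thesis .
    qed
    have "norm s \<le> real q" using s assms by simp
    then have "norm E1 \<le> C1 * real N powr (2 - Re s - real K)" and "norm E2 \<le> C1 * real M powr (2 - Re (of_nat q) - real K)"
      unfolding E1_def E2_def using NM by (intro C1(2); simp)+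
    moreover have "real N powr (2 - Re s - real K) \<le> D * real n powr (2 - Re s - real K)"
      using NM Res assms by (intro pow) auto
    moreover have "real M powr (2 - Re (of_nat q) - real K) \<le> D * real n powr (2 - real q - real K)"
      using NM Res assms pow[of M "2 - real q - real K"] by auto
    ultimately have E1: "norm E1 \<le> C1 * (D * real n powr (2 - Re s - real K))"
      and E2: "norm E2 \<le> C1 * (D * real n powr (2 - real q - real K))"
      using C1(1) by (meson order_trans mult_left_mono)+
    let ?mid = "(beta_closed (q - 2) s + of_nat (q - 1) * rising s (q - 1) * of_real (ln (real n))) / (of_nat (q - 1) * of_nat n ^ (q - 1))"
    have mid: "of_nat n powr (- of_nat q) * half_boundary 0 (of_nat q) s n N + of_nat n powr (- s) * half_boundary 0 s (of_nat q) n M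
       = of_nat n powr (- s) * ?mid"
    proof -
      have y: "0 < real N / real n" "real N / real n < 1" using NM n by auto
      have "of_nat (Suc (q - 2)) * beta_const (q - 2 + 2) s (of_real (real N / real n)) = beta_closed (q - 2) s"
        by (rule beta_const_closed[OF s y])
      moreover have "Suc (q - 2) = q - 1" "q - 2 + 2 = q" using assms by auto
      ultimately have b: "beta_closed (q - 2) s = of_nat (q - 1) * beta_const q s (of_real (real N / real n))" by simp
      have q1: "(of_nat (q - 1) :: complex) \<noteq> 0" using assms by (simp only: of_nat_eq_0_iff)
      have "of_nat n powr (1 - s - of_nat q) = of_nat n powr (- s - of_nat (q - 1))"
        using assms by (simp add: of_nat_diff algebra_simps)
      also have "\<dots> = of_nat n powr (- s) / of_nat n ^ (q - 1)"
        using n0 by (subst powr_diff) (simp add: powr_nat)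
      finally have X: "of_nat n powr (1 - s - of_nat q) = of_nat n powr (- s) / of_nat n ^ (q - 1)" .
      have "of_nat n powr (- of_nat q) * half_boundary 0 (of_nat q) s n N + of_nat n powr (- s) * half_boundary 0 s (of_nat q) n M
        = of_nat n powr (1 - s - of_nat q) * (beta_const q s (of_real (real N / real n)) + rising s (q - 1) * of_real (ln (real n)))"
        using boundary_0_total[OF NM(1,2) s, of q] assms by (simp add: n)
      also have "\<dots> = of_nat n powr (- s) * ?mid"
        unfolding X b using q1 n0 by (simp add: field_simps)
      finally show ?thesis .
    qed
    have sumsplit: "(\<Sum>i<K. f i) = f 0 + (\<Sum>i=1..<K. f i)" for f :: "nat \<Rightarrow> complex"
      using K by (simp add: lessThan_atLeast0 sum.atLeast_Suc_lessThan)
    have canc: "of_nat n powr (- of_nat q) * (\<Sum>i=1..<K. of_real (bern i) * half_boundary i (of_nat q) s n N)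
       + of_nat n powr (- s) * (\<Sum>i=1..<K. of_real (bern i) * half_boundary i s (of_nat q) n M)
       + of_nat N powr (- s) * of_nat M powr (- of_nat q) = 0"
      unfolding n by (rule boundary_cancel) (use NM K in auto)
    have pq: "of_nat n powr (- of_nat q) = (1 / of_nat n ^ q :: complex)" by (rule powr_minus_nat[OF n0])
    define S1 where "S1 = half_zeta L (of_nat q) s n"
    define S2 where "S2 = half_zeta L s (of_nat q) n"
    define T1 where "T1 = (\<Sum>i=1..<K. of_real (bern i) * half_boundary i (of_nat q) s n N)"
    define T2 where "T2 = (\<Sum>i=1..<K. of_real (bern i) * half_boundary i s (of_nat q) n M)"
    define A where "A = (of_nat n powr (- of_nat q) :: complex)"
    define B where "B = (of_nat n powr (- s) :: complex)"
    define X where "X = of_nat N powr (- s) * of_nat M powr (- of_nat q)"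
    have h1: "half_sum (of_nat q) s n N = E1 + S1 + (half_boundary 0 (of_nat q) s n N + T1)"
      unfolding E1_def S1_def T1_def half_correction_def sumsplit by (simp add: bern_0)
    have h2: "half_sum s (of_nat q) n M = E2 + S2 + (half_boundary 0 s (of_nat q) n M + T2)"
      unfolding E2_def S2_def T2_def half_correction_def sumsplit by (simp add: bern_0)
    have "conv_sum q s n = A * half_sum (of_nat q) s n N + B * half_sum s (of_nat q) n M + X"
      unfolding A_def B_def X_def n by (rule conv_sum_split) (use NM in auto)
    also have "\<dots> = (A * S1 + B * S2 + (A * half_boundary 0 (of_nat q) s n N + B * half_boundary 0 s (of_nat q) n M))
        + (A * E1 + B * E2) + (A * T1 + B * T2 + X)"
      unfolding h1 h2 by (simp add: algebra_simps)
    also have "A * T1 + B * T2 + X = 0" using canc by (simp add: A_def B_def T1_def T2_def X_def)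
    also have "A * half_boundary 0 (of_nat q) s n N + B * half_boundary 0 s (of_nat q) n M
       = B * ?mid"
      unfolding A_def B_def by (rule mid)
    finally have eq: "conv_sum q s n - conv_expansion q L s n = A * E1 + B * E2"
      unfolding conv_expansion_def A_def B_def S1_def S2_def pq by (simp add: distrib_left)
    have "norm (A * E1) = real n powr (- real q) * norm E1"
      using n0 by (simp add: A_def norm_mult norm_powr_real_powr)
    also have "\<dots> \<le> real n powr (- real q) * (C1 * (D * real n powr (2 - Re s - real K)))"
      by (intro mult_left_mono E1) auto
    also have "\<dots> = C1 * D * real n powr (2 - real q - Re s - real K)"
      by (simp add: powr_diff powr_add powr_minus divide_simps)
    also have "\<dots> \<le> C1 * D * real n powr (5 / 2 - real q - real K)"
      using C1 Res n0 by (intro mult_left_mono powr_mono) (auto simp: D_def)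
    finally have A1: "norm (A * E1) \<le> C1 * D * real n powr (5 / 2 - real q - real K)" .
    have "norm (B * E2) = real n powr (- Re s) * norm E2"
      using n0 by (simp add: B_def norm_mult norm_powr_real_powr)
    also have "\<dots> \<le> real n powr (- Re s) * (C1 * (D * real n powr (2 - real q - real K)))"
      by (intro mult_left_mono E2) auto
    also have "\<dots> = C1 * D * real n powr (2 - real q - Re s - real K)"
      by (simp add: powr_diff powr_add powr_minus divide_simps)
    also have "\<dots> \<le> C1 * D * real n powr (5 / 2 - real q - real K)"
      using C1 Res n0 by (intro mult_left_mono powr_mono) (auto simp: D_def)
    finally have B1: "norm (B * E2) \<le> C1 * D * real n powr (5 / 2 - real q - real K)" .
    show ?thesis unfolding eq using norm_triangle_ineq[of "A * E1" "B * E2"] A1 B1 by (simp add: algebra_simps)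
  qed
  show ?thesis by (intro exI[of _ "2 * C1 * D"]) (use main C1 in \<open>auto simp: D_def\<close>)
qed

section \<open>Power series in the exponent\<close>

definition shifted_rising_fps :: "nat \<Rightarrow> complex fps" where
  "shifted_rising_fps n = Abs_fps (\<lambda>r. of_real (S_sum (int r) 1 (int n)))"

lemma shifted_rising_fps_Suc: "shifted_rising_fps (Suc n) = shifted_rising_fps n * (1 + fps_X * fps_const (1 / of_nat (Suc n)))"
proof (rule fps_ext)
  fix r
  show "fps_nth (shifted_rising_fps (Suc n)) r = fps_nth (shifted_rising_fps n * (1 + fps_X * fps_const (1 / of_nat (Suc n)))) r"
  proof (cases r)
    case 0
    then show ?thesis by (simp add: shifted_rising_fps_def S_sum_0)
  next
    case (Suc k)
    have "fps_nth (shifted_rising_fps n * (1 + fps_X * fps_const (1 / of_nat (Suc n)))) r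
       = fps_nth (shifted_rising_fps n) r + fps_nth (fps_X * shifted_rising_fps n) r * (1 / of_nat (Suc n))"
      by (simp add: distrib_left mult.left_commute[of "shifted_rising_fps n"] mult.assoc[symmetric] del: of_nat_Suc)
    then show ?thesis using S_sum_Suc[of "int r" n] by (simp add: Suc shifted_rising_fps_def)
  qed
qed

lemma shifted_rising_has_fps_expansion: "(\<lambda>s. rising (s + 1) n) has_fps_expansion shifted_rising_fps n"
proof (induction n)
  case 0
  have "shifted_rising_fps 0 = 1"
  proof (rule fps_ext)
    fix r show "fps_nth (shifted_rising_fps 0) r = fps_nth 1 r"
      using S_sum_nat_eq_0[of 0 "int r"] by (cases r) (auto simp: shifted_rising_fps_def S_sum_0)
  qed
  then show ?case by simp
next
  case (Suc n)
  have "(\<lambda>s. rising (s + 1) n * (1 + s * (1 / of_nat (Suc n)))) has_fps_expansion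
      shifted_rising_fps n * (1 + fps_X * fps_const (1 / of_nat (Suc n)))"
    by (intro fps_expansion_intros Suc)
  then show ?case unfolding rising_shift_Suc shifted_rising_fps_Suc by simp
qed

definition rising_fps :: "nat \<Rightarrow> complex fps" where
  "rising_fps l = (if l = 0 then 1 else fps_X * shifted_rising_fps (l - 1) * fps_const (1 / of_nat l))"

lemma rising_has_fps_expansion: "(\<lambda>s. rising s l) has_fps_expansion rising_fps l"
proof (cases l)
  case (Suc k)
  have "(\<lambda>s. s * rising (s + 1) k * (1 / of_nat (Suc k))) has_fps_expansion
     fps_X * shifted_rising_fps k * fps_const (1 / of_nat (Suc k))"
    by (intro fps_expansion_intros shifted_rising_has_fps_expansion)
  then show ?thesis unfolding Suc rising_shift by (simp add: rising_fps_def)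
qed (simp add: rising_fps_def)

lemma nth_rising_fps:
  "fps_nth (rising_fps l) r = of_real (if l = 0 then if r = 0 then 1 else 0 else S_sum (int r - 1) 1 (int l - 1) / real l)"
  by (cases r; cases l) (auto simp: rising_fps_def shifted_rising_fps_def S_sum_neg mult.assoc)

lemma higher_deriv_psi_series:
  "norm s < 1 \<Longrightarrow> (deriv ^^ n) psi_series s = (-1) ^ Suc n * Polygamma n (1 - s) - (if n = 0 then euler_mascheroni else 0)"
proof (induction n arbitrary: s)
  case 0
  have "Polygamma 0 (1 - s) + euler_mascheroni = (\<Sum>k. inverse (of_nat (Suc k)) - inverse (1 - s + of_nat k))"
    by (simp add: Digamma_def)
  also have "\<dots> = (\<Sum>l. - (1 / (of_nat l + 1 - s) - 1 / (of_nat l + 1)))"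
    by (intro suminf_cong) (simp add: inverse_eq_divide algebra_simps)
  also have "\<dots> = - psi_series s"
  proof -
    have ne: "1 - s \<noteq> 0" using 0 by auto
    have "summable (\<lambda>l. - (inverse (of_nat (Suc l)) - inverse (1 - s + of_nat l)))"
      by (intro summable_minus summable_Digamma ne)
    then have "summable (\<lambda>l. 1 / (of_nat l + 1 - s) - 1 / (of_nat l + 1))"
      by (simp add: inverse_eq_divide algebra_simps)
    then show ?thesis unfolding psi_series_def by (rule suminf_minus[symmetric, THEN sym])
  qed
  finally have "psi_series s = - (Polygamma 0 (1 - s) + euler_mascheroni)" by simp
  then show ?case by simp
next
  case (Suc n)
  have nn: "1 - z \<notin> \<int>\<^sub>\<le>\<^sub>0" if "norm z < 1" for z :: complex
  proof
    assume "1 - z \<in> \<int>\<^sub>\<le>\<^sub>0"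
    then obtain m where "1 - z = of_int m" "m \<le> 0" by (auto elim!: nonpos_Ints_cases)
    then have "Re (1 - z) \<le> 0" by (simp del: minus_complex.simps)
    then show False using complex_Re_le_cmod[of z] that by simp
  qed
  have "\<forall>\<^sub>F z in nhds s. norm z < 1"
    using eventually_nhds_in_open[of "ball 0 1" s] Suc.prems by simp
  then have "\<forall>\<^sub>F z in nhds s. (deriv ^^ n) psi_series z = (-1) ^ Suc n * Polygamma n (1 - z) - (if n = 0 then euler_mascheroni else 0)"
    by eventually_elim (rule Suc.IH)
  then have "deriv ((deriv ^^ n) psi_series) s = deriv (\<lambda>z. (-1) ^ Suc n * Polygamma n (1 - z) - (if n = 0 then euler_mascheroni else 0)) s"
    by (intro deriv_cong_ev) auto
  also have "\<dots> = (-1) ^ Suc n * (Polygamma (Suc n) (1 - s) * (-1))"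
  proof (rule DERIV_imp_deriv)
    have "((\<lambda>z. Polygamma n (1 - z)) has_field_derivative Polygamma (Suc n) (1 - s) * (-1)) (at s)"
      by (rule DERIV_chain2[OF has_field_derivative_Polygamma])
         (use nn[OF Suc.prems] in \<open>auto intro!: derivative_eq_intros\<close>)
    then have "((\<lambda>z. (-1) ^ Suc n * Polygamma n (1 - z)) has_field_derivative (-1) ^ Suc n * (Polygamma (Suc n) (1 - s) * (-1))) (at s)"
      by (rule DERIV_cmult)
    from DERIV_diff[OF this DERIV_const]
    show "((\<lambda>z. (-1) ^ Suc n * Polygamma n (1 - z) - (if n = 0 then euler_mascheroni else 0)) has_field_derivative
        (-1) ^ Suc n * (Polygamma (Suc n) (1 - s) * (-1))) (at s)" by simp
  qed
  finally show ?case by simp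
qed

lemma holomorphic_psi_series: "psi_series holomorphic_on ball 0 1"
proof -
  have "(\<lambda>s. - Polygamma 0 (1 - s) - euler_mascheroni) holomorphic_on ball 0 1"
  proof -
    have "(\<lambda>s. Polygamma 0 (1 - s)) holomorphic_on ball 0 (1::real)"
    proof (rule holomorphic_on_compose_gen[of "\<lambda>s. 1 - s" "ball 0 1" "Polygamma 0" "{z. Re z > 0}", unfolded o_def])
      show "Polygamma 0 holomorphic_on {z::complex. Re z > 0}"
        by (rule holomorphic_on_Polygamma) (auto elim!: nonpos_Ints_cases)
      show "(\<lambda>s. 1 - s) ` ball 0 1 \<subseteq> {z::complex. Re z > 0}"
      proof
        fix z :: complex assume "z \<in> (\<lambda>s. 1 - s) ` ball 0 1"
        then obtain s where "z = 1 - s" "norm s < 1" by auto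
        then show "z \<in> {z. Re z > 0}" using complex_Re_le_cmod[of s] by simp
      qed
    qed (intro holomorphic_intros)
    then show ?thesis by (intro holomorphic_intros)
  qed
  then show ?thesis
    by (rule holomorphic_transform) (use higher_deriv_psi_series[of _ 0] in auto)
qed

definition psi_fps :: "complex fps" where
  "psi_fps = Abs_fps (\<lambda>k. if k = 0 then 0 else zeta_const (of_nat k + 1))"

lemma psi_has_fps_expansion: "psi_series has_fps_expansion psi_fps"
proof -
  have "psi_series has_fps_expansion fps_expansion psi_series 0"
    by (rule has_fps_expansion_fps_expansion[OF _ _ holomorphic_psi_series]) auto
  moreover have "fps_expansion psi_series 0 = psi_fps"
  proof (rule fps_ext)
    fix k
    have nth: "fps_nth (fps_expansion psi_series 0) k = (deriv ^^ k) psi_series 0 / fact k"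
      by (simp add: fps_expansion_def)
    show "fps_nth (fps_expansion psi_series 0) k = fps_nth psi_fps k"
    proof (cases "k = 0")
      case True
      then show ?thesis unfolding nth by (simp add: psi_fps_def psi_series_def)
    next
      case False
      have "(\<lambda>j. inverse ((1 + of_nat j) ^ Suc k)) sums ((-1) ^ Suc k * Polygamma k (1 :: complex) / fact k)"
        by (rule Polygamma_LIMSEQ) (use False in auto)
      moreover have "(\<lambda>n. 1 / of_nat (Suc n) powr (of_nat k + 1)) sums zeta_const (of_nat k + 1)"
        by (rule zeta_const_sums) (use False in auto)
      moreover have "1 / of_nat (Suc n) powr (of_nat k + 1) = inverse ((1 + of_nat n :: complex) ^ Suc k)" for n
      proof -
        have "(of_nat (Suc n) :: complex) powr (of_nat (Suc k)) = of_nat (Suc n) ^ Suc k"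
          by (rule powr_nat') auto
        then show ?thesis by (simp add: inverse_eq_divide add.commute)
      qed
      ultimately have "zeta_const (of_nat k + 1) = (-1) ^ Suc k * Polygamma k 1 / fact k"
        using sums_unique2 by auto
      then show ?thesis unfolding nth using False by (simp add: psi_fps_def higher_deriv_psi_series)
    qed
  qed
  ultimately show ?thesis by simp
qed

definition beta_fps :: "nat \<Rightarrow> complex fps" where
  "beta_fps n = shifted_rising_fps n * (fps_X * fps_const (harm (Suc n)) + fps_X * psi_fps - 1) - fps_X * fps_deriv (shifted_rising_fps n)"

lemma beta_closed_has_fps_expansion: "beta_closed n has_fps_expansion beta_fps n"
  unfolding beta_closed_def[abs_def] beta_fps_def
  by (intro fps_expansion_intros shifted_rising_has_fps_expansion psi_has_fps_expansion)

text \<open>The coefficients of \<open>P (s H + s psi_series s - 1) - s P'\<close> with the power series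
  \<open>P\<close> of the sums \<open>S_sum r 1 n\<close>, the harmonic number \<open>H\<close> and \<open>s
  psi_series s = \<Sum>k\<ge>2. \<zeta>(k) s^k\<close>.\<close>
lemma Re_nth_beta_fps:
  "Re (fps_nth (beta_fps n) r) = S_sum (int r - 1) 1 (int n) * harm (Suc n) - (real r + 1) * S_sum (int r) 1 (int n)
     + (\<Sum>k=2..r. S_sum (int r - int k) 1 (int n) * zeta_real (real k))"
proof -
  have zr: "Re (zeta_const (of_nat k + 1)) = zeta_real (real (Suc k))" if "k \<ge> 1" for k
  proof -
    have "zeta (of_nat k + 1) = zeta_const (of_nat k + 1)" using that by (intro zeta_eq_zeta_const) auto
    then show ?thesis by (simp add: zeta_deriv_def add.commute)
  qed
  have 1: "fps_nth (shifted_rising_fps n * (fps_X * fps_const c)) r = of_real (S_sum (int r - 1) 1 (int n)) * c" for c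
    by (cases r) (simp_all add: shifted_rising_fps_def S_sum_neg mult.left_commute[of "shifted_rising_fps n"] mult.assoc[symmetric])
  have 2: "fps_nth (fps_X * fps_deriv (shifted_rising_fps n)) r = of_nat r * of_real (S_sum (int r) 1 (int n))"
    by (cases r) (simp_all add: shifted_rising_fps_def)
  have 3: "fps_nth (shifted_rising_fps n * (fps_X * psi_fps)) r
     = (\<Sum>k=2..r. of_real (S_sum (int r - int k) 1 (int n)) * zeta_const (of_nat (k - 1) + 1))"
  proof -
    have "fps_nth (shifted_rising_fps n * (fps_X * psi_fps)) r = (\<Sum>k=0..r. fps_nth (fps_X * psi_fps) k * fps_nth (shifted_rising_fps n) (r - k))"
      unfolding mult.commute[of "shifted_rising_fps n"] by (rule fps_mult_nth)
    also have "\<dots> = (\<Sum>k=2..r. of_real (S_sum (int r - int k) 1 (int n)) * zeta_const (of_nat (k - 1) + 1))"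
    proof (rule sum.mono_neutral_cong_right)
      show "\<forall>k\<in>{0..r} - {2..r}. fps_nth (fps_X * psi_fps) k * fps_nth (shifted_rising_fps n) (r - k) = 0"
      proof
        fix k assume "k \<in> {0..r} - {2..r}"
        then have "k = 0 \<or> k = 1" by auto
        then show "fps_nth (fps_X * psi_fps) k * fps_nth (shifted_rising_fps n) (r - k) = 0" by (auto simp: psi_fps_def)
      qed
      fix k assume "k \<in> {2..r}"
      then show "fps_nth (fps_X * psi_fps) k * fps_nth (shifted_rising_fps n) (r - k)
         = of_real (S_sum (int r - int k) 1 (int n)) * zeta_const (of_nat (k - 1) + 1)"
        by (simp add: psi_fps_def shifted_rising_fps_def of_nat_diff)
    qed auto
    finally show ?thesis .
  qed
  have harm: "(harm (Suc n) :: complex) = of_real (harm (Suc n))" by (simp add: of_real_harm)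
  have "fps_nth (beta_fps n) r = fps_nth (shifted_rising_fps n * (fps_X * fps_const (harm (Suc n)))) r
     + fps_nth (shifted_rising_fps n * (fps_X * psi_fps)) r - fps_nth (shifted_rising_fps n) r - fps_nth (fps_X * fps_deriv (shifted_rising_fps n)) r"
    by (simp add: beta_fps_def algebra_simps)
  also have "Re \<dots> = S_sum (int r - 1) 1 (int n) * harm (Suc n)
     + (\<Sum>k=2..r. S_sum (int r - int k) 1 (int n) * Re (zeta_const (of_nat (k - 1) + 1))) - S_sum (int r) 1 (int n) - real r * S_sum (int r) 1 (int n)"
    unfolding 1 2 3 harm by (simp add: shifted_rising_fps_def Re_sum)
  also have "(\<Sum>k=2..r. S_sum (int r - int k) 1 (int n) * Re (zeta_const (of_nat (k - 1) + 1)))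
     = (\<Sum>k=2..r. S_sum (int r - int k) 1 (int n) * zeta_real (real k))"
  proof (intro sum.cong refl)
    fix k assume k: "k \<in> {2..r}"
    then have "Re (zeta_const (of_nat (k - 1) + 1)) = zeta_real (real (Suc (k - 1)))" by (intro zr) auto
    also have "Suc (k - 1) = k" using k by auto
    finally show "S_sum (int r - int k) 1 (int n) * Re (zeta_const (of_nat (k - 1) + 1))
      = S_sum (int r - int k) 1 (int n) * zeta_real (real k)" by simp
  qed
  finally show ?thesis by (simp add: algebra_simps)
qed

text \<open>The two cases in \<open>d_coeff\<close> are one formula: for \<open>r \<ge> q\<close> there are too few
  numbers up to \<open>q - 2\<close> for the sums \<open>S_sum (r-1)\<close>, \<open>S_sum r\<close> and \<open>S_sum
  (r-k)\<close> with \<open>k < r - q + 2\<close>.\<close>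
lemma d_coeff_eq:
  assumes "q \<ge> 2"
  shows "d_coeff p q r = (-1) ^ r * fact p / fact (p - r) *
     (Re (fps_nth (beta_fps (q - 2)) r) - (real p - real r) * S_sum (int r) 1 (int q - 2)
       + S_sum (int r - 1) 1 (int q - 2) * euler_mascheroni)"
proof -
  have n: "int (q - 2) = int q - 2" "Suc (q - 2) = q - 1" using assms by auto
  note beta = Re_nth_beta_fps[of "q - 2" r, unfolded n]
  show ?thesis
  proof (cases "r \<le> q - 1")
    case True
    show ?thesis unfolding d_coeff_def beta using True D_coeff_eq_harm[OF assms True] by simp
  next
    case False
    then have r: "r \<ge> q" by simp
    have 0: "S_sum (int r) 1 (int q - 2) = 0" "S_sum (int r - 1) 1 (int q - 2) = 0"
      using r assms by (auto intro!: S_sum_eq_0)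
    have "(\<Sum>k=2..r. S_sum (int r - int k) 1 (int q - 2) * zeta_real (real k))
       = (\<Sum>k=r-q+2..r. S_sum (int r - int k) 1 (int q - 2) * zeta_real (real k))"
    proof (rule sum.mono_neutral_right)
      show "\<forall>k\<in>{2..r} - {r-q+2..r}. S_sum (int r - int k) 1 (int q - 2) * zeta_real (real k) = 0"
      proof
        fix k assume k: "k \<in> {2..r} - {r-q+2..r}"
        then have "S_sum (int r - int k) 1 (int q - 2) = 0" using r assms by (intro S_sum_eq_0) auto
        then show "S_sum (int r - int k) 1 (int q - 2) * zeta_real (real k) = 0" by simp
      qed
    qed auto
    then show ?thesis unfolding d_coeff_def beta 0 using False by simp
  qed
qed

definition conv_sum_fps :: "nat \<Rightarrow> nat \<Rightarrow> complex fps" where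
  "conv_sum_fps q n = (\<Sum>k=1..<n. fps_exp (- of_real (ln (real k))) * fps_const (1 / of_nat (n - k) ^ q))"

text \<open>The factor of \<open>n^(-s)\<close> in \<open>conv_expansion\<close>.\<close>
definition bracket_fps :: "nat \<Rightarrow> nat \<Rightarrow> nat \<Rightarrow> complex fps" where
  "bracket_fps q L n = (\<Sum>l<L. rising_fps l * fps_const (zeta_const (of_nat q - of_nat l) / of_nat n ^ l))
     + (beta_fps (q - 2) + rising_fps (q - 1) * fps_const (of_nat (q - 1) * of_real (ln (real n)))) * fps_const (1 / (of_nat (q - 1) * of_nat n ^ (q - 1)))"

definition expansion_fps :: "nat \<Rightarrow> nat \<Rightarrow> nat \<Rightarrow> complex fps" where
  "expansion_fps q L n =
     fps_const (1 / of_nat n ^ q) * (\<Sum>l<L. fps_const (rising (of_nat q) l / of_nat n ^ l) * fps_expansion zeta_const (- of_nat l))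
     + fps_exp (- of_real (ln (real n))) * bracket_fps q L n"

lemma nat_powr_eq_exp: "k > 0 \<Longrightarrow> of_nat k powr (- s) = exp (- of_real (ln (real k)) * s :: complex)"
  by (simp add: powr_def Ln_of_nat mult.commute)

lemma conv_sum_has_fps_expansion: "(\<lambda>s. conv_sum q s n) has_fps_expansion conv_sum_fps q n"
proof -
  have "(\<lambda>s. \<Sum>k=1..<n. exp (- of_real (ln (real k)) * s) * (1 / of_nat (n - k) ^ q)) has_fps_expansion conv_sum_fps q n"
    unfolding conv_sum_fps_def by (intro fps_expansion_intros)
  also have "(\<lambda>s. \<Sum>k=1..<n. exp (- of_real (ln (real k)) * s) * (1 / of_nat (n - k) ^ q)) = (\<lambda>s. conv_sum q s n)"
    unfolding conv_sum_def by (intro ext sum.cong refl) (simp add: nat_powr_eq_exp)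
  finally show ?thesis .
qed

lemma zeta_const_analytic: "w \<noteq> 1 \<Longrightarrow> zeta_const analytic_on {w}"
  using holomorphic_zeta_const by (subst analytic_at) (auto intro!: exI[of _ "- {1}"])

lemma conv_expansion_has_fps_expansion:
  assumes "n \<ge> 1"
  shows "(\<lambda>s. conv_expansion q L s n) has_fps_expansion expansion_fps q L n"
proof -
  have z: "(\<lambda>s. zeta_const (- of_nat l + s)) has_fps_expansion fps_expansion zeta_const (- of_nat l)" for l
  proof (intro analytic_at_imp_has_fps_expansion zeta_const_analytic)
    show "- of_nat l \<noteq> (1 :: complex)"
    proof
      assume "- of_nat l = (1 :: complex)"
      then have "Re (- of_nat l) = Re (1 :: complex)" by (rule arg_cong)
      then show False by simp
    qed
  qed
  have "(\<lambda>s. 1 / of_nat n ^ q * (\<Sum>l<L. rising (of_nat q) l / of_nat n ^ l * zeta_const (- of_nat l + s))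
     + exp (- of_real (ln (real n)) * s) * ((\<Sum>l<L. rising s l * (zeta_const (of_nat q - of_nat l) / of_nat n ^ l))
        + (beta_closed (q - 2) s + rising s (q - 1) * (of_nat (q - 1) * of_real (ln (real n)))) * (1 / (of_nat (q - 1) * of_nat n ^ (q - 1)))))
     has_fps_expansion expansion_fps q L n"
    unfolding expansion_fps_def bracket_fps_def
    by (intro fps_expansion_intros z rising_has_fps_expansion beta_closed_has_fps_expansion)
  moreover have "(\<lambda>s. 1 / of_nat n ^ q * (\<Sum>l<L. rising (of_nat q) l / of_nat n ^ l * zeta_const (- of_nat l + s))
     + exp (- of_real (ln (real n)) * s) * ((\<Sum>l<L. rising s l * (zeta_const (of_nat q - of_nat l) / of_nat n ^ l))
        + (beta_closed (q - 2) s + rising s (q - 1) * (of_nat (q - 1) * of_real (ln (real n)))) * (1 / (of_nat (q - 1) * of_nat n ^ (q - 1)))))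
     = (\<lambda>s. conv_expansion q L s n)"
    using assms by (intro ext) (simp add: conv_expansion_def half_zeta_def nat_powr_eq_exp mult_ac)
  ultimately show ?thesis by simp
qed

lemma holomorphic_conv_sum: "(\<lambda>s. conv_sum q s n) holomorphic_on UNIV"
  unfolding conv_sum_def by (intro holomorphic_intros) auto

lemma holomorphic_conv_expansion:
  assumes "n \<ge> 1" "q \<ge> 2"
  shows "(\<lambda>s. conv_expansion q L s n) holomorphic_on ball 0 1"
proof -
  have r: "(\<lambda>s. rising s l) holomorphic_on A" for l and A :: "complex set"
    unfolding rising_def pochhammer_prod by (intro holomorphic_intros) auto
  have r1: "(\<lambda>s. rising (s + 1) l) holomorphic_on A" for l and A :: "complex set"
    unfolding rising_def pochhammer_prod by (intro holomorphic_intros) auto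
  have b: "beta_closed k holomorphic_on ball 0 1" for k
    unfolding beta_closed_def[abs_def] by (intro holomorphic_intros r1 holomorphic_psi_series) auto
  have z: "(\<lambda>s. zeta_const (s - of_nat l)) holomorphic_on ball 0 1" for l
  proof (rule holomorphic_on_compose_gen[of "\<lambda>s. s - of_nat l" "ball 0 1" zeta_const "- {1}", unfolded o_def])
    show "(\<lambda>s. s - of_nat l) ` ball 0 1 \<subseteq> - {1::complex}"
    proof
      fix w :: complex assume "w \<in> (\<lambda>s. s - of_nat l) ` ball 0 1"
      then obtain s where s: "w = s - of_nat l" "norm s < 1" by auto
      then have "Re w < 1" using complex_Re_le_cmod[of s] by simp
      then show "w \<in> - {1}" by auto
    qed
  qed (intro holomorphic_intros holomorphic_zeta_const)+
  show ?thesis unfolding conv_expansion_def half_zeta_def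
    using assms by (intro holomorphic_intros r b z) auto
qed

text \<open>Cauchy's inequality on the circle of radius \<open>1/2\<close>.\<close>
lemma nth_error_fps_bound:
  assumes "n \<ge> 3" "q \<ge> 2"
    and B: "\<And>s. norm s \<le> 1 / 2 \<Longrightarrow> norm (conv_sum q s n - conv_expansion q L s n) \<le> B"
  shows "norm (fps_nth (conv_sum_fps q n - expansion_fps q L n) p) \<le> B * 2 ^ p"
proof -
  define E where "E = (\<lambda>s. conv_sum q s n - conv_expansion q L s n)"
  have E: "E has_fps_expansion (conv_sum_fps q n - expansion_fps q L n)"
    unfolding E_def using assms by (intro fps_expansion_intros conv_sum_has_fps_expansion conv_expansion_has_fps_expansion) auto
  have hol: "E holomorphic_on ball 0 1"
    unfolding E_def using assms
    by (intro holomorphic_intros holomorphic_conv_expansion holomorphic_on_subset[OF holomorphic_conv_sum]) auto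
  have 1: "norm ((deriv ^^ p) E 0) \<le> fact p * B / (1 / 2) ^ p"
  proof (rule Cauchy_inequality)
    show "E holomorphic_on ball 0 (1 / 2)" by (rule holomorphic_on_subset[OF hol]) auto
    show "continuous_on (cball 0 (1 / 2)) E"
      by (rule continuous_on_subset[OF holomorphic_on_imp_continuous_on[OF hol]]) auto
    show "norm (E x) \<le> B" if "norm (0 - x) = 1 / 2" for x using that B by (simp add: E_def)
  qed auto
  have 2: "fps_nth (conv_sum_fps q n - expansion_fps q L n) p = (deriv ^^ p) E 0 / fact p"
    by (rule fps_nth_fps_expansion[OF E])
  show ?thesis unfolding 2 norm_divide using divide_right_mono[OF 1, of "fact p"] by (simp add: power_divide)
qed

section \<open>Extraction of the powers of the logarithm\<close>

text \<open>For a power series \<open>G\<close> with coefficients \<open>A\<close>, the number \<open>(-1)^p\<close>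
  times the \<open>p\<close>-th derivative of \<open>e^(-x s) G(s)\<close> at \<open>s = 0\<close>; it is used with
  \<open>x = ln n\<close>.\<close>
definition log_coeff :: "nat \<Rightarrow> real \<Rightarrow> (nat \<Rightarrow> real) \<Rightarrow> real" where
  "log_coeff p x A = (\<Sum>r=0..p. (-1) ^ r * fact p / fact (p - r) * A r * x ^ (p - r))"

lemma log_coeff_add: "log_coeff p x (\<lambda>r. A r + B r) = log_coeff p x A + log_coeff p x B"
  by (simp add: log_coeff_def distrib_left distrib_right sum.distrib)

lemma log_coeff_cmult: "log_coeff p x (\<lambda>r. c * A r) = c * log_coeff p x A"
  by (simp add: log_coeff_def sum_distrib_left mult_ac)

lemma log_coeff_sum: "log_coeff p x (\<lambda>r. \<Sum>l\<in>S. A l r) = (\<Sum>l\<in>S. log_coeff p x (A l))"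
  unfolding log_coeff_def sum_distrib_left sum_distrib_right by (rule sum.swap)

lemma Re_nth_exp_mult:
  "Re ((-1) ^ p * fact p * fps_nth (fps_exp (- of_real x) * G) p) = log_coeff p x (\<lambda>r. Re (fps_nth G r))"
proof -
  have "(-1) ^ p * fact p * fps_nth (fps_exp (- of_real x) * G) p
      = (\<Sum>r=0..p. (-1) ^ p * fact p * (fps_nth G r * ((- of_real x) ^ (p - r) / fact (p - r))))"
    unfolding mult.commute[of "fps_exp (- of_real x)"] fps_mult_nth sum_distrib_left by simp
  also have "\<dots> = (\<Sum>r=0..p. of_real ((-1) ^ r * fact p / fact (p - r) * x ^ (p - r)) * fps_nth G r)"
  proof (rule sum.cong[OF refl])
    fix r assume "r \<in> {0..p}"
    then obtain t where p: "p = r + t" using le_Suc_ex by auto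
    have "(-1) ^ p * (- of_real x) ^ (p - r) = (-1 :: complex) ^ r * of_real x ^ t"
      unfolding p power_minus[of "of_real x"] by (simp add: power_add mult.assoc flip: power_mult_distrib)
    then show "(-1) ^ p * fact p * (fps_nth G r * ((- of_real x) ^ (p - r) / fact (p - r)))
       = of_real ((-1) ^ r * fact p / fact (p - r) * x ^ (p - r)) * fps_nth G r"
      by (simp add: p field_simps)
  qed
  finally show ?thesis by (simp add: log_coeff_def Re_sum mult_ac del: of_real_mult of_real_divide)
qed

definition log_conv :: "nat \<Rightarrow> nat \<Rightarrow> nat \<Rightarrow> real" where
  "log_conv p q n = (\<Sum>k=1..<n. ln (real k) ^ p / real (n - k) ^ q)"

lemma Re_nth_conv_sum_fps:
  "Re ((-1) ^ p * fact p * fps_nth (conv_sum_fps q n) p) = log_conv p q n"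
proof -
  have "(-1) ^ p * fact p * fps_nth (conv_sum_fps q n) p = of_real (log_conv p q n)"
    unfolding conv_sum_fps_def log_conv_def fps_sum_nth sum_distrib_left of_real_sum
  proof (rule sum.cong[OF refl])
    fix k
    show "(-1) ^ p * fact p * fps_nth (fps_exp (- of_real (ln (real k))) * fps_const (1 / of_nat (n - k) ^ q)) p
       = complex_of_real (ln (real k) ^ p / real (n - k) ^ q)"
      unfolding fps_mult_right_const_nth fps_exp_nth power_minus[of "of_real (ln (real k))"]
      by (simp add: field_simps flip: power_mult_distrib)
  qed
  then show ?thesis by simp
qed

definition c_sum :: "nat \<Rightarrow> nat \<Rightarrow> real \<Rightarrow> real" where
  "c_sum p l x = (\<Sum>r=1..p. c_coeff p l r * x ^ (p - r))"

lemma log_coeff_rising: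
  assumes "l \<ge> 1"
  shows "log_coeff p x (\<lambda>r. S_sum (int r - 1) 1 (int l - 1)) = c_sum p l x"
  unfolding log_coeff_def c_sum_def c_coeff_def
  by (simp add: sum.atLeast_Suc_atMost S_sum_neg)

lemma log_coeff_unit: "log_coeff p x (\<lambda>r. if r = 0 then 1 else 0) = x ^ p"
proof -
  have "log_coeff p x (\<lambda>r. if r = 0 then 1 else 0) = (\<Sum>r=0..p. if r = 0 then x ^ p else 0)"
    unfolding log_coeff_def by (intro sum.cong refl) auto
  then show ?thesis by simp
qed

text \<open>A factor \<open>x\<close> raises the power of the logarithm by one. Shifting the index \<open>r\<close>
  restores the form of \<open>log_coeff\<close>, and the factorials produce \<open>-(p - r)\<close>; this explains the
  second summand in \<open>d_coeff\<close>.\<close>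
lemma log_coeff_shift:
  assumes "f (-1) = 0"
  shows "log_coeff p x (\<lambda>r. f (int r - 1) * x) = log_coeff p x (\<lambda>r. - (real p - real r) * f (int r))"
proof (cases p)
  case 0
  then show ?thesis using assms by (simp add: log_coeff_def)
next
  case (Suc p')
  have "log_coeff p x (\<lambda>r. f (int r - 1) * x) = (\<Sum>r=0..p'. (-1) ^ Suc r * fact p / fact (p - Suc r) * (f (int r) * x) * x ^ (p - Suc r))"
    unfolding log_coeff_def Suc sum.atLeast0_atMost_Suc_shift using assms by simp
  also have "\<dots> = (\<Sum>r=0..p'. (-1) ^ r * fact p / fact (p - r) * (- (real p - real r) * f (int r)) * x ^ (p - r))"
  proof (rule sum.cong[OF refl])
    fix r assume "r \<in> {0..p'}"
    then obtain t where t: "p' = r + t" using le_Suc_ex by auto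
    define T where "T = real t + 1"
    have pr: "p - Suc r = t" "p - r = Suc t" "real p - real r = T" and F: "fact (p - r) = T * fact t"
      by (auto simp: Suc t T_def)
    have "T \<noteq> 0" by (simp add: T_def)
    then show "(-1) ^ Suc r * fact p / fact (p - Suc r) * (f (int r) * x) * x ^ (p - Suc r)
       = (-1) ^ r * fact p / fact (p - r) * (- (real p - real r) * f (int r)) * x ^ (p - r)"
      unfolding F unfolding pr by (simp add: divide_simps)
  qed
  also have "\<dots> = log_coeff p x (\<lambda>r. - (real p - real r) * f (int r))"
    unfolding log_coeff_def Suc by simp
  finally show ?thesis .
qed

lemma zeta_deriv_eq:
  assumes "x \<noteq> 1"
  shows "zeta_deriv p x = Re ((deriv ^^ p) zeta_const (of_real x))"
proof -
  have x: "complex_of_real x \<noteq> 1" using assms by (metis of_real_1 of_real_eq_iff)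
  have "\<forall>\<^sub>F w in nhds (complex_of_real x). w \<in> - {1}"
    by (rule eventually_nhds_in_open) (use x in auto)
  then have "\<forall>\<^sub>F w in nhds (complex_of_real x). zeta w = zeta_const w"
    by eventually_elim (auto intro: zeta_eq_zeta_const)
  then show ?thesis unfolding zeta_deriv_def by (subst higher_deriv_cong_ev[OF _ refl]) auto
qed

lemma rising_of_nat:
  assumes "q \<ge> 1"
  shows "rising (of_nat q :: complex) l = of_nat ((l + q - 1) choose (q - 1))"
proof -
  have "rising (of_nat q :: complex) l = (-1) ^ l * ((-1) ^ l * ((of_nat l + of_nat q - 1) gchoose l))"
    unfolding rising_gbinomial by (subst gbinomial_negated_upper) simp
  also have "\<dots> = of_nat (l + q - 1) gchoose l"
    using assms by (simp add: of_nat_diff flip: mult.assoc power_mult_distrib)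
  also have "\<dots> = of_nat ((l + q - 1) choose l)" by (simp add: binomial_gbinomial)
  also have "(l + q - 1) choose l = (l + q - 1) choose (q - 1)"
    using assms binomial_symmetric[of l "l + q - 1"] by simp
  finally show ?thesis .
qed

definition right_term :: "nat \<Rightarrow> nat \<Rightarrow> nat \<Rightarrow> real \<Rightarrow> real" where
  "right_term p q l x = Re (zeta_const (of_nat q - of_nat l)) / real l * c_sum p l x"

definition left_term :: "nat \<Rightarrow> nat \<Rightarrow> nat \<Rightarrow> real" where
  "left_term p q l = (-1) ^ p * real ((l + q - 1) choose (q - 1)) * zeta_deriv p (- real l)"

lemma Re_nth_bracket_fps:
  assumes "q \<ge> 2" "L \<ge> 1"
  shows "Re (fps_nth (bracket_fps q L n) r) =
     Re (zeta_const (of_nat q)) * (if r = 0 then 1 else 0)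
     + (\<Sum>l=1..<L. Re (zeta_const (of_nat q - of_nat l)) / (real l * real n ^ l) * S_sum (int r - 1) 1 (int l - 1))
     + 1 / (real (q - 1) * real n ^ (q - 1)) * (Re (fps_nth (beta_fps (q - 2)) r) + S_sum (int r - 1) 1 (int q - 2) * ln (real n))"
proof -
  let ?\<rho> = "\<lambda>l. if l = 0 then if r = 0 then 1 else 0 else S_sum (int r - 1) 1 (int l - 1) / real l"
  have q1: "int (q - 1) - 1 = int q - 2" "q - 1 \<noteq> 0" using assms by auto
  have A: "Re (fps_nth (rising_fps l * fps_const (zeta_const (of_nat q - of_nat l) / of_nat n ^ l)) r)
    = ?\<rho> l * Re (zeta_const (of_nat q - of_nat l)) / real n ^ l" for l
  proof -
    have "(of_nat n :: complex) ^ l = of_real (real n ^ l)" by simp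
    then show ?thesis unfolding fps_mult_right_const_nth nth_rising_fps by (simp del: of_real_power)
  qed
  have B: "Re (fps_nth ((beta_fps (q - 2) + rising_fps (q - 1) * fps_const (of_nat (q - 1) * of_real (ln (real n)))) * fps_const (1 / (of_nat (q - 1) * of_nat n ^ (q - 1)))) r)
     = 1 / (real (q - 1) * real n ^ (q - 1)) * (Re (fps_nth (beta_fps (q - 2)) r) + S_sum (int r - 1) 1 (int q - 2) * ln (real n))"
  proof -
    have "(1 / (of_nat (q - 1) * of_nat n ^ (q - 1)) :: complex) = of_real (1 / (real (q - 1) * real n ^ (q - 1)))" by simp
    moreover have "of_nat (q - 1) * complex_of_real (ln (real n)) = of_real (real (q - 1) * ln (real n))" by simp
    moreover have "S_sum (int r - 1) 1 (int q - 2) / real (q - 1) * (real (q - 1) * ln (real n)) = S_sum (int r - 1) 1 (int q - 2) * ln (real n)"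
      using q1 by simp
    ultimately show ?thesis
      unfolding fps_mult_right_const_nth fps_add_nth nth_rising_fps q1(1)
      using q1(2) by (simp del: of_real_mult of_real_divide add: of_real_mult[symmetric])
  qed
  have "Re (fps_nth (bracket_fps q L n) r) = (\<Sum>l<L. ?\<rho> l * Re (zeta_const (of_nat q - of_nat l)) / real n ^ l)
      + 1 / (real (q - 1) * real n ^ (q - 1)) * (Re (fps_nth (beta_fps (q - 2)) r) + S_sum (int r - 1) 1 (int q - 2) * ln (real n))"
    unfolding bracket_fps_def fps_add_nth[of "sum _ _"] fps_sum_nth plus_complex.simps Re_sum A B ..
  also have "(\<Sum>l<L. ?\<rho> l * Re (zeta_const (of_nat q - of_nat l)) / real n ^ l)
     = Re (zeta_const (of_nat q)) * (if r = 0 then 1 else 0) +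
      (\<Sum>l=1..<L. ?\<rho> l * Re (zeta_const (of_nat q - of_nat l)) / real n ^ l)"
    using assms by (simp add: lessThan_atLeast0 sum.atLeast_Suc_lessThan)
  also have "(\<Sum>l=1..<L. ?\<rho> l * Re (zeta_const (of_nat q - of_nat l)) / real n ^ l)
     = (\<Sum>l=1..<L. Re (zeta_const (of_nat q - of_nat l)) / (real l * real n ^ l) * S_sum (int r - 1) 1 (int l - 1))"
    by (intro sum.cong refl) auto
  finally show ?thesis .
qed

text \<open>The index \<open>l = q - 1\<close> is singled out: its constant is Euler's constant, and together with the
  contribution of the two primitives it forms the sum with the coefficients \<open>d_coeff\<close>.\<close>
lemma Re_nth_expansion_fps:
  assumes "q \<ge> 2" "L \<ge> q" "n \<ge> 1"
  shows "Re ((-1) ^ p * fact p * fps_nth (expansion_fps q L n) p) =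
     (\<Sum>l<L. left_term p q l / real n ^ (l + q))
     + zeta_real (real q) * ln (real n) ^ p
     + (\<Sum>l\<in>{1..<L} - {q - 1}. right_term p q l (ln (real n)) / real n ^ l)
     + 1 / (real (q - 1) * real n ^ (q - 1)) * (\<Sum>r=0..p. d_coeff p q r * ln (real n) ^ (p - r))"
proof -
  define x where "x = ln (real n)"
  define m where "m = 1 / (real (q - 1) * real n ^ (q - 1))"
  have zl: "Re ((deriv ^^ p) zeta_const (- of_nat l)) = zeta_deriv p (- real l)" for l
    using zeta_deriv_eq[of "- real l" p] by simp
  have P1: "Re ((-1) ^ p * fact p * fps_nth (fps_const (1 / of_nat n ^ q) * (\<Sum>l<L. fps_const (rising (of_nat q) l / of_nat n ^ l) * fps_expansion zeta_const (- of_nat l))) p)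
     = (\<Sum>l<L. left_term p q l / real n ^ (l + q))"
  proof -
    have "(-1) ^ p * fact p * fps_nth (fps_const (1 / of_nat n ^ q) * (\<Sum>l<L. fps_const (rising (of_nat q) l / of_nat n ^ l) * fps_expansion zeta_const (- of_nat l))) p
      = (\<Sum>l<L. of_real ((-1) ^ p * real ((l + q - 1) choose (q - 1)) / real n ^ (l + q)) * (deriv ^^ p) zeta_const (- of_nat l))"
      unfolding fps_mult_left_const_nth fps_sum_nth sum_distrib_left
      using assms by (intro sum.cong refl) (simp add: rising_of_nat fps_expansion_def power_add mult_ac)
    then show ?thesis by (simp add: Re_sum zl left_term_def del: of_real_mult of_real_divide)
  qed
  have P2: "Re ((-1) ^ p * fact p * fps_nth (fps_exp (- of_real (ln (real n))) * bracket_fps q L n) p)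
     = Re (zeta_const (of_nat q)) * x ^ p
       + (\<Sum>l=1..<L. right_term p q l x / real n ^ l)
       + m * (log_coeff p x (\<lambda>r. Re (fps_nth (beta_fps (q - 2)) r)) + log_coeff p x (\<lambda>r. S_sum (int r - 1) 1 (int q - 2) * x))"
  proof -
    define B where "B = (\<lambda>l. Re (zeta_const (of_nat q - of_nat l)) / (real l * real n ^ l))"
    have "L \<ge> 1" using assms by simp
    then have br: "Re (fps_nth (bracket_fps q L n) r) = Re (zeta_const (of_nat q)) * (if r = 0 then 1 else 0)
        + (\<Sum>l=1..<L. B l * S_sum (int r - 1) 1 (int l - 1))
        + m * (Re (fps_nth (beta_fps (q - 2)) r) + S_sum (int r - 1) 1 (int q - 2) * x)" for r
      unfolding B_def m_def x_def by (rule Re_nth_bracket_fps[OF assms(1)])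
    have "(\<Sum>l=1..<L. B l * log_coeff p x (\<lambda>r. S_sum (int r - 1) 1 (int l - 1))) = (\<Sum>l=1..<L. B l * c_sum p l x)"
      by (intro sum.cong refl) (simp add: log_coeff_rising)
    then show ?thesis
      unfolding Re_nth_exp_mult br x_def[symmetric] log_coeff_add log_coeff_sum log_coeff_cmult log_coeff_unit
      by (simp add: B_def right_term_def)
  qed
  have S: "(\<Sum>l=1..<L. right_term p q l x / real n ^ l)
    = m * (euler_mascheroni * c_sum p (q - 1) x) + (\<Sum>l\<in>{1..<L} - {q - 1}. right_term p q l x / real n ^ l)"
  proof -
    have "of_nat q - of_nat (q - 1) = (1 :: complex)" using assms by (simp add: of_nat_diff)
    moreover have "Re (zeta_const 1) = euler_mascheroni" unfolding zeta_const_1 by (rule Re_complex_of_real)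
    ultimately show ?thesis using assms
      by (subst sum.remove[of _ "q - 1"]) (auto simp: m_def right_term_def)
  qed
  have c: "c_sum p (q - 1) x = log_coeff p x (\<lambda>r. S_sum (int r - 1) 1 (int q - 2))"
  proof -
    have "int (q - 1) - 1 = int q - 2" using assms by auto
    then show ?thesis using log_coeff_rising[of "q - 1" p x] assms by simp
  qed
  have D: "log_coeff p x (\<lambda>r. Re (fps_nth (beta_fps (q - 2)) r)) + log_coeff p x (\<lambda>r. S_sum (int r - 1) 1 (int q - 2) * x)
      + euler_mascheroni * c_sum p (q - 1) x = (\<Sum>r=0..p. d_coeff p q r * x ^ (p - r))"
  proof -
    have "log_coeff p x (\<lambda>r. Re (fps_nth (beta_fps (q - 2)) r)) + log_coeff p x (\<lambda>r. S_sum (int r - 1) 1 (int q - 2) * x)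
      + euler_mascheroni * c_sum p (q - 1) x
      = log_coeff p x (\<lambda>r. Re (fps_nth (beta_fps (q - 2)) r) + - (real p - real r) * S_sum (int r) 1 (int q - 2) + euler_mascheroni * S_sum (int r - 1) 1 (int q - 2))"
      unfolding log_coeff_add log_coeff_cmult c by (subst log_coeff_shift) (auto simp: S_sum_neg)
    also have "\<dots> = (\<Sum>r=0..p. d_coeff p q r * x ^ (p - r))"
      unfolding log_coeff_def d_coeff_eq[OF assms(1)] by (intro sum.cong refl) (simp add: algebra_simps)
    finally show ?thesis .
  qed
  have zq: "Re (zeta_const (of_nat q)) = zeta_real (real q)"
  proof -
    have "(of_nat q :: complex) \<noteq> 1" using assms by (metis of_nat_1 of_nat_eq_iff numeral_le_one_iff semiring_norm(69))
    then show ?thesis by (simp add: zeta_deriv_def zeta_eq_zeta_const)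
  qed
  have "Re ((-1) ^ p * fact p * fps_nth (expansion_fps q L n) p) = (\<Sum>l<L. left_term p q l / real n ^ (l + q)) +
     (Re (zeta_const (of_nat q)) * x ^ p
       + (\<Sum>l=1..<L. right_term p q l x / real n ^ l)
       + m * (log_coeff p x (\<lambda>r. Re (fps_nth (beta_fps (q - 2)) r)) + log_coeff p x (\<lambda>r. S_sum (int r - 1) 1 (int q - 2) * x)))"
    unfolding expansion_fps_def fps_add_nth distrib_left plus_complex.simps P1 P2 ..
  then show ?thesis unfolding S zq x_def[symmetric] m_def[symmetric] D[symmetric] by (simp add: algebra_simps)
qed

lemma c_coeff_eq_0: "r > i \<Longrightarrow> i \<ge> 1 \<Longrightarrow> c_coeff p i r = 0"
  unfolding c_coeff_def by (simp add: S_sum_eq_0)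

lemma c_sum_min: "i \<ge> 1 \<Longrightarrow> c_sum p i x = (\<Sum>r=1..min i p. c_coeff p i r * x ^ (p - r))"
  unfolding c_sum_def by (intro sum.mono_neutral_right) (auto simp: c_coeff_eq_0)

definition log_expansion :: "nat \<Rightarrow> nat \<Rightarrow> nat \<Rightarrow> nat \<Rightarrow> real" where
  "log_expansion p q m n =
     zeta_real (real q) * ln (real n) ^ p
     + (\<Sum>i=1..q-2. zeta_real (real (q - i)) / (real i * real n ^ i) *
          (\<Sum>r=1..min i p. c_coeff p i r * ln (real n) ^ (p - r)))
     + 1 / (real (q - 1) * real n ^ (q - 1)) * (\<Sum>r=0..p. d_coeff p q r * ln (real n) ^ (p - r))
     - (\<Sum>k=1..m.
          ((-1) ^ k * bernoulli k / (real k * real (k + q - 1)) *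
             (\<Sum>r=1..p. c_coeff p (k + q - 1) r * ln (real n) ^ (p - r))
           - (-1) ^ p * real ((k + q - 2) choose (q - 1)) * zeta_deriv p (1 - real k))
          * (1 / real n ^ (k + q - 1)))"

text \<open>The left terms with \<open>l < m\<close> and the right terms with \<open>q \<le> l < q + m\<close> are the
  summands \<open>k = l + 1\<close> and \<open>k = l - q + 1\<close> of the last sum in the expansion, where
  \<open>zeta_const_nonpos\<close> brings in the Bernoulli numbers. The terms beyond are collected separately.\<close>
lemma Re_nth_expansion_fps_eq:
  assumes "q \<ge> 2" "L \<ge> q + m" "n \<ge> 1"
  shows "Re ((-1) ^ p * fact p * fps_nth (expansion_fps q L n) p) = log_expansion p q m n
     + (\<Sum>l=m..<L. left_term p q l / real n ^ (l + q))
     + (\<Sum>l=q+m..<L. right_term p q l (ln (real n)) / real n ^ l)"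
proof -
  define x where "x = ln (real n)"
  define b where "b = (\<lambda>l. right_term p q l x / real n ^ l)"
  have A: "(\<Sum>l<L. left_term p q l / real n ^ (l + q)) = (\<Sum>k=1..m. (-1) ^ p * real ((k + q - 2) choose (q - 1)) * zeta_deriv p (1 - real k) * (1 / real n ^ (k + q - 1)))
      + (\<Sum>l=m..<L. left_term p q l / real n ^ (l + q))"
  proof -
    have "(\<Sum>l<L. left_term p q l / real n ^ (l + q)) = (\<Sum>l=0..<m. left_term p q l / real n ^ (l + q)) + (\<Sum>l=m..<L. left_term p q l / real n ^ (l + q))"
      using assms by (simp add: lessThan_atLeast0 sum.atLeastLessThan_concat)
    also have "(\<Sum>l=0..<m. left_term p q l / real n ^ (l + q)) = (\<Sum>k=1..m. (-1) ^ p * real ((k + q - 2) choose (q - 1)) * zeta_deriv p (1 - real k) * (1 / real n ^ (k + q - 1)))"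
    proof (rule sum.reindex_bij_witness[of _ "\<lambda>k. k - 1" Suc])
      fix l assume "l \<in> {0..<m}"
      have "Suc l + q - 2 = l + q - 1" "Suc l + q - 1 = l + q" using assms by auto
      then show "(-1) ^ p * real ((Suc l + q - 2) choose (q - 1)) * zeta_deriv p (1 - real (Suc l)) * (1 / real n ^ (Suc l + q - 1))
          = left_term p q l / real n ^ (l + q)" by (simp add: left_term_def)
    qed auto
    finally show ?thesis .
  qed
  have B: "(\<Sum>l\<in>{1..<L} - {q - 1}. b l) = (\<Sum>l=1..q-2. b l) + (\<Sum>l=q..<q+m. b l) + (\<Sum>l=q+m..<L. b l)"
  proof -
    have "{1..<L} - {q - 1} = {1..q-2} \<union> {q..<L}" using assms by auto
    then have "(\<Sum>l\<in>{1..<L} - {q - 1}. b l) = (\<Sum>l\<in>{1..q-2} \<union> {q..<L}. b l)" by (simp only:)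
    also have "\<dots> = (\<Sum>l=1..q-2. b l) + (\<Sum>l=q..<L. b l)" using assms by (intro sum.union_disjoint) auto
    also have "(\<Sum>l=q..<L. b l) = (\<Sum>l=q..<q+m. b l) + (\<Sum>l=q+m..<L. b l)"
      using assms by (simp add: sum.atLeastLessThan_concat)
    finally show ?thesis by simp
  qed
  have B1: "(\<Sum>l=1..q-2. b l) = (\<Sum>i=1..q-2. zeta_real (real (q - i)) / (real i * real n ^ i) *
          (\<Sum>r=1..min i p. c_coeff p i r * x ^ (p - r)))"
  proof (rule sum.cong[OF refl])
    fix i assume i: "i \<in> {1..q-2}"
    have "i \<le> q" using i by auto
    then have "of_nat q - of_nat i = (of_nat (q - i) :: complex)" by (simp add: of_nat_diff)
    moreover have "of_nat (q - i) \<noteq> (1 :: complex)"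
    proof
      assume "of_nat (q - i) = (1 :: complex)"
      then have "q - i = 1" by (metis of_nat_1 of_nat_eq_iff)
      then show False using i by auto
    qed
    ultimately have "Re (zeta_const (of_nat q - of_nat i)) = zeta_real (real (q - i))"
      by (simp add: zeta_deriv_def zeta_eq_zeta_const)
    then show "b i = zeta_real (real (q - i)) / (real i * real n ^ i) * (\<Sum>r=1..min i p. c_coeff p i r * x ^ (p - r))"
      using i by (simp add: b_def right_term_def c_sum_min)
  qed
  have B2: "(\<Sum>l=q..<q+m. b l) = - (\<Sum>k=1..m. (-1) ^ k * bernoulli k / (real k * real (k + q - 1)) *
             (\<Sum>r=1..p. c_coeff p (k + q - 1) r * x ^ (p - r)) * (1 / real n ^ (k + q - 1)))"
    unfolding sum_negf[symmetric]
  proof (rule sum.reindex_bij_witness[of _ "\<lambda>k. k + q - 1" "\<lambda>l. l - q + 1"])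
    fix l assume l: "l \<in> {q..<q+m}"
    define k where "k = l - q + 1"
    have k: "k \<ge> 1" "l = k + q - 1" using l assms by (auto simp: k_def)
    have "of_nat q - of_nat l = (1 - of_nat k :: complex)" using k assms by (simp add: of_nat_diff)
    then have "Re (zeta_const (of_nat q - of_nat l)) = - ((-1) ^ k * bern k * fact (k - 1))"
      using zeta_const_nonpos[OF k(1)] by simp
    also have "bern k * fact (k - 1) = bernoulli k / real k"
      using k(1) by (simp add: bern_def fact_reduce[of k])
    then have "- ((-1) ^ k * bern k * fact (k - 1)) = - ((-1) ^ k * bernoulli k / real k)"
      by (simp add: mult.assoc)
    finally have "b l = - ((-1) ^ k * bernoulli k / (real k * real l) * c_sum p l x * (1 / real n ^ l))"
      by (simp add: b_def right_term_def)
    then show "- ((-1) ^ (l - q + 1) * bernoulli (l - q + 1) / (real (l - q + 1) * real (l - q + 1 + q - 1)) *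
             (\<Sum>r=1..p. c_coeff p (l - q + 1 + q - 1) r * x ^ (p - r)) * (1 / real n ^ (l - q + 1 + q - 1))) = b l"
      unfolding k_def[symmetric] k(2)[symmetric] c_sum_def by simp
  qed (use assms in auto)
  have "Re ((-1) ^ p * fact p * fps_nth (expansion_fps q L n) p) = (\<Sum>l<L. left_term p q l / real n ^ (l + q))
     + zeta_real (real q) * x ^ p + (\<Sum>l\<in>{1..<L} - {q - 1}. b l)
     + 1 / (real (q - 1) * real n ^ (q - 1)) * (\<Sum>r=0..p. d_coeff p q r * x ^ (p - r))"
    unfolding b_def x_def using assms by (intro Re_nth_expansion_fps) auto
  then show ?thesis
    unfolding A B B1 B2 log_expansion_def x_def[symmetric] left_diff_distrib sum_subtractf
    by (simp add: b_def)
qed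

lemma log_power_bound:
  assumes "n \<ge> 3" "a \<le> b" "M \<le> l"
  shows "ln (real n) ^ a / real n ^ l \<le> ln (real n) ^ b / real n ^ M"
proof -
  have "exp 1 \<le> real n" using exp_le assms by linarith
  then have "ln (real n) \<ge> 1" using assms by (simp add: ln_ge_iff)
  then have "ln (real n) ^ a \<le> ln (real n) ^ b" using assms by (intro power_increasing) auto
  moreover have "real n ^ M \<le> real n ^ l" using assms by (intro power_increasing) auto
  ultimately show ?thesis using assms \<open>ln (real n) \<ge> 1\<close> by (intro frac_le) auto
qed

lemma abs_c_sum_le:
  assumes "n \<ge> 3" "M \<le> l"
  shows "\<bar>c_sum p l (ln (real n)) / real n ^ l\<bar> \<le> (\<Sum>r=1..p. \<bar>c_coeff p l r\<bar>) * (ln (real n) ^ (p - 1) / real n ^ M)"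
proof -
  have "exp 1 \<le> real n" using exp_le assms by linarith
  then have ln: "ln (real n) \<ge> 1" using assms by (simp add: ln_ge_iff)
  have "\<bar>c_sum p l (ln (real n)) / real n ^ l\<bar> = \<bar>\<Sum>r=1..p. c_coeff p l r * (ln (real n) ^ (p - r) / real n ^ l)\<bar>"
    by (simp add: c_sum_def sum_divide_distrib)
  also have "\<dots> \<le> (\<Sum>r=1..p. \<bar>c_coeff p l r * (ln (real n) ^ (p - r) / real n ^ l)\<bar>)" by (rule sum_abs)
  also have "\<dots> \<le> (\<Sum>r=1..p. \<bar>c_coeff p l r\<bar> * (ln (real n) ^ (p - 1) / real n ^ M))"
  proof (rule sum_mono)
    fix r assume "r \<in> {1..p}"
    then have "ln (real n) ^ (p - r) / real n ^ l \<le> ln (real n) ^ (p - 1) / real n ^ M"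
      using assms by (intro log_power_bound) auto
    then have "\<bar>c_coeff p l r\<bar> * (ln (real n) ^ (p - r) / real n ^ l) \<le> \<bar>c_coeff p l r\<bar> * (ln (real n) ^ (p - 1) / real n ^ M)"
      by (rule mult_left_mono) simp
    moreover have "\<bar>c_coeff p l r * (ln (real n) ^ (p - r) / real n ^ l)\<bar> = \<bar>c_coeff p l r\<bar> * (ln (real n) ^ (p - r) / real n ^ l)"
      using ln by (simp add: abs_mult)
    ultimately show "\<bar>c_coeff p l r * (ln (real n) ^ (p - r) / real n ^ l)\<bar> \<le> \<bar>c_coeff p l r\<bar> * (ln (real n) ^ (p - 1) / real n ^ M)"
      by (simp only:)
  qed
  finally show ?thesis unfolding sum_distrib_right .
qed

text \<open>With \<open>q + m + 3\<close> boundary terms the error of \<open>conv_sum_approx\<close> is of smaller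
  order than \<open>n^(-m-q)\<close>. The terms that the expansion up to \<open>L\<close> has in excess carry a factor
  \<open>n^(-l)\<close> with \<open>l \<ge> m + q\<close> and at most the power \<open>p - 1\<close> of the logarithm:
  a right term comes with \<open>rising s l\<close>, which vanishes at \<open>s = 0\<close>, so one of the
  \<open>p\<close> derivatives is spent on it.\<close>
lemma log_expansion_error:
  assumes "q \<ge> 2" "p \<ge> 1"
  shows "(\<lambda>n. log_conv p q n - log_expansion p q m n)
           \<in> O(\<lambda>n. ln (real n) ^ (p - 1) / real n ^ (m + q))"
proof -
  (* At least q + 3 boundary terms are required for conv_sum_approx; m more make 5/2 - q - K less than -(m + q). *)
  define K where "K = q + m + 3"
  define L where "L = q + K"
  obtain C where C: "C \<ge> 0" "\<And>s n. norm s \<le> 1 / 2 \<Longrightarrow> n \<ge> 3 \<Longrightarrow>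
     norm (conv_sum q s n - conv_expansion q L s n) \<le> C * real n powr (5 / 2 - real q - real K)"
    using conv_sum_approx[of q K L] assms by (auto simp: K_def L_def)
  define Z where "Z = (\<lambda>l. \<bar>Re (zeta_const (of_nat q - of_nat l)) / real l\<bar> * (\<Sum>r=1..p. \<bar>c_coeff p l r\<bar>))"
  define A where "A = fact p * C * 2 ^ p + (\<Sum>l=m..<L. \<bar>left_term p q l\<bar>)
     + (\<Sum>l=q+m..<L. Z l)"
  have main: "\<bar>log_conv p q n - log_expansion p q m n\<bar> \<le> A * (ln (real n) ^ (p - 1) / real n ^ (m + q))"
    if n: "n \<ge> 3" for n
  proof -
    define G where "G = ln (real n) ^ (p - 1) / real n ^ (m + q)"
    have G0: "1 / real n ^ l \<le> G" if "m + q \<le> l" for l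
      using log_power_bound[OF n, of 0 "p - 1" "m + q" l] that by (simp add: G_def)
    define e where "e = fps_nth (conv_sum_fps q n - expansion_fps q L n) p"
    define X where "X = (\<Sum>l=m..<L. left_term p q l / real n ^ (l + q))"
    define Y where "Y = (\<Sum>l=q+m..<L. right_term p q l (ln (real n)) / real n ^ l)"
    have "Re ((-1) ^ p * fact p * e) = log_conv p q n - (log_expansion p q m n + X + Y)"
    proof -
      have "Re ((-1) ^ p * fact p * e) = Re ((-1) ^ p * fact p * fps_nth (conv_sum_fps q n) p) - Re ((-1) ^ p * fact p * fps_nth (expansion_fps q L n) p)"
        by (simp only: e_def fps_sub_nth right_diff_distrib minus_complex.simps)
      also have "Re ((-1) ^ p * fact p * fps_nth (expansion_fps q L n) p) = log_expansion p q m n + X + Y"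
        unfolding X_def Y_def using assms n by (intro Re_nth_expansion_fps_eq) (auto simp: L_def K_def)
      finally show ?thesis by (simp only: Re_nth_conv_sum_fps)
    qed
    then have eq: "log_conv p q n - log_expansion p q m n = Re ((-1) ^ p * fact p * e) + X + Y"
      by simp
    have e: "\<bar>Re ((-1) ^ p * fact p * e)\<bar> \<le> fact p * C * 2 ^ p * G"
    proof -
      have "norm e \<le> C * real n powr (5 / 2 - real q - real K) * 2 ^ p"
        unfolding e_def using n assms C(2) by (intro nth_error_fps_bound) auto
      also have "real n powr (5 / 2 - real q - real K) \<le> real n powr (- real (m + q))"
        using n by (intro powr_mono) (auto simp: K_def)
      also have "real n powr (- real (m + q)) = 1 / real n ^ (m + q)"
        using n by (simp only: powr_minus_divide powr_realpow)
      also have "1 / real n ^ (m + q) \<le> G" by (rule G0) simp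
      finally have "norm e \<le> C * G * 2 ^ p" using C(1) by (simp add: mult_left_mono mult_right_mono)
      then have le: "fact p * norm e \<le> fact p * (C * G * 2 ^ p)" by (intro mult_left_mono) auto
      have "\<bar>Re ((-1) ^ p * fact p * e)\<bar> \<le> norm ((-1) ^ p * fact p * e)" by (rule abs_Re_le_cmod)
      also have "\<dots> = fact p * norm e" by (simp add: norm_mult norm_power)
      also note le
      finally show ?thesis by (simp add: mult_ac)
    qed
    have X: "\<bar>X\<bar> \<le> (\<Sum>l=m..<L. \<bar>left_term p q l\<bar>) * G"
    proof -
      have "\<bar>X\<bar> \<le> (\<Sum>l=m..<L. \<bar>left_term p q l / real n ^ (l + q)\<bar>)" unfolding X_def by (rule sum_abs)
      also have "\<dots> \<le> (\<Sum>l=m..<L. \<bar>left_term p q l\<bar> * G)"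
      proof (rule sum_mono)
        fix l assume "l \<in> {m..<L}"
        then have "\<bar>left_term p q l\<bar> * (1 / real n ^ (l + q)) \<le> \<bar>left_term p q l\<bar> * G"
          by (intro mult_left_mono G0) auto
        then show "\<bar>left_term p q l / real n ^ (l + q)\<bar> \<le> \<bar>left_term p q l\<bar> * G" by (simp add: abs_mult)
      qed
      finally show ?thesis by (simp add: sum_distrib_right)
    qed
    have Y: "\<bar>Y\<bar> \<le> (\<Sum>l=q+m..<L. Z l) * G"
    proof -
      have "\<bar>Y\<bar> \<le> (\<Sum>l=q+m..<L. \<bar>right_term p q l (ln (real n)) / real n ^ l\<bar>)"
        unfolding Y_def by (rule sum_abs)
      also have "\<dots> \<le> (\<Sum>l=q+m..<L. Z l * G)"
      proof (rule sum_mono)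
        fix l assume l: "l \<in> {q+m..<L}"
        have "\<bar>right_term p q l (ln (real n)) / real n ^ l\<bar>
            = \<bar>Re (zeta_const (of_nat q - of_nat l)) / real l\<bar> * \<bar>c_sum p l (ln (real n)) / real n ^ l\<bar>"
          by (simp add: right_term_def abs_mult)
        also have "\<dots> \<le> \<bar>Re (zeta_const (of_nat q - of_nat l)) / real l\<bar> * ((\<Sum>r=1..p. \<bar>c_coeff p l r\<bar>) * G)"
          unfolding G_def using n l by (intro mult_left_mono abs_c_sum_le) auto
        finally show "\<bar>right_term p q l (ln (real n)) / real n ^ l\<bar> \<le> Z l * G"
          by (simp add: Z_def mult.assoc)
      qed
      finally show ?thesis by (simp add: sum_distrib_right)
    qed
    have "\<bar>Re ((-1) ^ p * fact p * e) + X + Y\<bar> \<le> \<bar>Re ((-1) ^ p * fact p * e)\<bar> + \<bar>X\<bar> + \<bar>Y\<bar>" by linarith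
    also have "\<dots> \<le> A * G" unfolding A_def distrib_right by (intro add_mono e X Y)
    finally show ?thesis unfolding eq G_def .
  qed
  show ?thesis
  proof (rule bigoI[of _ A], rule eventually_sequentiallyI[of 3])
    fix n :: nat assume n: "3 \<le> n"
    then have "ln (real n) \<ge> 0" by simp
    then show "norm (log_conv p q n - log_expansion p q m n)
       \<le> A * norm (ln (real n) ^ (p - 1) / real n ^ (m + q))"
      using main[OF n] by simp
  qed
qed

lemma log_power_over_power_tendsto_0:
  assumes "l \<ge> 1"
  shows "(\<lambda>n. ln (real n) ^ a / real n ^ l) \<longlonglongrightarrow> 0"
proof (rule Lim_null_comparison)
  (* The bound ln n <= n^e / e is used with e * a < 1/2. *)
  define e where "e = 1 / (2 * (real a + 1))"
  have e: "e > 0" by (simp add: e_def)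
  show "\<forall>\<^sub>F n in sequentially. norm (ln (real n) ^ a / real n ^ l) \<le> (1 / e) ^ a * real n powr (- 1 / 2)"
  proof (rule eventually_sequentiallyI[of 1])
    fix n :: nat assume n: "n \<ge> 1"
    have "ln (real n) ^ a \<le> (real n powr e / e) ^ a" using n e by (intro power_mono ln_powr_bound) auto
    also have "\<dots> = (1 / e) ^ a * real n powr (e * real a)"
      using n by (simp add: power_divide powr_powr flip: powr_realpow)
    also have "\<dots> \<le> (1 / e) ^ a * real n powr (1 / 2)"
      using n e by (intro mult_left_mono powr_mono) (auto simp: e_def field_simps)
    finally have "ln (real n) ^ a / real n ^ l \<le> (1 / e) ^ a * real n powr (1 / 2) / real n ^ 1"
      using n e assms by (intro frac_le power_increasing) auto
    also have "\<dots> = (1 / e) ^ a * (real n powr (1 / 2) * real n powr (-1))"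
      using n by (simp add: powr_minus_divide)
    also have "real n powr (1 / 2) * real n powr (-1) = real n powr (- 1 / 2)"
      unfolding powr_add[symmetric] by simp
    finally show "norm (ln (real n) ^ a / real n ^ l) \<le> (1 / e) ^ a * real n powr (- 1 / 2)" using n by simp
  qed
  show "(\<lambda>n. (1 / e) ^ a * real n powr (- 1 / 2)) \<longlonglongrightarrow> 0"
    by (intro tendsto_mult_right_zero real_powr_tendsto_0) auto
qed

lemma log_polynomial_over_power_tendsto_0:
  assumes "l \<ge> 1"
  shows "(\<lambda>n. c / real n ^ l * (\<Sum>r\<in>R. f r * ln (real n) ^ g r)) \<longlonglongrightarrow> 0"
proof -
  have "(\<lambda>n. \<Sum>r\<in>R. (c * f r) * (ln (real n) ^ g r / real n ^ l)) \<longlonglongrightarrow> 0"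
    by (intro tendsto_null_sum tendsto_mult_right_zero log_power_over_power_tendsto_0 assms)
  then show ?thesis by (simp add: sum_distrib_left mult_ac)
qed

text \<open>All other terms contain a negative power of \<open>n\<close>.\<close>
lemma log_expansion_leading:
  assumes "q \<ge> 2"
  shows "(\<lambda>n. log_expansion p q m n - zeta_real (real q) * ln (real n) ^ p) \<longlonglongrightarrow> 0"
proof -
  have 1: "(\<lambda>n. \<Sum>i=1..q-2. zeta_real (real (q - i)) / (real i * real n ^ i) *
          (\<Sum>r=1..min i p. c_coeff p i r * ln (real n) ^ (p - r))) \<longlonglongrightarrow> 0"
    unfolding divide_divide_eq_left[symmetric]
    by (intro tendsto_null_sum log_polynomial_over_power_tendsto_0) auto
  have 2: "(\<lambda>n. 1 / (real (q - 1) * real n ^ (q - 1)) * (\<Sum>r=0..p. d_coeff p q r * ln (real n) ^ (p - r))) \<longlonglongrightarrow> 0"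
    unfolding divide_divide_eq_left[symmetric]
    using assms by (intro log_polynomial_over_power_tendsto_0) auto
  have aux: "(\<lambda>n. (a * (\<Sum>r\<in>R. f r * ln (real n) ^ g r) - b) * (1 / real n ^ l)) \<longlonglongrightarrow> 0"
    if "l \<ge> 1" for a b l f g and R :: "nat set"
  proof -
    have "(\<lambda>n. b / real n ^ l) \<longlonglongrightarrow> 0"
      using log_polynomial_over_power_tendsto_0[OF that, where c = b and R = "{0::nat}" and f = "\<lambda>_. 1" and g = "\<lambda>_. 0"] by simp
    from tendsto_diff[OF log_polynomial_over_power_tendsto_0[OF that, where c = a and R = R and f = f and g = g] this]
    show ?thesis by (simp add: diff_divide_distrib)
  qed
  have 3: "(\<lambda>n. \<Sum>k=1..m.
          ((-1) ^ k * bernoulli k / (real k * real (k + q - 1)) *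
             (\<Sum>r=1..p. c_coeff p (k + q - 1) r * ln (real n) ^ (p - r))
           - (-1) ^ p * real ((k + q - 2) choose (q - 1)) * zeta_deriv p (1 - real k))
          * (1 / real n ^ (k + q - 1))) \<longlonglongrightarrow> 0"
    using assms by (intro tendsto_null_sum aux) auto
  from tendsto_diff[OF tendsto_add[OF 1 2] 3] show ?thesis
    unfolding log_expansion_def by (simp add: add_diff_eq)
qed

theorem lemma6p4:
  fixes q p m :: nat
  assumes "q \<ge> 2" and "p \<ge> 1" and "m \<ge> 1"
  shows "((\<lambda>n::nat.
            (\<Sum>k=1..n-1. ln (real k) ^ p / real (n - k) ^ q)
            - (zeta_real (real q) * ln (real n) ^ p
               + (\<Sum>i=1..q-2. zeta_real (real (q - i)) / (real i * real n ^ i) *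
                    (\<Sum>r=1..min i p. c_coeff p i r * ln (real n) ^ (p - r)))
               + 1 / (real (q - 1) * real n ^ (q - 1)) *
                    (\<Sum>r=0..p. d_coeff p q r * ln (real n) ^ (p - r))
               - (\<Sum>k=1..m.
                    ((-1) ^ k * bernoulli k / (real k * real (k + q - 1)) *
                       (\<Sum>r=1..p. c_coeff p (k + q - 1) r * ln (real n) ^ (p - r))
                     - (-1) ^ p * real ((k + q - 2) choose (q - 1)) * zeta_deriv p (1 - real k))
                    * (1 / real n ^ (k + q - 1)))))
         \<in> O(\<lambda>n. ln (real n) ^ (p - 1) / real n ^ (m + q)))
         \<and> ((\<lambda>n::nat. (\<Sum>k=1..n-1. ln (real k) ^ p / real (n - k) ^ q)
                   - zeta_real (real q) * ln (real n) ^ p) \<longlonglongrightarrow> 0)"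
proof -
  have range: "(\<Sum>k=1..n-1. ln (real k) ^ p / real (n - k) ^ q) = log_conv p q n" for n
    unfolding log_conv_def by (rule sum.cong) auto
  note error = log_expansion_error[OF assms(1,2), of m]
  have "(\<lambda>n. ln (real n) ^ (p - 1) / real n ^ (m + q)) \<longlonglongrightarrow> 0"
    using assms by (intro log_power_over_power_tendsto_0) auto
  then have g: "(\<lambda>n. c * norm (ln (real n) ^ (p - 1) / real n ^ (m + q))) \<longlonglongrightarrow> 0" for c
    by (intro tendsto_mult_right_zero tendsto_norm_zero)
  from error obtain c where
    "\<forall>\<^sub>F n in sequentially. norm (log_conv p q n - log_expansion p q m n)
       \<le> c * norm (ln (real n) ^ (p - 1) / real n ^ (m + q))"
    by (rule landau_o.bigE)
  from Lim_null_comparison[OF this g]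
  have "(\<lambda>n. log_conv p q n - log_expansion p q m n) \<longlonglongrightarrow> 0" .
  from tendsto_add[OF this log_expansion_leading[OF assms(1), of p m]]
  have "(\<lambda>n. log_conv p q n - zeta_real (real q) * ln (real n) ^ p) \<longlonglongrightarrow> 0" by simp
  with error show ?thesis unfolding range log_expansion_def by blast
qed

end
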